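(* Let $E$ be the elliptic curve over $\mathbb{Q}$ defined by $y^2=x^3+x-1$, and let $g=(1,1)\in E(\mathbb{Q})$. Write $(x_1,y_1)\times(x_2,y_2)$ for affine coordinates on $E^2\subseteq\mathbb{P}_2^2$, so that $E^2$ is given by $y_1^2=x_1^3+x_1-1$ and $y_2^2=x_2^3+x_2-1$. For each integer $n\ge1$ let $\mathcal{C}_n\subseteq E^2$ be the curve defined via the additional equation $x_1^n=y_2$. Then for every $n\geq 1$, if $P\in \mathcal{C}_n(\mathbb{Q})$ we have \[\hat{h}(P)\leq 8.253\cdot 10^{38} (n+1)^3.\] Moreover, writing $P=([a]g,[b]g)$ with integers $a,b$, the following inequalities hold: \[|a|\leq 7.037\cdot 10^{19}(n+1)\] and \[|b|\leq \left(\frac{3na^2}{2}+14\log 2+10\right)^{\frac{1}{2}}.\]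
   Context: The group $E(\mathbb{Q})$ has rank $1$, is torsion-free, and is generated by $g=(1,1)$, so every point of $E^2(\mathbb{Q})$ can be written uniquely as $([a]g,[b]g)$ with $a,b\in\mathbb{Z}$. The curve $\mathcal{C}_n$ is the Zariski closure in $E^2$ of the affine curve given by the equations $y_1^2=x_1^3+x_1-1$, $y_2^2=x_2^3+x_2-1$ and $x_1^n=y_2$. The Néron-Tate height on $E$ is normalized by $\hat h(P)=\lim_{m\to\infty}4^{-m}\cdot\frac12 h(x([2^m]P))$, where $h$ is the logarithmic Weil height of an algebraic number, and on $E^2$ by $\hat h(P_1,P_2)=\hat h(P_1)+\hat h(P_2)$. *)

theory Defs
  imports Complex_Main "HOL.Hull"
begin

section \<open>The elliptic curve $E : y^2 = x^3 + x - 1$\<close>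

datatype 'a point = Infty | Aff 'a 'a

definition ell_curve :: "'a::field_char_0 point set"
  where "ell_curve = {Infty} \<union> {Aff x y |x y. y ^ 2 = x ^ 3 + x - 1}"

fun ell_neg :: "'a::field_char_0 point \<Rightarrow> 'a point"
  where
    "ell_neg Infty = Infty"
  | "ell_neg (Aff x y) = Aff x (- y)"

text \<open>Chord--tangent addition. For points of the curve with equal abscissae that are not
  opposite to each other, the two points coincide and \<open>y1 \<noteq> 0\<close>, so that the tangent
  slope is a genuine quotient.\<close>

fun ell_add :: "'a::field_char_0 point \<Rightarrow> 'a point \<Rightarrow> 'a point"
  where
    "ell_add Infty Q = Q"
  | "ell_add (Aff x1 y1) Infty = Aff x1 y1"
  | "ell_add (Aff x1 y1) (Aff x2 y2) =
      (if x1 = x2 \<and> y1 = - y2 then Infty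
       else
         let l = (if x1 = x2 then (3 * x1 ^ 2 + 1) / (2 * y1) else (y2 - y1) / (x2 - x1));
             x3 = l ^ 2 - x1 - x2
         in Aff x3 (l * (x1 - x3) - y1))"

definition ell_mult :: "int \<Rightarrow> 'a::field_char_0 point \<Rightarrow> 'a point"
  where "ell_mult a P =
    (if a \<ge> 0 then (ell_add P ^^ nat a) Infty else ell_neg ((ell_add P ^^ nat (- a)) Infty))"

definition gen :: "rat point"
  where "gen = Aff 1 1"

lemma gen_in_ell_curve: "gen \<in> ell_curve"
  by (simp add: gen_def ell_curve_def)

lemma ell_mult_2_gen: "ell_mult 2 gen = Aff 2 (- 3)"
  by (simp add: ell_mult_def gen_def numeral_2_eq_2)


section \<open>The Zariski topology on $E^2 \subseteq P_2 \times P_2$\<close>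

fun hom_coords :: "'a::field_char_0 point \<Rightarrow> 'a \<times> 'a \<times> 'a"
  where
    "hom_coords Infty = (0, 1, 0)"
  | "hom_coords (Aff x y) = (x, y, 1)"

fun monomial :: "nat \<times> nat \<times> nat \<Rightarrow> 'a \<times> 'a \<times> 'a \<Rightarrow> 'a::comm_semiring_1"
  where "monomial (i, j, k) (X, Y, Z) = X ^ i * Y ^ j * Z ^ k"

definition exponents :: "nat \<Rightarrow> (nat \<times> nat \<times> nat) set"
  where "exponents d = {(i, j, k). i + j + k = d}"

lemma finite_exponents: "finite (exponents d)"
  by (rule finite_subset[of _ "{..d} \<times> {..d} \<times> {..d}"]) (auto simp: exponents_def)

text \<open>A bihomogeneous form of bidegree \<open>(d, e)\<close> in two triples of variables is given by its
  coefficient family \<open>c\<close>.\<close>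

definition eval_form ::
  "nat \<times> nat \<times> (nat \<times> nat \<times> nat \<Rightarrow> nat \<times> nat \<times> nat \<Rightarrow> 'a) \<Rightarrow>
    'a point \<times> 'a point \<Rightarrow> 'a::field_char_0"
  where "eval_form = (\<lambda>(d, e, c) (P, Q).
    \<Sum>u\<in>exponents d. \<Sum>v\<in>exponents e.
      c u v * monomial u (hom_coords P) * monomial v (hom_coords Q))"

definition zariski_closed :: "('a::field_char_0 point \<times> 'a point) set \<Rightarrow> bool"
  where "zariski_closed Z \<longleftrightarrow>
    (\<exists>F. Z = {R \<in> ell_curve \<times> ell_curve. \<forall>f\<in>F. eval_form f R = 0})"


section \<open>The curves $C_n$ and their rational points\<close>

text \<open>The closure is geometric: it is taken among points with complex coordinates, where the
  affine curve has all its points. Rational points are the points of the closure with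
  rational coordinates.\<close>

definition affine_C :: "nat \<Rightarrow> (complex point \<times> complex point) set"
  where "affine_C n = {(Aff x1 y1, Aff x2 y2) |x1 y1 x2 y2.
    y1 ^ 2 = x1 ^ 3 + x1 - 1 \<and> y2 ^ 2 = x2 ^ 3 + x2 - 1 \<and> x1 ^ n = y2}"

definition curve_C :: "nat \<Rightarrow> (complex point \<times> complex point) set"
  where "curve_C n = zariski_closed hull affine_C n"

definition rational_C :: "nat \<Rightarrow> (rat point \<times> rat point) set"
  where "rational_C n =
    {(P, Q). (map_point of_rat P, map_point of_rat Q) \<in> curve_C n}"


section \<open>Heights\<close>

text \<open>Only points of \<open>E(\<rat>)\<close> occur, so the logarithmic Weil height is needed on the
  rationals alone, where it is $\log \max(|p|, |q|)$ for a fraction $p/q$ in lowest terms.\<close>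

definition weil_height :: "rat \<Rightarrow> real"
  where "weil_height r = (case quotient_of r of (p, q) \<Rightarrow> ln (real_of_int (max \<bar>p\<bar> \<bar>q\<bar>)))"

text \<open>At the point at infinity the \<open>x\<close>-coordinate is \<open>(1 : 0)\<close>, whose height is \<open>0\<close>.\<close>

fun x_height :: "rat point \<Rightarrow> real"
  where
    "x_height Infty = 0"
  | "x_height (Aff x y) = weil_height x"

definition neron_tate :: "rat point \<Rightarrow> real"
  where "neron_tate P = lim (\<lambda>m. (1 / 2 * x_height (ell_mult (2 ^ m) P)) / 4 ^ m)"

definition neron_tate2 :: "rat point \<times> rat point \<Rightarrow> real"
  where "neron_tate2 = (\<lambda>(P, Q). neron_tate P + neron_tate Q)"

end

theory Submission
  imports Defs "HOL-Computational_Algebra.Primes" "HOL-Computational_Algebra.Polynomial"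
begin

text \<open>
  The group \<open>E(\<rat>)\<close> is generated by \<open>g\<close>: writing \<open>x = p / q ^ 2\<close>, the element \<open>p - q ^ 2 \<alpha>\<close> of the
  norm-Euclidean ring \<open>\<int>[\<alpha>]\<close>, \<open>\<alpha> ^ 3 + \<alpha> = 1\<close>, is a unit times a square, and modulo squares the
  units of positive norm are represented by \<open>1\<close> and \<open>\<alpha>\<close>; hence every point is \<open>2 Q\<close> or \<open>2 Q - g\<close>, and descent
  with the canonical height finishes the proof.

  For a point \<open>([a]g, [b]g)\<close> of \<open>C_n\<close>, comparing denominators and sizes in \<open>x1 ^ n = y2\<close> gives
  \<open>3/2 h(x2) \<le> n h(x1)\<close>, which bounds \<open>b\<close> in terms of \<open>a\<close>. To bound \<open>a\<close>, put \<open>z = x / y\<close>. At every place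
  where \<open>z1 = z([a]g)\<close> is small, \<open>z2 = z([b]g)\<close> is small as well, and \<open>[b][a]g = [a][b]g\<close> forces
  \<open>b z1\<close> and \<open>a z2\<close> to have the same size. As \<open>x1 ^ n = y2\<close> makes \<open>|z2| = |z1| ^ (2n/3)\<close>, where \<open>2n/3\<close> is
  never \<open>1\<close>, this bounds the height of \<open>x1\<close> by a power of \<open>max |a| |b|\<close>, whereas it grows like the
  exponential of a multiple of \<open>a ^ 2\<close>.
\<close>

section \<open>The group law\<close>

text \<open>The existence of a and b is part of the conclusion, so the Mordell-Weil group has to be
  computed with explicit constants: the descent must stop inside a set of points that can be listed,
  here those of height at most 8, and this requires a numerical upper bound for the canonical height
  of g. The bound for b has a constant term that does not grow with n, although n multiplies the
  error between naive and canonical height. The comparison of the heights of x1 and x2 is therefore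
  kept exact, and the one remaining error is absorbed by enlarging 2 a^2 to 9/2 a^2 in the height of
  [a]g, since 2n/3 * 9/4 = 3n/2. The local comparisons rest on z(P + Q) - z(P) - z(Q) being of fifth
  order. At a prime l this makes multiplication by l raise the valuation of z by exactly one
  whenever that valuation is at least 1, with no exception at l = 2 or l = 3. The resulting bound
  10^6 (n + 1) for a lies far below the one claimed, which leaves room for estimates as crude as ln
  A \<le> A - 1.\<close>

lemma curve_lowest_terms:
  fixes y :: rat
  assumes "y ^ 2 = x ^ 3 + x - 1"
  shows "\<exists>p r q::int. q > 0 \<and> coprime p q \<and> coprime r q \<and> x = of_int p / of_int q ^ 2 \<and> y = of_int r / of_int q ^ 3 \<and> r ^ 2 = p ^ 3 + p * q ^ 4 - q ^ 6"
proof -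
  obtain m e where me: "quotient_of x = (m, e)" by (cases "quotient_of x")
  obtain u f where uf: "quotient_of y = (u, f)" by (cases "quotient_of y")
  have x: "x = of_int m / of_int e" and e: "e > 0" and cme: "coprime m e"
    using quotient_of_div[OF me] quotient_of_denom_pos[OF me] quotient_of_coprime[OF me] by auto
  have y: "y = of_int u / of_int f" and f: "f > 0" and cuf: "coprime u f"
    using quotient_of_div[OF uf] quotient_of_denom_pos[OF uf] quotient_of_coprime[OF uf] by auto
  have "of_int (u ^ 2 * e ^ 3) = (of_int (f ^ 2 * (m ^ 3 + m * e ^ 2 - e ^ 3)) :: rat)"
    using assms e f by (simp add: x y field_simps power2_eq_square power3_eq_cube)
  then have eq: "u ^ 2 * e ^ 3 = f ^ 2 * (m ^ 3 + m * e ^ 2 - e ^ 3)"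
    by (simp only: of_int_eq_iff)
  have "coprime (m ^ 3) e" using cme by simp
  have split: "m ^ 3 + m * e ^ 2 - e ^ 3 = m ^ 3 + e * (m * e - e ^ 2)"
    by (simp add: algebra_simps power2_eq_square power3_eq_cube)
  have c1: "coprime (m ^ 3 + m * e ^ 2 - e ^ 3) e"
    using \<open>coprime (m ^ 3) e\<close> gcd_add_mult[of e "m * e - e ^ 2" "m ^ 3"] unfolding split
    by (simp add: coprime_iff_gcd_eq_1 gcd.commute add.commute mult.commute)
  have d1: "f ^ 2 dvd e ^ 3"
    using dvd_triv_left[of "f ^ 2" "m ^ 3 + m * e ^ 2 - e ^ 3"] cuf unfolding eq[symmetric]
    by (subst (asm) coprime_dvd_mult_right_iff) (auto simp: coprime_commute)
  have d2: "e ^ 3 dvd f ^ 2"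
    using dvd_triv_right[of "e ^ 3" "u ^ 2"] c1 unfolding eq
    by (subst (asm) coprime_dvd_mult_left_iff) (auto simp: coprime_commute)
  \<comment> \<open>Numerators prime to the denominators make the square and the cube divide each
    other. The quotient \<open>f / e\<close> is then an integer whose square is \<open>e\<close> and
    whose cube is \<open>f\<close>.\<close>
  have fe: "f ^ 2 = e ^ 3" using d1 d2 e f by (simp add: zdvd_antisym_nonneg)
  have "e ^ 2 dvd f ^ 2" using fe by (simp add: le_imp_power_dvd)
  then have "e dvd f" by simp
  then obtain q where q: "f = e * q" by (auto simp: dvd_def)
  have eq2: "e = q ^ 2" using fe e by (simp add: q power2_eq_square power3_eq_cube)
  have qpos: "q > 0" using q e f by (simp add: zero_less_mult_iff)
  have fq: "f = q ^ 3" using q eq2 by (simp add: power2_eq_square power3_eq_cube)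
  have "coprime m q" using cme eq2 by simp
  moreover have "coprime u q" using cuf fq by simp
  moreover have "u ^ 2 = m ^ 3 + m * q ^ 4 - q ^ 6"
    using eq fe e by (simp add: eq2 flip: power_mult)
  moreover have "x = of_int m / of_int q ^ 2" "y = of_int u / of_int q ^ 3"
    using x y eq2 fq by simp_all
  ultimately show ?thesis using qpos by blast
qed

lemma curve_pos:
  fixes x :: "'a::linordered_field"
  assumes "y ^ 2 = x ^ 3 + x - 1"
  shows "x > 0"
proof (rule ccontr)
  assume "\<not> x > 0"
  then have "x ^ 3 \<le> 0" by (simp add: power3_eq_cube mult_nonneg_nonpos mult_nonneg_nonpos2 zero_le_mult_iff mult_nonpos_nonneg)
  then show False using assms \<open>\<not> x > 0\<close> zero_le_power2[of y] by linarith
qed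

text \<open>Rational root test: y = 0 would make p and q units. Because y never vanishes, tangent
  slopes and the coordinate x / y are genuine quotients.\<close>

lemma no_two_torsion:
  fixes y :: rat
  assumes "y ^ 2 = x ^ 3 + x - 1"
  shows "y \<noteq> 0"
proof
  assume "y = 0"
  obtain p r q :: int where *: "q > 0" "coprime p q" "y = of_int r / of_int q ^ 3" "r ^ 2 = p ^ 3 + p * q ^ 4 - q ^ 6"
    using curve_lowest_terms[OF assms] by blast
  with \<open>y = 0\<close> have "r = 0" by simp
  then have eq: "q ^ 6 = p ^ 3 + p * q ^ 4" using * by simp
  have "p * (p ^ 2 + q ^ 4) = q ^ 6" using eq by (simp add: algebra_simps power2_eq_square power3_eq_cube)
  then have "p dvd q ^ 6" by (metis dvd_triv_left)
  then have "is_unit p" using *(2) by (metis coprime_common_divisor coprime_power_right_iff dvd_refl)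
  have "q dvd p ^ 3"
  proof -
    have "p ^ 3 = q * (q ^ 5 - p * q ^ 3)" using eq by (simp add: algebra_simps power_numeral_reduce)
    then show ?thesis by simp
  qed
  then have "is_unit q" using *(2) by (metis coprime_common_divisor coprime_commute coprime_power_right_iff dvd_refl)
  then have "q = 1" using *(1) by simp
  moreover have "p = 1 \<or> p = - 1" using \<open>is_unit p\<close> by (auto simp: abs_if split: if_splits)
  ultimately show False using eq by auto
qed

lemma ell_curve_Aff: "Aff x y \<in> ell_curve \<longleftrightarrow> y ^ 2 = x ^ 3 + x - 1"
  by (auto simp: ell_curve_def)

lemma Infty_in_ell_curve: "Infty \<in> ell_curve"
  by (simp add: ell_curve_def)

lemma ell_add_Infty_right: "ell_add P Infty = P"
  by (cases P) auto

lemma ell_neg_neg: "ell_neg (ell_neg P) = P"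
  by (cases P) auto

lemma ell_neg_in: "P \<in> ell_curve \<Longrightarrow> ell_neg P \<in> ell_curve"
  by (cases P) (auto simp: ell_curve_Aff Infty_in_ell_curve)

lemma ell_add_neg: "ell_add P (ell_neg P) = Infty"
  by (cases P) auto

lemma ell_neg_add: "ell_add (ell_neg P) P = Infty"
  by (cases P) auto

text \<open>Both points and the negative of their sum lie on the line \<open>y = l x + c\<close>; the last three
  conditions are Vieta's relations for the cubic \<open>x ^ 3 + x - 1 - (l x + c) ^ 2\<close>.\<close>

definition chord :: "rat \<Rightarrow> rat \<Rightarrow> rat \<Rightarrow> rat \<Rightarrow> rat \<Rightarrow> rat \<Rightarrow> rat \<Rightarrow> rat \<Rightarrow> bool"
  where "chord l c x1 y1 x2 y2 x3 y3 \<longleftrightarrow>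
    y1 = l * x1 + c \<and> y2 = l * x2 + c \<and> y3 = - (l * x3 + c) \<and> x1 + x2 + x3 = l ^ 2 \<and>
    x1 * x2 + x1 * x3 + x2 * x3 = 1 - 2 * l * c \<and> x1 * x2 * x3 = 1 + c ^ 2"

lemma ell_add_chord:
  assumes c1: "y1 ^ 2 = x1 ^ 3 + x1 - 1" and c2: "y2 ^ 2 = x2 ^ 3 + x2 - 1"
    and n: "\<not> (x1 = x2 \<and> y1 = - y2)"
  shows "\<exists>l c x3 y3. ell_add (Aff x1 y1) (Aff x2 y2) = Aff x3 y3 \<and> chord l c x1 y1 x2 y2 x3 y3 \<and>
     (x1 = x2 \<longrightarrow> 2 * y1 * l = 3 * x1 ^ 2 + 1)"
proof (cases "x1 = x2")
  case True
  have "y1 ^ 2 = y2 ^ 2" using c1 c2 True by simp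
  then have y: "y1 = y2" using n True by (auto simp: power2_eq_iff)
  have y0: "y1 \<noteq> 0" using no_two_torsion[OF c1] .
  define l where "l = (3 * x1 ^ 2 + 1) / (2 * y1)"
  have l: "2 * y1 * l = 3 * x1 ^ 2 + 1" using y0 by (simp add: l_def)
  define x3 where "x3 = l ^ 2 - x1 - x2"
  define c where "c = y1 - l * x1"
  have 1: "x1 * x2 + x1 * x3 + x2 * x3 = 1 - 2 * l * c"
  proof -
    have "2 * x1 * (l ^ 2) - 3 * x1 ^ 2 = 1 - 2 * l * y1 + 2 * l ^ 2 * x1"
      using l by algebra
    then show ?thesis unfolding x3_def c_def True[symmetric] by algebra
  qed
  have 2: "x1 * x2 * x3 = 1 + c ^ 2"
    unfolding x3_def c_def True[symmetric] using l c1 by algebra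
  have "ell_add (Aff x1 y1) (Aff x2 y2) = Aff x3 (l * (x1 - x3) - y1)"
    using n True by (simp add: Let_def l_def x3_def)
  moreover have "chord l c x1 y1 x2 y2 x3 (l * (x1 - x3) - y1)"
    using 1 2 True y by (simp add: chord_def c_def x3_def algebra_simps)
  ultimately show ?thesis using l by blast
next
  case False
  define l where "l = (y2 - y1) / (x2 - x1)"
  have l: "l * (x2 - x1) = y2 - y1" using False by (simp add: l_def)
  define x3 where "x3 = l ^ 2 - x1 - x2"
  define c where "c = y1 - l * x1"
  have y1: "y1 = l * x1 + c" and y2: "y2 = l * x2 + c" using l by (simp_all add: c_def algebra_simps)
  have "(x2 - x1) * (x1 * x2 + x1 * x3 + x2 * x3 - (1 - 2 * l * c)) = 0"
    using c1 c2 unfolding y1 y2 x3_def by algebra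
  then have 1: "x1 * x2 + x1 * x3 + x2 * x3 = 1 - 2 * l * c" using False by simp
  have 2: "x1 * x2 * x3 = 1 + c ^ 2"
    using 1 c1 unfolding y1 x3_def by algebra
  have "ell_add (Aff x1 y1) (Aff x2 y2) = Aff x3 (l * (x1 - x3) - y1)"
    using n False by (simp add: Let_def l_def x3_def)
  moreover have "chord l c x1 y1 x2 y2 x3 (l * (x1 - x3) - y1)"
    using 1 2 y1 y2 by (simp add: chord_def x3_def algebra_simps)
  ultimately show ?thesis using False by blast
qed

lemma chord_on_curve:
  assumes "chord l c x1 y1 x2 y2 x3 y3"
  shows "y1 ^ 2 = x1 ^ 3 + x1 - 1" "y2 ^ 2 = x2 ^ 3 + x2 - 1" "y3 ^ 2 = x3 ^ 3 + x3 - 1"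
proof -
  have y: "y1 = l * x1 + c" "y2 = l * x2 + c" "y3 = - (l * x3 + c)"
    and v: "x1 + x2 + x3 = l ^ 2" "x1 * x2 + x1 * x3 + x2 * x3 = 1 - 2 * l * c" "x1 * x2 * x3 = 1 + c ^ 2"
    using assms by (simp_all add: chord_def)
  show "y1 ^ 2 = x1 ^ 3 + x1 - 1" using v unfolding y by algebra
  show "y2 ^ 2 = x2 ^ 3 + x2 - 1" using v unfolding y by algebra
  show "y3 ^ 2 = x3 ^ 3 + x3 - 1" using v unfolding y by algebra
qed

lemma ell_add_in:
  fixes P Q :: "rat point"
  assumes "P \<in> ell_curve" "Q \<in> ell_curve"
  shows "ell_add P Q \<in> ell_curve"
proof (cases P; cases Q)
  fix x1 y1 x2 y2
  assume PQ: "P = Aff x1 y1" "Q = Aff x2 y2"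
  show ?thesis
  proof (cases "x1 = x2 \<and> y1 = - y2")
    case True then show ?thesis by (simp add: PQ Infty_in_ell_curve)
  next
    case False
    obtain l c x3 y3 where "ell_add P Q = Aff x3 y3" "chord l c x1 y1 x2 y2 x3 y3"
      using ell_add_chord[OF _ _ False] assms unfolding PQ ell_curve_Aff by metis
    then show ?thesis using chord_on_curve(3) by (simp add: ell_curve_Aff)
  qed
qed (use assms in auto)

lemma ell_add_commute:
  fixes P Q :: "rat point"
  assumes "P \<in> ell_curve" "Q \<in> ell_curve"
  shows "ell_add P Q = ell_add Q P"
proof (cases P; cases Q)
  fix x1 y1 x2 y2
  assume PQ: "P = Aff x1 y1" "Q = Aff x2 y2"
  show ?thesis
  proof (cases "x1 = x2")
    case True
    then have "y1 ^ 2 = y2 ^ 2" using assms by (simp add: PQ ell_curve_Aff)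
    then have "y1 = y2 \<or> y1 = - y2" by (simp add: power2_eq_iff)
    then show ?thesis unfolding PQ using True by (auto simp: Let_def)
  next
    case False
    define l where "l = (y2 - y1) / (x2 - x1)"
    have "(y1 - y2) / (x1 - x2) = l"
      unfolding l_def by (metis minus_diff_eq minus_divide_divide)
    moreover have "l * (x2 - x1) = y2 - y1" using False by (simp add: l_def)
    then have "l * (x1 - t) - y1 = l * (x2 - t) - y2" for t by (simp add: algebra_simps)
    moreover have "l ^ 2 - x2 - x1 = l ^ 2 - x1 - x2" by simp
    ultimately show ?thesis unfolding PQ using False
      by (simp only: ell_add.simps Let_def l_def[symmetric] if_False simp_thms point.inject) simp
  qed
qed auto


lemma ell_neg_add_distrib:
  fixes P Q :: "rat point"
  shows "ell_neg (ell_add P Q) = ell_add (ell_neg P) (ell_neg Q)"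
proof (cases P; cases Q)
  fix x1 y1 x2 y2
  assume PQ: "P = Aff x1 y1" "Q = Aff x2 y2"
  have "(- y2 - - y1) / (x2 - x1) = - ((y2 - y1) / (x2 - x1))"
    by (simp add: minus_divide_left)
  then show ?thesis
    unfolding PQ by (auto simp: Let_def algebra_simps)
qed auto

text \<open>A double root of x^3 + x - 1 - (l x + c)^2 is also a root of its derivative.\<close>

lemma chord_tangent:
  assumes "chord l c x1 y1 x2 y2 x2 y3"
  shows "2 * y2 * l = 3 * x2 ^ 2 + 1"
proof -
  have "y2 = l * x2 + c" "x1 + x2 + x2 = l ^ 2" "x1 * x2 + x1 * x2 + x2 * x2 = 1 - 2 * l * c"
    using assms by (simp_all add: chord_def)
  then show ?thesis by algebra
qed

text \<open>P + Q and -Q lie on the mirrored line y = -l x - c, whose third point is -P. Only the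
  slope needs care: if the abscissae of P + Q and Q agree, it has to be obtained from
  tangency.\<close>

lemma ell_add_cancel:
  fixes P Q :: "rat point"
  assumes "P \<in> ell_curve" "Q \<in> ell_curve"
  shows "ell_add (ell_add P Q) (ell_neg Q) = P"
proof (cases P; cases Q)
  fix x1 y1 x2 y2
  assume PQ: "P = Aff x1 y1" "Q = Aff x2 y2"
  have c1: "y1 ^ 2 = x1 ^ 3 + x1 - 1" and c2: "y2 ^ 2 = x2 ^ 3 + x2 - 1"
    using assms by (simp_all add: PQ ell_curve_Aff)
  show ?thesis
  proof (cases "x1 = x2 \<and> y1 = - y2")
    case True then show ?thesis by (simp add: PQ)
  next
    case False
    obtain l c x3 y3 where s: "ell_add P Q = Aff x3 y3" and ch: "chord l c x1 y1 x2 y2 x3 y3"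
      using ell_add_chord[OF c1 c2 False] unfolding PQ by metis
    have c3: "y3 ^ 2 = x3 ^ 3 + x3 - 1" and c2': "(- y2) ^ 2 = x2 ^ 3 + x2 - 1"
      using chord_on_curve[OF ch] by simp_all
    have y2: "y2 \<noteq> 0" using no_two_torsion[OF c2] .
    have n: "\<not> (x3 = x2 \<and> y3 = - (- y2))"
      using ch y2 by (auto simp: chord_def)
    obtain l' c' x' y' where s': "ell_add (Aff x3 y3) (Aff x2 (- y2)) = Aff x' y'"
      and ch': "chord l' c' x3 y3 x2 (- y2) x' y'" and tg: "x3 = x2 \<longrightarrow> 2 * y3 * l' = 3 * x3 ^ 2 + 1"
      using ell_add_chord[OF c3 c2' n] by metis
    have l': "l' = - l"
    proof (cases "x3 = x2")
      case True
      then have "y3 = - y2" using ch by (auto simp: chord_def)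
      then have "2 * y2 * (- l') = 2 * y2 * l" using True tg chord_tangent[of l c x1 y1 x2 y2 y3] ch by simp
      then have "- l' = l" using y2 by (simp only: mult_cancel_left) simp
      then show ?thesis by simp
    next
      case False
      have "y3 = - (l * x3 + c)" "y2 = l * x2 + c" "y3 = l' * x3 + c'" "- y2 = l' * x2 + c'"
        using ch ch' by (simp_all add: chord_def)
      then have "(l' + l) * (x3 - x2) = 0" by algebra
      then show ?thesis using False by (simp add: add_eq_0_iff2)
    qed
    have "c' = - c" using ch ch' l' by (simp add: chord_def)
    then have "x' = x1 \<and> y' = y1" using ch ch' l' unfolding chord_def by simp
    then show ?thesis using s s' by (simp add: PQ)
  qed
qed (auto simp: ell_add_Infty_right)

text \<open>The product of the two lines used to form \<open>(P1 + P2) + P3\<close>, divided by \<open>x - xA\<close>, is a function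
  \<open>x ^ 2 + \<beta> x + \<gamma> - s y\<close> vanishing at \<open>P1\<close>, \<open>P2\<close>, \<open>P3\<close> and at the negative of the sum. Such a
  function is determined by the three points, in any order; this gives associativity.\<close>

lemma chord_chord:
  assumes c1: "chord l c x1 y1 x2 y2 xA yA" and c2: "chord k d xA yA x3 y3 xT yT"
    and "s = l + k" "\<beta> = l * k + xA" "\<gamma> = 1 + l * d + c * k + xA * \<beta>"
  shows "s * y1 = x1 ^ 2 + \<beta> * x1 + \<gamma>" "s * y2 = x2 ^ 2 + \<beta> * x2 + \<gamma>" "s * y3 = x3 ^ 2 + \<beta> * x3 + \<gamma>"
    "- s * yT = xT ^ 2 + \<beta> * xT + \<gamma>" "xT = s ^ 2 - 2 * \<beta> - x1 - x2 - x3"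
    "2 * x1 + \<beta> = s * l \<or> x1 \<noteq> x2"
    "x2 = x3 \<Longrightarrow> y2 = y3 \<Longrightarrow> 2 * y2 * (2 * x2 + \<beta>) = s * (3 * x2 ^ 2 + 1)"
proof -
  have y: "y1 = l * x1 + c" "y2 = l * x2 + c" "yA = - (l * xA + c)" "yA = k * xA + d"
      "y3 = k * x3 + d" "yT = - (k * xT + d)"
    and v1: "x1 + x2 + xA = l ^ 2" "x1 * x2 + x1 * xA + x2 * xA = 1 - 2 * l * c"
    and v2: "xA + x3 + xT = k ^ 2" "xA * x3 + xA * xT + x3 * xT = 1 - 2 * k * d"
    using c1 c2 by (simp_all add: chord_def)
  have d: "d = - (l + k) * xA - c" using y(3,4) by algebra
  have c: "c = - (l + k) * xA - d" using y(3,4) by algebra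
  have g: "\<gamma> = 1 + l * d + c * k + xA * (l * k + xA)" using assms by simp
  have "l ^ 2 * (x1 + xA) + 2 * l * c - 1 = x1 ^ 2 + x1 * xA + xA ^ 2"
    using v1 by algebra
  then show "s * y1 = x1 ^ 2 + \<beta> * x1 + \<gamma>"
    unfolding assms(3,4) g y(1) d by algebra
  have "l ^ 2 * (x2 + xA) + 2 * l * c - 1 = x2 ^ 2 + x2 * xA + xA ^ 2"
    using v1 by algebra
  then show 2: "s * y2 = x2 ^ 2 + \<beta> * x2 + \<gamma>"
    unfolding assms(3,4) g y(2) d by algebra
  have "k ^ 2 * (x3 + xA) + 2 * k * d - 1 = x3 ^ 2 + x3 * xA + xA ^ 2"
    using v2 by algebra
  then show "s * y3 = x3 ^ 2 + \<beta> * x3 + \<gamma>"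
    unfolding assms(3,4) g y(5) c by algebra
  have "k ^ 2 * (xT + xA) + 2 * k * d - 1 = xT ^ 2 + xT * xA + xA ^ 2"
    using v2 by algebra
  then show "- s * yT = xT ^ 2 + \<beta> * xT + \<gamma>"
    unfolding assms(3,4) g y(6) c by algebra
  show "xT = s ^ 2 - 2 * \<beta> - x1 - x2 - x3"
    using v1(1) v2(1) unfolding assms(3,4) by algebra
  \<comment> \<open>At a repeated point the function has to vanish to second order. This is its
    derivative along the line of slope \<open>l\<close>; the last clause is the analogue for P2 =
    P3, with the tangent slope written out.\<close>
  show "2 * x1 + \<beta> = s * l \<or> x1 \<noteq> x2"
  proof (cases "x1 = x2")
    case True
    then have "2 * x1 + \<beta> = s * l" using v1(1) unfolding assms(3,4)
      by (simp add: power2_eq_square algebra_simps)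
    then show ?thesis ..
  qed simp
  show "2 * y2 * (2 * x2 + \<beta>) = s * (3 * x2 ^ 2 + 1)" if "x2 = x3" "y2 = y3"
  proof -
    have yk: "y2 = k * x2 + d" using y(5) that by simp
    have "2 * y2 = s * (x2 - xA)" using y(2) yk unfolding assms(3) d by algebra
    moreover have "(x2 - xA) * (2 * x2 + \<beta>) = 3 * x2 ^ 2 + 1"
    proof -
      have "(x2 - xA) * (2 * x2 + \<beta>) = 3 * x2 ^ 2 + 1 + l * (k * x2 + d) + k * (l * x2 + c) - (x2 ^ 2 + \<beta> * x2 + \<gamma>)"
        unfolding assms(4) g by algebra
      also have "\<dots> = 3 * x2 ^ 2 + 1"
        unfolding 2[symmetric] yk[symmetric] y(2)[symmetric] assms(3) by algebra
      finally show ?thesis .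
    qed
    ultimately show ?thesis by algebra
  qed
qed


text \<open>Vieta's relations factor the cubic cut out by the line, which leaves no room for a
  fourth root.\<close>

lemma chord_third:
  assumes "chord l c x1 y1 x2 y2 xA yA" "y3 ^ 2 = x3 ^ 3 + x3 - 1" "y3 = l * x3 + c" "x3 \<noteq> x1" "x3 \<noteq> x2"
  shows "x3 = xA"
proof -
  have "(x3 - x1) * (x3 - x2) * (x3 - xA) = x3 ^ 3 - (x1 + x2 + xA) * x3 ^ 2 + (x1 * x2 + x1 * xA + x2 * xA) * x3 - x1 * x2 * xA"
    by algebra
  also have "\<dots> = x3 ^ 3 - l ^ 2 * x3 ^ 2 + (1 - 2 * l * c) * x3 - (1 + c ^ 2)"
    using assms(1) by (simp add: chord_def)
  also have "\<dots> = y3 ^ 2 - (l * x3 + c) ^ 2" unfolding assms(2) by algebra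
  also have "\<dots> = 0" by (simp add: assms(3))
  finally show ?thesis using assms by simp
qed

text \<open>The difference of two such functions is linear. It vanishes at P1 and P2, or to second
  order at P1, so it is a multiple of y - l x - c; the point P3 off that line makes the multiple
  zero.\<close>

lemma quadric_unique:
  fixes l c s s' \<beta> \<beta>' \<gamma> \<gamma>' :: rat
  assumes y: "y1 = l * x1 + c" "y3 \<noteq> l * x3 + c"
    and lin: "2 * x1 + \<beta> = s * l \<and> 2 * x1 + \<beta>' = s' * l \<or> x1 \<noteq> x2 \<and> y2 = l * x2 + c \<and> s * y2 = x2 ^ 2 + \<beta> * x2 + \<gamma> \<and> s' * y2 = x2 ^ 2 + \<beta>' * x2 + \<gamma>'"
    and q: "s * y1 = x1 ^ 2 + \<beta> * x1 + \<gamma>" "s * y3 = x3 ^ 2 + \<beta> * x3 + \<gamma>"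
    and q': "s' * y1 = x1 ^ 2 + \<beta>' * x1 + \<gamma>'" "s' * y3 = x3 ^ 2 + \<beta>' * x3 + \<gamma>'"
  shows "s = s' \<and> \<beta> = \<beta>' \<and> \<gamma> = \<gamma>'"
proof -
  have b: "\<beta> - \<beta>' = (s - s') * l"
    using lin
  proof
    assume "2 * x1 + \<beta> = s * l \<and> 2 * x1 + \<beta>' = s' * l"
    then show ?thesis by (auto simp: algebra_simps)
  next
    assume a: "x1 \<noteq> x2 \<and> y2 = l * x2 + c \<and> s * y2 = x2 ^ 2 + \<beta> * x2 + \<gamma> \<and> s' * y2 = x2 ^ 2 + \<beta>' * x2 + \<gamma>'"
    have "s * y2 = x2 ^ 2 + \<beta> * x2 + \<gamma>" "s' * y2 = x2 ^ 2 + \<beta>' * x2 + \<gamma>'"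
      using a by blast+
    then have "(s - s') * (y2 - y1) = (\<beta> - \<beta>') * (x2 - x1)" using q(1) q'(1) by algebra
    moreover have "y2 - y1 = l * (x2 - x1)" using a y(1) by (simp add: right_diff_distrib)
    ultimately have "(s - s') * l * (x2 - x1) = (\<beta> - \<beta>') * (x2 - x1)" by (simp add: mult.assoc)
    then show ?thesis using a by simp
  qed
  have g: "\<gamma> - \<gamma>' = (s - s') * c" using q(1) q'(1) b y(1) by algebra
  have "(s - s') * (y3 - (l * x3 + c)) = 0" using q(2) q'(2) b g by algebra
  then have "s = s'" using y(2) by simp
  then show ?thesis using b g by simp
qed

text \<open>With the middle point Q fixed, (P + Q) + R and (R + Q) + P are symmetric, so
  \<open>chord_chord\<close> yields two functions through the same three points and
  \<open>quadric_unique\<close> identifies them.\<close>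

lemma ell_add_assoc_generic:
  fixes x1 y1 x2 y2 x3 y3 :: rat
  assumes c1: "y1 ^ 2 = x1 ^ 3 + x1 - 1" and c2: "y2 ^ 2 = x2 ^ 3 + x2 - 1" and c3: "y3 ^ 2 = x3 ^ 3 + x3 - 1"
    and n12: "ell_add (Aff x1 y1) (Aff x2 y2) \<noteq> Infty"
    and nl: "ell_add (ell_add (Aff x1 y1) (Aff x2 y2)) (Aff x3 y3) \<noteq> Infty"
    and nr: "ell_add (ell_add (Aff x3 y3) (Aff x2 y2)) (Aff x1 y1) \<noteq> Infty"
    and n13: "x1 \<noteq> x3" and n: "x2 \<noteq> x3"
  shows "ell_add (ell_add (Aff x1 y1) (Aff x2 y2)) (Aff x3 y3) = ell_add (ell_add (Aff x3 y3) (Aff x2 y2)) (Aff x1 y1)"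
proof -
  have m12: "\<not> (x1 = x2 \<and> y1 = - y2)" using n12 by auto
  have m23: "\<not> (x3 = x2 \<and> y3 = - y2)" using n by auto
  obtain l c xA yA where A: "ell_add (Aff x1 y1) (Aff x2 y2) = Aff xA yA" and ch1: "chord l c x1 y1 x2 y2 xA yA"
    using ell_add_chord[OF c1 c2 m12] by metis
  obtain l' c' xB yB where B: "ell_add (Aff x3 y3) (Aff x2 y2) = Aff xB yB" and ch1': "chord l' c' x3 y3 x2 y2 xB yB"
    using ell_add_chord[OF c3 c2 m23] by metis
  have mA: "\<not> (xA = x3 \<and> yA = - y3)" using nl A by auto
  have mB: "\<not> (xB = x1 \<and> yB = - y1)" using nr B by auto
  obtain k d xT yT where T: "ell_add (Aff xA yA) (Aff x3 y3) = Aff xT yT" and ch2: "chord k d xA yA x3 y3 xT yT"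
    using ell_add_chord[OF chord_on_curve(3)[OF ch1] c3 mA] by metis
  obtain k' d' xU yU where U: "ell_add (Aff xB yB) (Aff x1 y1) = Aff xU yU" and ch2': "chord k' d' xB yB x1 y1 xU yU"
    using ell_add_chord[OF chord_on_curve(3)[OF ch1'] c1 mB] by metis
  define s where "s = l + k"
  define \<beta> where "\<beta> = l * k + xA"
  define \<gamma> where "\<gamma> = 1 + l * d + c * k + xA * \<beta>"
  define s' where "s' = l' + k'"
  define \<beta>' where "\<beta>' = l' * k' + xB"
  define \<gamma>' where "\<gamma>' = 1 + l' * d' + c' * k' + xB * \<beta>'"
  note q = chord_chord[OF ch1 ch2 s_def \<beta>_def \<gamma>_def]
  note q' = chord_chord[OF ch1' ch2' s'_def \<beta>'_def \<gamma>'_def]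
  have y1: "y1 = l * x1 + c" and y2: "y2 = l * x2 + c" using ch1 by (simp_all add: chord_def)
  have y3: "y3 \<noteq> l * x3 + c"
  proof
    assume a: "y3 = l * x3 + c"
    then have "x3 = xA" using chord_third[OF ch1 c3 a] n13 n by simp
    then have "xA = x3 \<and> yA = - y3" using ch1 a by (simp add: chord_def)
    then show False using mA by simp
  qed
  have lin: "2 * x1 + \<beta> = s * l \<and> 2 * x1 + \<beta>' = s' * l \<or> x1 \<noteq> x2 \<and> y2 = l * x2 + c \<and> s * y2 = x2 ^ 2 + \<beta> * x2 + \<gamma> \<and> s' * y2 = x2 ^ 2 + \<beta>' * x2 + \<gamma>'"
  proof (cases "x1 = x2")
    case True
    then have y12: "y1 = y2" using y1 y2 by simp
    have "chord l c xA (- yA) x1 y1 x1 (- y1)"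
      using ch1 True y12 by (auto simp: chord_def ac_simps)
    then have tg: "2 * y1 * l = 3 * x1 ^ 2 + 1" by (rule chord_tangent)
    have "2 * x1 + \<beta> = s * l" using q(6) True by simp
    moreover have "2 * y1 * (2 * x1 + \<beta>') = s' * (2 * y1 * l)"
      unfolding tg using q'(7) True y12 by simp
    then have "2 * x1 + \<beta>' = s' * l" using no_two_torsion[OF c1] by simp
    ultimately show ?thesis by blast
  next
    case False
    then show ?thesis using q(2) q'(2) y2 by blast
  qed
  have eq: "s = s' \<and> \<beta> = \<beta>' \<and> \<gamma> = \<gamma>'"
    by (rule quadric_unique[OF y1 y3 lin q(1,3) q'(3,1)])
  have x: "xT = xU" using q(5) q'(5) eq by simp
  \<comment> \<open>The relation \<open>q(4)\<close> determines \<open>yT\<close> only if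
    \<open>s\<close> is nonzero. For \<open>s = 0\<close> a monic quadratic would have the distinct
    roots x1 and x3 and also x2, which forces x2 = x1 to be a double root.\<close>
  have "s \<noteq> 0"
  proof
    assume s0: "s = 0"
    have r: "x1 ^ 2 + \<beta> * x1 + \<gamma> = 0" "x2 ^ 2 + \<beta> * x2 + \<gamma> = 0" "x3 ^ 2 + \<beta> * x3 + \<gamma> = 0"
      using q(1-3) s0 by simp_all
    have "(x1 - x3) * (x1 + x3 + \<beta>) = 0" using r by algebra
    then have b: "\<beta> = - x1 - x3" using n13 by (simp add: algebra_simps) algebra
    have "(x2 - x3) * (x2 + x3 + \<beta>) = 0" using r by algebra
    then have "x1 = x2" using n b by simp
    then have "2 * x1 + \<beta> = 0" using q(6) s0 by simp
    then show False using b n13 by simp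
  qed
  then have "yT = yU" using q(4) q'(4) eq x by (metis mult_cancel_left neg_equal_0_iff_equal)
  then show ?thesis using A B T U x by simp
qed

lemma ell_add_assoc:
  fixes P Q R :: "rat point"
  assumes P: "P \<in> ell_curve" and Q: "Q \<in> ell_curve" and R: "R \<in> ell_curve"
  shows "ell_add (ell_add P Q) R = ell_add P (ell_add Q R)"
proof -
  note comm = ell_add_commute and ni = ell_neg_in
  have neg: "ell_add X Y = Infty \<Longrightarrow> Y = ell_neg X" if "X \<in> ell_curve" "Y \<in> ell_curve" for X Y :: "rat point"
    by (cases X; cases Y) (auto simp: Let_def split: if_splits)
  have cancel2: "ell_add (ell_neg Y) (ell_add X Y) = X" if "X \<in> ell_curve" "Y \<in> ell_curve" for X Y :: "rat point"
    using ell_add_cancel[OF that] comm[OF ni[OF that(2)] ell_add_in[OF that]] by simp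
  consider "ell_add P Q = Infty" | "ell_add Q R = Infty" | "ell_add (ell_add P Q) R = Infty"
    | "ell_add P (ell_add Q R) = Infty"
    | "P = R" | "P = ell_neg R" | "P = Infty \<or> Q = Infty \<or> R = Infty"
    | x1 y1 x2 y2 x3 y3 where "P = Aff x1 y1" "Q = Aff x2 y2" "R = Aff x3 y3" "x1 \<noteq> x3"
        "ell_add P Q \<noteq> Infty" "ell_add Q R \<noteq> Infty" "ell_add (ell_add P Q) R \<noteq> Infty"
        "ell_add P (ell_add Q R) \<noteq> Infty"
  proof (cases P; cases Q; cases R)
    fix x1 y1 x2 y2 x3 y3
    assume *: "P = Aff x1 y1" "Q = Aff x2 y2" "R = Aff x3 y3"
    have "P = R \<or> P = ell_neg R" if "x1 = x3"
    proof -
      have "y1 ^ 2 = y3 ^ 2" using * that P R by (simp add: ell_curve_Aff)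
      then show ?thesis using * that by (auto simp: power2_eq_iff)
    qed
    then show thesis using that * by blast
  qed (use that in blast)+
  then show ?thesis
  proof cases
    case 1
    then have "Q = ell_neg P" using neg P Q by blast
    then show ?thesis using 1 cancel2[OF R ni[OF P]] comm[OF ni[OF P] R] by (simp add: ell_neg_neg)
  next
    case 2
    then have "R = ell_neg Q" using neg Q R by blast
    then show ?thesis using 2 ell_add_cancel[OF P Q] by (simp add: ell_add_Infty_right)
  next
    case 3
    then have "R = ell_neg (ell_add P Q)" using neg ell_add_in[OF P Q] R by blast
    then have "R = ell_add (ell_neg P) (ell_neg Q)" by (simp add: ell_neg_add_distrib)
    then have "ell_add Q R = ell_neg P"
      using cancel2[OF ni[OF P] ni[OF Q]] by (simp add: ell_neg_neg)
    then show ?thesis using 3 by (simp add: ell_add_neg)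
  next
    case 4
    then have "P = ell_neg (ell_add Q R)" using neg[OF P ell_add_in[OF Q R]] by (metis ell_neg_neg)
    then have "P = ell_add (ell_neg R) (ell_neg Q)"
      using comm[OF ni[OF Q] ni[OF R]] by (simp add: ell_neg_add_distrib)
    then have "ell_add P Q = ell_neg R"
      using ell_add_cancel[OF ni[OF R] ni[OF Q]] by (simp add: ell_neg_neg)
    then show ?thesis using 4 by (simp add: ell_neg_add)
  next
    case 5
    then show ?thesis using comm P Q ell_add_in by metis
  next
    case 6
    then have Rn: "R = ell_neg P" by (simp add: ell_neg_neg)
    have "ell_add (ell_add P Q) R = Q"
      unfolding Rn using comm[OF P Q] ell_add_cancel[OF Q P] by simp
    moreover have "ell_add P (ell_add Q R) = Q"
      unfolding Rn using cancel2[OF Q ni[OF P]] by (simp add: ell_neg_neg)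
    ultimately show ?thesis by simp
  next
    case 7
    then show ?thesis by (auto simp: ell_add_Infty_right)
  next
    case (8 x1 y1 x2 y2 x3 y3)
    have RQ: "ell_add R Q = ell_add Q R"
      and r: "ell_add (ell_add Q R) P = ell_add P (ell_add Q R)"
      using comm P Q R ell_add_in by blast+
    have c: "y1 ^ 2 = x1 ^ 3 + x1 - 1" "y2 ^ 2 = x2 ^ 3 + x2 - 1" "y3 ^ 2 = x3 ^ 3 + x3 - 1"
      using 8 P Q R by (simp_all add: ell_curve_Aff)
    show ?thesis
    proof (cases "x2 = x3")
      case False
      have "ell_add (ell_add P Q) R = ell_add (ell_add R Q) P"
        using ell_add_assoc_generic[OF c] 8 RQ r False by metis
      then show ?thesis using RQ r by simp
    next
      \<comment> \<open>Now x2 = x3 differs from x1, so the generic lemma applies with P and R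
        exchanged.\<close>
      case True
      have "ell_add (ell_add R Q) P = ell_add (ell_add P Q) R"
        using ell_add_assoc_generic[OF c(3,2,1)] 8 RQ r True by metis
      then show ?thesis using RQ r by simp
    qed
  qed
qed

section \<open>Multiples\<close>

lemma ell_mult_0: "ell_mult 0 P = Infty"
  by (simp add: ell_mult_def)

lemma ell_mult_1: "ell_mult 1 P = P"
  by (simp add: ell_mult_def ell_add_Infty_right)

lemma ell_mult_neg: "ell_mult (- a) P = ell_neg (ell_mult a P)"
  by (cases "a = 0") (auto simp: ell_mult_def ell_neg_neg)

lemma funpow_ell_add_in:
  fixes P :: "rat point"
  shows "P \<in> ell_curve \<Longrightarrow> (ell_add P ^^ k) Infty \<in> ell_curve"
  by (induction k) (auto simp: Infty_in_ell_curve ell_add_in)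

lemma ell_mult_in:
  fixes P :: "rat point"
  shows "P \<in> ell_curve \<Longrightarrow> ell_mult a P \<in> ell_curve"
  by (simp add: ell_mult_def funpow_ell_add_in ell_neg_in)

lemma ell_add_neg_cancel:
  fixes P Q :: "rat point"
  assumes "P \<in> ell_curve" "Q \<in> ell_curve"
  shows "ell_add P (ell_add (ell_neg P) Q) = Q"
  using ell_add_assoc[OF assms(1) ell_neg_in[OF assms(1)] assms(2)] by (simp add: ell_add_neg)

lemma ell_mult_Suc:
  fixes P :: "rat point"
  assumes P: "P \<in> ell_curve"
  shows "ell_mult (a + 1) P = ell_add P (ell_mult a P)"
proof (cases "a \<ge> 0")
  case True
  then have "nat (a + 1) = Suc (nat a)" by simp
  then show ?thesis using True by (simp add: ell_mult_def)
next
  case False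
  define k where "k = nat (- (a + 1))"
  have k: "nat (- a) = Suc k" "a + 1 = - int k" using False by (auto simp: k_def)
  have "ell_mult (a + 1) P = ell_neg ((ell_add P ^^ k) Infty)"
    unfolding k(2) ell_mult_neg by (simp add: ell_mult_def)
  also have "\<dots> = ell_add P (ell_add (ell_neg P) (ell_neg ((ell_add P ^^ k) Infty)))"
    using ell_add_neg_cancel[OF P ell_neg_in[OF funpow_ell_add_in[OF P]]] by simp
  also have "\<dots> = ell_add P (ell_mult a P)"
    using False k by (simp add: ell_mult_def ell_neg_add_distrib)
  finally show ?thesis .
qed

lemma ell_mult_add:
  fixes P :: "rat point"
  assumes P: "P \<in> ell_curve"
  shows "ell_mult (a + b) P = ell_add (ell_mult a P) (ell_mult b P)"
proof (induction a rule: int_induct[of _ 0])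
  case base
  then show ?case by (simp add: ell_mult_0)
next
  case (step1 i)
  have "ell_mult (i + 1 + b) P = ell_mult (i + b + 1) P" by (simp add: algebra_simps)
  also have "\<dots> = ell_add (ell_mult (i + 1) P) (ell_mult b P)"
    using step1 by (simp add: ell_mult_Suc P ell_add_assoc ell_mult_in)
  finally show ?case .
next
  case (step2 i)
  have "ell_add P (ell_mult (i - 1 + b) P) = ell_mult (i + b) P"
    using ell_mult_Suc[OF P, of "i - 1 + b"] by (simp add: algebra_simps)
  also have "\<dots> = ell_add (ell_mult i P) (ell_mult b P)" using step2 by simp
  also have "\<dots> = ell_add P (ell_add (ell_mult (i - 1) P) (ell_mult b P))"
    using ell_mult_Suc[OF P, of "i - 1"] by (simp add: P ell_add_assoc ell_mult_in)
  finally have "ell_add (ell_neg P) (ell_add P (ell_mult (i - 1 + b) P)) =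
      ell_add (ell_neg P) (ell_add P (ell_add (ell_mult (i - 1) P) (ell_mult b P)))" by simp
  then show ?case
    using ell_add_neg_cancel[OF ell_neg_in[OF P]] P by (simp add: ell_neg_neg ell_mult_in ell_add_in)
qed

lemma ell_mult_mult:
  fixes P :: "rat point"
  assumes P: "P \<in> ell_curve"
  shows "ell_mult a (ell_mult b P) = ell_mult (a * b) P"
proof (induction a rule: int_induct[of _ 0])
  case base
  then show ?case by (simp add: ell_mult_0)
next
  case (step1 i)
  then show ?case by (simp add: ell_mult_add P ell_mult_in ell_mult_1 distrib_right)
next
  case (step2 i)
  have "ell_mult (i - 1) (ell_mult b P) = ell_add (ell_mult i (ell_mult b P)) (ell_mult (- 1) (ell_mult b P))"
    using ell_mult_add[OF ell_mult_in[OF P], of i "- 1"] by simp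
  also have "\<dots> = ell_mult ((i - 1) * b) P"
    using step2 ell_mult_add[OF P, of "i * b" "- b"]
    by (simp add: ell_mult_neg ell_mult_1 left_diff_distrib)
  finally show ?case .
qed

lemma ell_mult_2: "ell_mult 2 P = ell_add P P"
proof -
  have "nat 2 = Suc (Suc 0)" by simp
  then show ?thesis by (simp add: ell_mult_def ell_add_Infty_right numeral_2_eq_2)
qed

lemma ell_mult_ell_add:
  fixes P Q :: "rat point"
  assumes P: "P \<in> ell_curve" and Q: "Q \<in> ell_curve"
  shows "ell_mult a (ell_add P Q) = ell_add (ell_mult a P) (ell_mult a Q)"
proof -
  have nat: "ell_mult (int k) (ell_add P Q) = ell_add (ell_mult (int k) P) (ell_mult (int k) Q)" for k
  proof (induction k)
    case 0
    then show ?case by (simp add: ell_mult_0)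
  next
    case (Suc k)
    let ?A = "ell_mult (int k) P" and ?B = "ell_mult (int k) Q"
    have in': "?A \<in> ell_curve" "?B \<in> ell_curve" using P Q by (simp_all add: ell_mult_in)
    have "ell_mult (int k + 1) (ell_add P Q) = ell_add (ell_add P Q) (ell_add ?A ?B)"
      using Suc by (simp add: ell_mult_Suc ell_add_in P Q)
    also have "\<dots> = ell_add P (ell_add (ell_add Q ?A) ?B)"
      using P Q in' by (simp add: ell_add_assoc ell_add_in)
    also have "\<dots> = ell_add P (ell_add (ell_add ?A Q) ?B)"
      using ell_add_commute[OF Q in'(1)] by simp
    also have "\<dots> = ell_add (ell_add P ?A) (ell_add Q ?B)"
      using P Q in' by (simp add: ell_add_assoc ell_add_in)
    also have "\<dots> = ell_add (ell_mult (int k + 1) P) (ell_mult (int k + 1) Q)"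
      using P Q by (simp add: ell_mult_Suc)
    finally show ?case by (simp add: add.commute)
  qed
  show ?thesis
  proof (cases "a \<ge> 0")
    case True
    then show ?thesis using nat[of "nat a"] by simp
  next
    case False
    then obtain k where "a = - int k" by (metis add.inverse_inverse int_nat_eq less_eq_int_code(1) linorder_le_cases neg_0_le_iff_le)
    then show ?thesis using nat[of k] by (simp add: ell_mult_neg ell_neg_add_distrib)
  qed
qed

section \<open>Heights\<close>

text \<open>The exponential of the Weil height, kept as an integer so that height estimates become
  divisibility arguments.\<close>

definition rat_height :: "rat \<Rightarrow> int"
  where "rat_height r = (case quotient_of r of (p, q) \<Rightarrow> max \<bar>p\<bar> \<bar>q\<bar>)"

fun hgt :: "rat point \<Rightarrow> int"
  where "hgt Infty = 1" | "hgt (Aff x y) = rat_height x"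

lemma rat_height_quotient:
  assumes "coprime p q" "q > 0"
  shows "rat_height (of_int p / of_int q) = max \<bar>p\<bar> q"
proof -
  have "quotient_of (of_int p / of_int q) = (p, q)"
    using assms by (simp add: Fract_of_int_quotient[symmetric] quotient_of_Fract normalize_stable)
  then show ?thesis using assms by (simp add: rat_height_def)
qed

lemma weil_height_eq: "weil_height r = ln (real_of_int (rat_height r))"
  by (simp add: weil_height_def rat_height_def split: prod.split)

lemma rat_height_ge_1: "rat_height r \<ge> 1"
  using quotient_of_denom_pos'[of r] by (auto simp: rat_height_def split: prod.split)

lemma hgt_ge_1: "hgt P \<ge> 1"
  by (cases P) (auto simp: rat_height_ge_1)

lemma x_height_eq: "x_height P = ln (real_of_int (hgt P))"
  by (cases P) (auto simp: weil_height_eq)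

lemma hgt_neg: "hgt (ell_neg P) = hgt P"
  by (cases P) auto

section \<open>Behaviour of the naive height under duplication and addition\<close>

lemma curve_fraction:
  fixes x y :: rat
  assumes "y ^ 2 = x ^ 3 + x - 1"
  obtains p e :: int where "p > 0" "e > 0" "coprime p e" "x = of_int p / of_int e" "rat_height x = max p e"
    "p ^ 3 + p * e ^ 2 - e ^ 3 > 0"
proof -
  obtain p r q :: int where *: "q > 0" "coprime p q" "x = of_int p / of_int q ^ 2" "y = of_int r / of_int q ^ 3" "r ^ 2 = p ^ 3 + p * q ^ 4 - q ^ 6"
    using curve_lowest_terms[OF assms] by blast
  have "p > 0" using curve_pos[OF assms] *(1,3) by (simp add: zero_less_divide_iff)
  moreover have "q ^ 2 > 0" "coprime p (q ^ 2)" "x = of_int p / of_int (q ^ 2)" using * by auto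
  moreover have "rat_height x = max p (q ^ 2)" using rat_height_quotient[of p "q ^ 2"] calculation by simp
  moreover have "r \<noteq> 0" using no_two_torsion[OF assms] *(4) by auto
  then have "p ^ 3 + p * (q ^ 2) ^ 2 - (q ^ 2) ^ 3 > 0"
    using *(5) zero_less_power2[of r] by (simp flip: power_mult)
  ultimately show thesis using that by blast
qed

lemma double_x:
  fixes x y :: rat
  assumes c: "y ^ 2 = x ^ 3 + x - 1"
  shows "\<exists>y'. ell_add (Aff x y) (Aff x y) = Aff ((x ^ 4 - 2 * x ^ 2 + 8 * x + 1) / (4 * (x ^ 3 + x - 1))) y'"
proof -
  have y: "y \<noteq> 0" using no_two_torsion[OF c] .
  have "((3 * x ^ 2 + 1) / (2 * y)) ^ 2 - x - x = ((3 * x ^ 2 + 1) ^ 2 - 2 * x * (4 * y ^ 2)) / (4 * y ^ 2)"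
    using y by (simp add: field_simps power2_eq_square)
  also have "(3 * x ^ 2 + 1) ^ 2 - 2 * x * (4 * y ^ 2) = x ^ 4 - 2 * x ^ 2 + 8 * x + 1"
    unfolding c by algebra
  finally show ?thesis using y by (simp add: Let_def c)
qed

lemma coprimeI_prime:
  fixes a b :: int
  assumes "a \<noteq> 0" "\<And>r. prime r \<Longrightarrow> r dvd a \<Longrightarrow> r dvd b \<Longrightarrow> False"
  shows "coprime a b"
proof (rule ccontr)
  assume "\<not> coprime a b"
  then have "\<not> is_unit (gcd a b)" by (simp add: coprime_iff_gcd_eq_1)
  moreover have "gcd a b \<noteq> 0" using assms(1) by simp
  ultimately obtain r where "prime r" "r dvd gcd a b" using prime_divisorE by blast
  then show False using assms(2)[of r] by simp
qed

lemma max_pow_bounds: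
  fixes p e :: int
  assumes "p > 0" "e > 0" "i + j = d"
  shows "p ^ i * e ^ j \<le> max p e ^ d"
proof -
  have "p ^ i * e ^ j \<le> max p e ^ i * max p e ^ j"
    using assms by (intro mult_mono power_mono) auto
  then show ?thesis using assms by (simp add: power_add flip: assms(3))
qed

text \<open>The new abscissa is F / G, and the Bezout identities bound the cancelled factor c by
  124. Since F and G are positive, negative coefficients may be dropped in upper bounds: 10 = 1 + 8
  + 1 comes from F, and 265 = (124 + 4 + 100) + 37 from the positive coefficients in
  \<open>id2\<close>.\<close>

lemma hgt_double:
  assumes "P \<in> ell_curve"
  shows "hgt (ell_add P P) \<le> 10 * hgt P ^ 4" "hgt P ^ 4 \<le> 265 * hgt (ell_add P P)"
proof -
  have "hgt (ell_add P P) \<le> 10 * hgt P ^ 4 \<and> hgt P ^ 4 \<le> 265 * hgt (ell_add P P)"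
  proof (cases P)
    case Infty then show ?thesis by simp
  next
    case (Aff x y)
    then have c: "y ^ 2 = x ^ 3 + x - 1" using assms by (simp add: ell_curve_Aff)
    obtain p e :: int where pe: "p > 0" "e > 0" "coprime p e" "x = of_int p / of_int e" "rat_height x = max p e"
      "p ^ 3 + p * e ^ 2 - e ^ 3 > 0"
      using curve_fraction[OF c] .
    define x' where "x' = (x ^ 4 - 2 * x ^ 2 + 8 * x + 1) / (4 * (x ^ 3 + x - 1))"
    obtain y' where dbl: "ell_add P P = Aff x' y'" using double_x[OF c] unfolding Aff x'_def by blast
    have "Aff x' y' \<in> ell_curve" using ell_add_in[OF assms assms] dbl by simp
    then obtain p' e' :: int where pe': "p' > 0" "e' > 0" "coprime p' e'" "x' = of_int p' / of_int e'" "rat_height x' = max p' e'"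
      unfolding ell_curve_Aff using curve_fraction by metis
    define F where "F = p ^ 4 - 2 * p ^ 2 * e ^ 2 + 8 * p * e ^ 3 + e ^ 4"
    define G where "G = 4 * e * (p ^ 3 + p * e ^ 2 - e ^ 3)"
    define M where "M = max p e"
    have G0: "G > 0" using pe by (simp add: G_def)
    have px: "of_int p = x * of_int e" using pe by simp
    have "of_int F = (x ^ 4 - 2 * x ^ 2 + 8 * x + 1) * of_int e ^ 4"
      by (simp add: F_def px) algebra
    moreover have "of_int G = 4 * (x ^ 3 + x - 1) * of_int e ^ 4"
      by (simp add: G_def px) algebra
    ultimately have x': "x' = of_int F / of_int G"
      using pe by (simp add: x'_def)
    have F0: "F > 0"
    proof -
      have "x' > 0" using pe' by simp
      then show ?thesis using G0 by (simp add: x' zero_less_divide_iff)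
    qed
    have "of_int (F * e') = (of_int (p' * G) :: rat)"
      using x' pe'(2,4) G0 by (simp add: field_simps)
    then have cross: "F * e' = p' * G" by (simp only: of_int_eq_iff)
    then have "e' dvd p' * G" by (metis dvd_triv_right)
    then have "e' dvd G" using pe'(3) by (simp add: coprime_dvd_mult_right_iff coprime_commute)
    then obtain c where c: "G = e' * c" by (auto simp: dvd_def)
    have cF: "F = p' * c" using cross c pe'(2) by (simp add: mult.assoc mult.left_commute)
    have c0: "c > 0" using c G0 pe' by (simp add: zero_less_mult_iff)
    \<comment> \<open>Bezout identities for numerator and denominator of the duplication map; 31 comes from the discriminant.\<close>
    have id1: "124 * e ^ 7 = (12 * p ^ 2 * e + 16 * e ^ 3) * F - (3 * p ^ 3 - 5 * p * e ^ 2 + 27 * e ^ 3) * G"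
      unfolding F_def G_def by algebra
    have id2: "124 * p ^ 7 = (124 * p ^ 3 + 4 * p ^ 2 * e + 100 * p * e ^ 2 - 108 * e ^ 3) * F
        + (- (p ^ 3) + 37 * p ^ 2 * e - 218 * p * e ^ 2 - 27 * e ^ 3) * G"
      unfolding F_def G_def by algebra
    have "c dvd 124 * e ^ 7" "c dvd 124 * p ^ 7" unfolding id1 id2 by (simp_all add: c cF)
    then have "c dvd gcd (124 * e ^ 7) (124 * p ^ 7)" by simp
    also have "gcd (124 * e ^ 7) (124 * p ^ 7) = 124"
    proof -
      have "coprime (e ^ 7) (p ^ 7)" using pe(3) by (simp add: coprime_commute)
      then show ?thesis by (simp add: gcd_mult_left)
    qed
    finally have c124: "c \<le> 124" by (simp add: zdvd_imp_le)
    have m: "p ^ i * e ^ j \<le> M ^ d" if "i + j = d" for i j d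
      unfolding M_def by (rule max_pow_bounds[OF pe(1,2) that])
    have pos: "p ^ i * e ^ j \<ge> 0" for i j using pe by simp
    have m4: "p ^ 4 * e ^ 0 \<le> M ^ 4" "p ^ 3 * e ^ 1 \<le> M ^ 4" "p ^ 1 * e ^ 3 \<le> M ^ 4" "p ^ 0 * e ^ 4 \<le> M ^ 4"
      by (rule m, simp)+
    define M' where "M' = max F G"
    have M': "M' = c * max p' e'"
      using c0 unfolding M'_def c cF by (simp add: max_def mult.commute)
    have "F \<le> 10 * M ^ 4"
    proof -
      have "F = p ^ 4 * e ^ 0 - 2 * (p ^ 2 * e ^ 2) + 8 * (p ^ 1 * e ^ 3) + p ^ 0 * e ^ 4"
        unfolding F_def by algebra
      then show ?thesis using m4 pos[of 2 2] by linarith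
    qed
    moreover have "G \<le> 10 * M ^ 4"
    proof -
      have "G = 4 * (p ^ 3 * e ^ 1) + 4 * (p ^ 1 * e ^ 3) - 4 * (p ^ 0 * e ^ 4)"
        unfolding G_def by algebra
      then show ?thesis using m4 pos[of 0 4] pos[of 4 0] by linarith
    qed
    ultimately have "M' \<le> 10 * M ^ 4" by (simp add: M'_def)
    moreover have "1 * max p' e' \<le> c * max p' e'" using c0 pe' by (intro mult_right_mono) auto
    then have "max p' e' \<le> M'" by (simp only: mult_1_left M')
    ultimately have up: "max p' e' \<le> 10 * M ^ 4" by simp
    have F': "F \<le> M'" "G \<le> M'" by (simp_all add: M'_def)
    \<comment> \<open>Only upper bounds for the cofactors are needed: a negative cofactor of the
      positive F or G makes the product harmless.\<close>
    have bnd: "A * X \<le> B * M ^ 3 * M'" if "A \<le> B * M ^ 3" "B \<ge> 0" "0 < X" "X \<le> M'" for A B X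
    proof (cases "A \<ge> 0")
      case True then show ?thesis using that by (intro mult_mono) auto
    next
      case False
      then have "A * X \<le> 0" using that by (simp add: mult_nonpos_nonneg)
      also have "0 \<le> B * M ^ 3 * M'" using that pe by (simp add: M_def)
      finally show ?thesis .
    qed
    have m3: "p ^ 3 \<le> M ^ 3" "p ^ 2 * e \<le> M ^ 3" "p * e ^ 2 \<le> M ^ 3" "e ^ 3 \<le> M ^ 3"
      using m[of 3 0 3] m[of 2 1 3] m[of 1 2 3] m[of 0 3 3] by simp_all
    have pos3: "0 \<le> p ^ 3" "0 \<le> p ^ 2 * e" "0 \<le> p * e ^ 2" "0 \<le> e ^ 3"
      using pe by simp_all
    have "124 * e ^ 7 \<le> 265 * M ^ 3 * M'"
    proof -
      have "(12 * p ^ 2 * e + 16 * e ^ 3) * F \<le> 28 * M ^ 3 * M'"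
        by (rule bnd) (use m3 pos3 F0 F' in linarith)+
      moreover have "(- (3 * p ^ 3) + 5 * p * e ^ 2 - 27 * e ^ 3) * G \<le> 5 * M ^ 3 * M'"
        by (rule bnd) (use m3 pos3 G0 F' in linarith)+
      moreover have "0 \<le> M ^ 3 * M'" using F' F0 pe by (simp add: M_def)
      ultimately show ?thesis unfolding id1 by (simp add: algebra_simps)
    qed
    moreover have "124 * p ^ 7 \<le> 265 * M ^ 3 * M'"
    proof -
      have "(124 * p ^ 3 + 4 * p ^ 2 * e + 100 * p * e ^ 2 - 108 * e ^ 3) * F \<le> 228 * M ^ 3 * M'"
        by (rule bnd) (use m3 pos3 F0 F' in linarith)+
      moreover have "(- (p ^ 3) + 37 * p ^ 2 * e - 218 * p * e ^ 2 - 27 * e ^ 3) * G \<le> 37 * M ^ 3 * M'"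
        by (rule bnd) (use m3 pos3 G0 F' in linarith)+
      ultimately show ?thesis unfolding id2 by linarith
    qed
    moreover have "M = e \<or> M = p" by (auto simp: M_def)
    ultimately have "124 * M ^ 7 \<le> 265 * M ^ 3 * M'" by auto
    \<comment> \<open>The bound 124 for the cancelled factor is exactly compensated by the 124 on
      the left of the Bezout identities.\<close>
    also have "\<dots> \<le> 265 * M ^ 3 * (124 * max p' e')"
      unfolding M' using c124 pe pe' by (intro mult_left_mono mult_right_mono) (auto simp: M_def)
    finally have "(124 * M ^ 3) * M ^ 4 \<le> (124 * M ^ 3) * (265 * max p' e')"
      by (simp add: algebra_simps power_add[symmetric])
    then have "M ^ 4 \<le> 265 * max p' e'"
      using pe by (subst (asm) mult_le_cancel_left_pos) (simp_all add: M_def)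
    then show ?thesis using up dbl Aff pe(5) pe'(5) by (simp add: M_def)
  qed
  then show "hgt (ell_add P P) \<le> 10 * hgt P ^ 4" "hgt P ^ 4 \<le> 265 * hgt (ell_add P P)" by blast+
qed


text \<open>The abscissae x3 and x4 of P + Q and P - Q are the roots of D X^2 - S X + T, whose
  coefficients are biquadratic in the fractions x1 and x2. The constant only has to dominate all
  cases, among them the 10 of \<open>hgt_double\<close>; it disappears from the canonical height
  after division by 4^m.\<close>

lemma hgt_parallelogram:
  assumes P: "P \<in> ell_curve" and Q: "Q \<in> ell_curve"
  shows "hgt (ell_add P Q) * hgt (ell_add P (ell_neg Q)) \<le> 12 * (hgt P ^ 2 * hgt Q ^ 2)"
proof -
  consider "P = Infty" | "Q = Infty" | "P = Q" | "P = ell_neg Q"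
    | x1 y1 x2 y2 where "P = Aff x1 y1" "Q = Aff x2 y2" "x1 \<noteq> x2"
  proof (cases P; cases Q)
    fix x1 y1 x2 y2
    assume *: "P = Aff x1 y1" "Q = Aff x2 y2"
    have "P = Q \<or> P = ell_neg Q" if "x1 = x2"
    proof -
      have "y1 ^ 2 = y2 ^ 2" using * that P Q by (simp add: ell_curve_Aff)
      then show ?thesis using * that by (auto simp: power2_eq_iff)
    qed
    then show thesis using that * by blast
  qed (use that in blast)+
  then show ?thesis
  proof cases
    case 1
    then show ?thesis using hgt_ge_1[of Q] by (simp add: hgt_neg flip: power2_eq_square)
  next
    case 2
    then show ?thesis using hgt_ge_1[of P] by (simp add: ell_add_Infty_right flip: power2_eq_square)
  next
    case 3
    have "hgt Q ^ 2 * hgt Q ^ 2 = hgt Q ^ 4" by (simp flip: power_add)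
    moreover have "hgt (ell_add Q Q) \<le> 12 * hgt Q ^ 4"
      using hgt_double(1)[OF Q] zero_le_even_power[of 4 "hgt Q", OF even_numeral] by linarith
    ultimately show ?thesis using 3 by (simp add: ell_add_neg)
  next
    case 4
    have "hgt Q ^ 2 * hgt Q ^ 2 = hgt Q ^ 4" by (simp flip: power_add)
    moreover have "hgt (ell_add (ell_neg Q) (ell_neg Q)) \<le> 12 * hgt Q ^ 4"
      using hgt_double(1)[OF ell_neg_in[OF Q]] zero_le_even_power[of 4 "hgt Q", OF even_numeral]
      unfolding hgt_neg by linarith
    ultimately show ?thesis using 4 by (simp add: ell_neg_add hgt_neg)
  next
    case (5 x1 y1 x2 y2)
    have c1: "y1 ^ 2 = x1 ^ 3 + x1 - 1" and c2: "y2 ^ 2 = x2 ^ 3 + x2 - 1"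
      using 5 P Q by (simp_all add: ell_curve_Aff)
    define \<delta> where "\<delta> = x2 - x1"
    have d0: "\<delta> \<noteq> 0" using 5 by (simp add: \<delta>_def)
    define l l' where "l = (y2 - y1) / \<delta>" and "l' = (- y2 - y1) / \<delta>"
    have ld: "l * \<delta> = y2 - y1" "l' * \<delta> = - y2 - y1" using d0 by (simp_all add: l_def l'_def)
    define x3 x4 where "x3 = l ^ 2 - x1 - x2" and "x4 = l' ^ 2 - x1 - x2"
    have s3: "ell_add P Q = Aff x3 (l * (x1 - x3) - y1)"
      and s4: "ell_add P (ell_neg Q) = Aff x4 (l' * (x1 - x4) - y1)"
      using 5 by (simp_all add: Let_def x3_def x4_def l_def l'_def \<delta>_def)
    have e3: "x3 * \<delta> ^ 2 = (y2 - y1) ^ 2 - (x1 + x2) * \<delta> ^ 2"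
      unfolding ld(1)[symmetric] x3_def by algebra
    have e4: "x4 * \<delta> ^ 2 = (- y2 - y1) ^ 2 - (x1 + x2) * \<delta> ^ 2"
      unfolding ld(2)[symmetric] x4_def by algebra
    have sum: "(x3 + x4) * \<delta> ^ 2 = 2 * ((x1 + x2) * (1 + x1 * x2) - 2)"
      using e3 e4 c1 c2 unfolding \<delta>_def by algebra
    have "(x3 * x4) * \<delta> ^ 2 * \<delta> ^ 2 = (x3 * \<delta> ^ 2) * (x4 * \<delta> ^ 2)" by algebra
    also have "\<dots> = ((x1 * x2 - 1) ^ 2 + 4 * (x1 + x2)) * \<delta> ^ 2"
    proof -
      have "(y2 ^ 2 - y1 ^ 2) ^ 2 = \<delta> ^ 2 * (x1 ^ 2 + x1 * x2 + x2 ^ 2 + 1) ^ 2"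
        unfolding c1 c2 \<delta>_def by algebra
      moreover have "(x3 * \<delta> ^ 2) * (x4 * \<delta> ^ 2) = (y2 ^ 2 - y1 ^ 2) ^ 2
          - 2 * (x1 + x2) * \<delta> ^ 2 * (y1 ^ 2 + y2 ^ 2) + (x1 + x2) ^ 2 * \<delta> ^ 2 * \<delta> ^ 2"
        unfolding e3 e4 by algebra
      ultimately have "(x3 * \<delta> ^ 2) * (x4 * \<delta> ^ 2) = ((x1 ^ 2 + x1 * x2 + x2 ^ 2 + 1) ^ 2
          - 2 * (x1 + x2) * (y1 ^ 2 + y2 ^ 2) + (x1 + x2) ^ 2 * \<delta> ^ 2) * \<delta> ^ 2"
        by algebra
      also have "(x1 ^ 2 + x1 * x2 + x2 ^ 2 + 1) ^ 2 - 2 * (x1 + x2) * (y1 ^ 2 + y2 ^ 2) + (x1 + x2) ^ 2 * \<delta> ^ 2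
          = (x1 * x2 - 1) ^ 2 + 4 * (x1 + x2)"
        unfolding c1 c2 \<delta>_def by algebra
      finally show ?thesis .
    qed
    finally have prod: "x3 * x4 * \<delta> ^ 2 = (x1 * x2 - 1) ^ 2 + 4 * (x1 + x2)"
      using d0 by simp
    have in34: "ell_add P Q \<in> ell_curve" "ell_add P (ell_neg Q) \<in> ell_curve"
      using P Q by (simp_all add: ell_add_in ell_neg_in)
    obtain p1 e1 where f1: "p1 > 0" "e1 > 0" "x1 = of_int p1 / of_int e1" "rat_height x1 = max p1 e1"
      using curve_fraction[OF c1] by metis
    obtain p2 e2 where f2: "p2 > 0" "e2 > 0" "x2 = of_int p2 / of_int e2" "rat_height x2 = max p2 e2"
      using curve_fraction[OF c2] by metis
    obtain p3 e3 where f3: "p3 > 0" "e3 > 0" "coprime p3 e3" "x3 = of_int p3 / of_int e3" "rat_height x3 = max p3 e3"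
      using in34(1) unfolding s3 ell_curve_Aff using curve_fraction by metis
    obtain p4 e4 where f4: "p4 > 0" "e4 > 0" "coprime p4 e4" "x4 = of_int p4 / of_int e4" "rat_height x4 = max p4 e4"
      using in34(2) unfolding s4 ell_curve_Aff using curve_fraction by metis
    define D where "D = (p2 * e1 - p1 * e2) ^ 2"
    define S where "S = 2 * ((p1 * e2 + p2 * e1) * (e1 * e2 + p1 * p2)) - 4 * (e1 * e2) ^ 2"
    define T where "T = (p1 * p2 - e1 * e2) ^ 2 + 4 * (e1 * e2) * (p1 * e2 + p2 * e1)"
    have rp: "of_int p1 = x1 * of_int e1" "of_int p2 = x2 * of_int e2" "of_int p3 = x3 * of_int e3" "of_int p4 = x4 * of_int e4"
      using f1 f2 f3 f4 by simp_all
    have rD: "of_int D = \<delta> ^ 2 * (of_int e1 * of_int e2) ^ 2"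
      by (simp add: D_def rp \<delta>_def) algebra
    have "(of_int (D * (p3 * e4 + p4 * e3)) :: rat) = of_int (S * (e3 * e4))"
    proof -
      have "of_int (D * (p3 * e4 + p4 * e3)) = (x3 + x4) * \<delta> ^ 2 * (of_int e1 * of_int e2) ^ 2 * (of_int e3 * of_int e4)"
        by (simp only: of_int_mult of_int_add rp rD) algebra
      also have "\<dots> = of_int S * (of_int e3 * of_int e4)"
      proof -
        have "2 * ((x1 + x2) * (1 + x1 * x2) - 2) * (of_int e1 * of_int e2) ^ 2 = of_int S"
          by (simp add: S_def rp) algebra
        then show ?thesis by (simp only: sum)
      qed
      also have "\<dots> = of_int (S * (e3 * e4))" by simp
      finally show ?thesis .
    qed
    then have E1: "D * (p3 * e4 + p4 * e3) = S * (e3 * e4)" by (simp only: of_int_eq_iff)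
    have "(of_int (D * (p3 * p4)) :: rat) = of_int (T * (e3 * e4))"
    proof -
      have "of_int (D * (p3 * p4)) = x3 * x4 * \<delta> ^ 2 * (of_int e1 * of_int e2) ^ 2 * (of_int e3 * of_int e4)"
        by (simp only: of_int_mult of_int_add rp rD) algebra
      also have "\<dots> = of_int T * (of_int e3 * of_int e4)"
      proof -
        have "((x1 * x2 - 1) ^ 2 + 4 * (x1 + x2)) * (of_int e1 * of_int e2) ^ 2 = of_int T"
          by (simp add: T_def rp) algebra
        then show ?thesis by (simp only: prod)
      qed
      also have "\<dots> = of_int (T * (e3 * e4))" by simp
      finally show ?thesis .
    qed
    then have E2: "D * (p3 * p4) = T * (e3 * e4)" by (simp only: of_int_eq_iff)
    have "e3 * e4 dvd D"
    proof -
      \<comment> \<open>Gauss's lemma: the product of the primitive forms e3 X - p3 and e4 X - p4 is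
        primitive, so its leading coefficient divides that of the proportional form D X^2 - S X +
        T.\<close>
      define g where "g = gcd (p3 * e4 + p4 * e3) (p3 * p4)"
      have "coprime (e3 * e4) g"
      proof (rule coprimeI_prime)
        show "e3 * e4 \<noteq> 0" using f3 f4 by simp
        fix r :: int
        assume r: "prime r" "r dvd e3 * e4" "r dvd g"
        then have r': "r dvd p3 * e4 + p4 * e3" "r dvd p3 * p4" by (simp_all add: g_def)
        have n3: "\<not> (r dvd p3 \<and> r dvd e3)" and n4: "\<not> (r dvd p4 \<and> r dvd e4)"
          using r(1) f3(3) f4(3) by (meson coprime_common_divisor not_prime_unit)+
        show False
          using r r' n3 n4 by (metis dvd_add_right_iff dvd_add_left_iff dvd_mult dvd_mult2 prime_dvd_mult_iff)
      qed
      moreover have "e3 * e4 dvd gcd (D * (p3 * e4 + p4 * e3)) (D * (p3 * p4))"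
        unfolding E1 E2 by simp
      then have "e3 * e4 dvd D * g"
        using f3 f4 by (simp add: gcd_mult_left g_def D_def)
      ultimately show ?thesis by (simp add: coprime_dvd_mult_left_iff)
    qed
    then obtain c where c: "D = e3 * e4 * c" by (auto simp: dvd_def)
    have "D > 0"
    proof -
      have "(of_int D :: rat) \<noteq> 0" using d0 f1 f2 unfolding rD by simp
      then have "D \<noteq> 0" by (simp only: of_int_eq_0_iff) simp
      moreover have "D \<ge> 0" by (simp add: D_def)
      ultimately show ?thesis by simp
    qed
    moreover have "e3 * e4 > 0" using f3 f4 by simp
    ultimately have c1: "c \<ge> 1" unfolding c using zero_less_mult_pos[of "e3 * e4" c] by linarith
    have Sc: "S = c * (p3 * e4 + p4 * e3)" and Tc: "T = c * (p3 * p4)"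
    proof -
      have "(e3 * e4) * S = (e3 * e4) * (c * (p3 * e4 + p4 * e3))" using E1 unfolding c by algebra
      then show "S = c * (p3 * e4 + p4 * e3)" using f3 f4 by simp
      have "(e3 * e4) * T = (e3 * e4) * (c * (p3 * p4))" using E2 unfolding c by algebra
      then show "T = c * (p3 * p4)" using f3 f4 by simp
    qed
    define M where "M = max p1 e1 * max p2 e2"
    have m: "p1 * p2 \<le> M" "p1 * e2 \<le> M" "e1 * p2 \<le> M" "e1 * e2 \<le> M"
      unfolding M_def using f1 f2 by (auto intro!: mult_mono)
    have m0: "p1 * p2 > 0" "p1 * e2 > 0" "e1 * p2 > 0" "e1 * e2 > 0" using f1 f2 by simp_all
    have sqd: "(a - b) ^ 2 \<le> M ^ 2" if "0 < a" "0 < b" "a \<le> M" "b \<le> M" for a b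
      using that by (intro power2_le_iff_abs_le[THEN iffD2]) auto
    have mm: "a * b \<le> M ^ 2" if "0 < a" "0 < b" "a \<le> M" "b \<le> M" for a b
      using that by (simp add: power2_eq_square mult_mono)
    have "D \<le> 12 * M ^ 2"
    proof -
      have "D = (e1 * p2 - p1 * e2) ^ 2" unfolding D_def by algebra
      then show ?thesis using sqd[OF m0(3,2) m(3,2)] zero_le_power2[of M] by linarith
    qed
    moreover have "S \<le> 12 * M ^ 2"
    proof -
      have "S = 2 * ((p1 * e2) * (e1 * e2)) + 2 * ((p1 * e2) * (p1 * p2)) + 2 * ((e1 * p2) * (e1 * e2)) + 2 * ((e1 * p2) * (p1 * p2)) - 4 * (e1 * e2) ^ 2"
        unfolding S_def by algebra
      moreover have "0 \<le> (e1 * e2) ^ 2" by simp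
      ultimately show ?thesis using mm[OF m0(2,4) m(2,4)] mm[OF m0(2,1) m(2,1)] mm[OF m0(3,4) m(3,4)] mm[OF m0(3,1) m(3,1)] zero_le_power2[of M] by linarith
    qed
    moreover have "T \<le> 12 * M ^ 2"
    proof -
      have "T = (p1 * p2 - e1 * e2) ^ 2 + 4 * ((e1 * e2) * (p1 * e2)) + 4 * ((e1 * e2) * (e1 * p2))"
        unfolding T_def by algebra
      moreover have "0 \<le> M ^ 2" by simp
      ultimately show ?thesis using mm[OF m0(4,2) m(4,2)] mm[OF m0(4,3) m(4,3)] sqd[OF m0(1,4) m(1,4)] zero_le_power2[of M] by linarith
    qed
    moreover have le: "a \<le> c * a" if "a \<ge> 0" for a using that c1 by (simp add: mult_le_cancel_right1)
    have "e3 * e4 \<le> c * (e3 * e4)" "p3 * e4 + p4 * e3 \<le> c * (p3 * e4 + p4 * e3)" "p3 * p4 \<le> c * (p3 * p4)"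
      using f3 f4 by (intro le; simp)+
    moreover have "D = c * (e3 * e4)" by (simp add: c mult.commute)
    ultimately have b: "e3 * e4 \<le> 12 * M ^ 2" "p3 * e4 + p4 * e3 \<le> 12 * M ^ 2" "p3 * p4 \<le> 12 * M ^ 2"
      unfolding Sc Tc by linarith+
    have "p3 * e4 > 0" "p4 * e3 > 0" using f3 f4 by simp_all
    then have "max p3 e3 * max p4 e4 \<le> 12 * M ^ 2"
      using b by (auto simp: max_def mult.commute)
    then show ?thesis using s3 s4 5 f1 f2 f3 f4 by (simp add: M_def power_mult_distrib)
  qed
qed

section \<open>The canonical height\<close>

lemma ln_hgt_nonneg: "0 \<le> ln (real_of_int (hgt P))"
  using hgt_ge_1[of P] by simp

lemma ln_hgt_double:
  assumes "P \<in> ell_curve"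
  shows "ln (hgt (ell_add P P)) \<le> 4 * ln (hgt P) + ln 10" "4 * ln (hgt P) \<le> ln (hgt (ell_add P P)) + ln 265"
proof -
  have p: "real_of_int (hgt P) > 0" "real_of_int (hgt (ell_add P P)) > 0"
    using hgt_ge_1[of P] hgt_ge_1[of "ell_add P P"] by linarith+
  have "real_of_int (hgt (ell_add P P)) \<le> 10 * real_of_int (hgt P) ^ 4"
    using hgt_double(1)[OF assms, THEN of_int_le_iff[where 'a = real, THEN iffD2]] by simp
  then have "ln (hgt (ell_add P P)) \<le> ln (10 * real_of_int (hgt P) ^ 4)"
    using p by (subst ln_le_cancel_iff) auto
  also have "\<dots> = 4 * ln (hgt P) + ln 10" using p by (simp add: ln_mult ln_realpow)
  finally show "ln (hgt (ell_add P P)) \<le> 4 * ln (hgt P) + ln 10" .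
  have "real_of_int (hgt P) ^ 4 \<le> 265 * real_of_int (hgt (ell_add P P))"
    using hgt_double(2)[OF assms, THEN of_int_le_iff[where 'a = real, THEN iffD2]] by simp
  then have "ln (real_of_int (hgt P) ^ 4) \<le> ln (265 * real_of_int (hgt (ell_add P P)))"
    using p by (subst ln_le_cancel_iff) auto
  then show "4 * ln (hgt P) \<le> ln (hgt (ell_add P P)) + ln 265"
    using p by (simp add: ln_mult ln_realpow)
qed

lemma ln_hgt_parallelogram:
  assumes "P \<in> ell_curve" "Q \<in> ell_curve"
  shows "ln (hgt (ell_add P Q)) + ln (hgt (ell_add P (ell_neg Q))) \<le> 2 * ln (hgt P) + 2 * ln (hgt Q) + ln 12"
proof -
  have p: "real_of_int (hgt P) > 0" "real_of_int (hgt Q) > 0" "real_of_int (hgt (ell_add P Q)) > 0"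
      "real_of_int (hgt (ell_add P (ell_neg Q))) > 0"
    using hgt_ge_1[of P] hgt_ge_1[of Q] hgt_ge_1[of "ell_add P Q"] hgt_ge_1[of "ell_add P (ell_neg Q)"] by linarith+
  have "real_of_int (hgt (ell_add P Q)) * real_of_int (hgt (ell_add P (ell_neg Q))) \<le> 12 * (real_of_int (hgt P) ^ 2 * real_of_int (hgt Q) ^ 2)"
    using hgt_parallelogram[OF assms, THEN of_int_le_iff[where 'a = real, THEN iffD2]] by simp
  then have "ln (real_of_int (hgt (ell_add P Q)) * real_of_int (hgt (ell_add P (ell_neg Q)))) \<le> ln (12 * (real_of_int (hgt P) ^ 2 * real_of_int (hgt Q) ^ 2))"
    using p by (subst ln_le_cancel_iff) auto
  also have "\<dots> = 2 * ln (hgt P) + 2 * ln (hgt Q) + ln 12" using p by (simp add: ln_mult ln_realpow)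
  finally show ?thesis using p by (simp add: ln_mult)
qed

text \<open>Tate's telescoping argument. A shift by one third of the duplication error makes the
  scaled heights monotone, because C + C/3 = 4 (C/3); the initial terms of the two monotone
  sequences then enclose the limit.\<close>

lemma neron_tate_bounds:
  assumes P: "P \<in> ell_curve"
  defines "h \<equiv> \<lambda>m. ln (real_of_int (hgt (ell_mult (2 ^ m) P)))"
  shows "(\<lambda>m. (1 / 2 * h m) / 4 ^ m) \<longlonglongrightarrow> neron_tate P"
    "neron_tate P \<le> (ln (hgt P) + ln 10 / 3) / 2" "neron_tate P \<ge> (ln (hgt P) - ln 265 / 3) / 2"
proof -
  have dbl: "ell_mult (2 ^ Suc m) P = ell_add (ell_mult (2 ^ m) P) (ell_mult (2 ^ m) P)" for m
    using ell_mult_add[OF P, of "2 ^ m" "2 ^ m"] by simp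
  have h1: "h (Suc m) \<le> 4 * h m + ln 10" and h2: "4 * h m \<le> h (Suc m) + ln 265" for m
    unfolding h_def dbl using ln_hgt_double[OF ell_mult_in[OF P]] by auto
  have h0: "h m \<ge> 0" for m unfolding h_def by (rule ln_hgt_nonneg)
  define u where "u m = (h m + ln 10 / 3) / 4 ^ m" for m
  define v where "v m = (h m - ln 265 / 3) / 4 ^ m" for m
  have du: "decseq u"
  proof (rule decseq_SucI)
    fix m
    have "(h (Suc m) + ln 10 / 3) / 4 ^ Suc m \<le> (4 * (h m + ln 10 / 3)) / 4 ^ Suc m"
      using h1[of m] by (intro divide_right_mono) auto
    also have "\<dots> = u m"
      unfolding u_def power_Suc by (rule mult_divide_mult_cancel_left) simp
    finally show "u (Suc m) \<le> u m" by (simp add: u_def)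
  qed
  have iv: "incseq v"
  proof (rule incseq_SucI)
    fix m
    have "v m = (4 * (h m - ln 265 / 3)) / 4 ^ Suc m"
      unfolding v_def power_Suc by (rule mult_divide_mult_cancel_left[symmetric]) simp
    also have "\<dots> \<le> (h (Suc m) - ln 265 / 3) / 4 ^ Suc m"
      using h2[of m] by (intro divide_right_mono) auto
    finally show "v m \<le> v (Suc m)" by (simp add: v_def)
  qed
  have u0: "0 \<le> u m" for m using h0[of m] by (simp add: u_def)
  obtain L where L: "u \<longlonglongrightarrow> L" "\<And>i. L \<le> u i"
    using decseq_convergent[OF du, of 0] u0 by metis
  have z: "(\<lambda>m. c / 4 ^ m) \<longlonglongrightarrow> 0" for c :: real
    by (rule tendsto_divide_0[OF tendsto_const filterlim_realpow_sequentially_gt1]) simp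
  have "(\<lambda>m. u m - (ln 10 / 3) / 4 ^ m) \<longlonglongrightarrow> L - 0"
    by (rule tendsto_diff[OF L(1) z])
  then have hL: "(\<lambda>m. h m / 4 ^ m) \<longlonglongrightarrow> L" by (simp add: u_def add_divide_distrib)
  then have "(\<lambda>m. (1 / 2) * (h m / 4 ^ m)) \<longlonglongrightarrow> 1 / 2 * L" by (intro tendsto_mult tendsto_const)
  then have lim: "(\<lambda>m. (1 / 2 * h m) / 4 ^ m) \<longlonglongrightarrow> L / 2" by simp
  then have nt: "neron_tate P = L / 2"
    unfolding neron_tate_def x_height_eq h_def by (rule limI)
  show "(\<lambda>m. (1 / 2 * h m) / 4 ^ m) \<longlonglongrightarrow> neron_tate P" unfolding nt by (rule lim)
  have h00: "h 0 = ln (hgt P)" by (simp add: h_def ell_mult_1)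
  show "neron_tate P \<le> (ln (hgt P) + ln 10 / 3) / 2"
    using L(2)[of 0] by (simp add: nt u_def h00)
  have "(\<lambda>m. h m / 4 ^ m - (ln 265 / 3) / 4 ^ m) \<longlonglongrightarrow> L - 0"
    by (rule tendsto_diff[OF hL z])
  then have "v \<longlonglongrightarrow> L" by (simp add: v_def[abs_def] diff_divide_distrib)
  then have "v 0 \<le> L" by (rule incseq_le[OF iv])
  then show "neron_tate P \<ge> (ln (hgt P) - ln 265 / 3) / 2"
    by (simp add: nt v_def h00)
qed

lemma neron_tate_neg:
  shows "neron_tate (ell_neg P) = neron_tate P"
proof -
  have "(ell_add (ell_neg P) ^^ k) Infty = ell_neg ((ell_add P ^^ k) Infty)" for P :: "rat point" and k
    by (induction k) (simp_all add: ell_neg_add_distrib)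
  then have "ell_mult (2 ^ m) (ell_neg P) = ell_neg (ell_mult (2 ^ m) P)" for m
    by (simp add: ell_mult_def)
  then show ?thesis by (simp add: neron_tate_def x_height_eq hgt_neg)
qed

lemma neron_tate_double:
  assumes P: "P \<in> ell_curve"
  shows "neron_tate (ell_add P P) = 4 * neron_tate P"
proof -
  let ?h = "\<lambda>m. ln (real_of_int (hgt (ell_mult (2 ^ m) P)))"
  have eq: "ell_mult (2 ^ m) (ell_add P P) = ell_mult (2 ^ Suc m) P" for m
    using ell_mult_mult[OF P, of "2 ^ m" 2] by (simp add: ell_mult_2 mult.commute)
  have "(\<lambda>m. (1 / 2 * ?h (Suc m)) / 4 ^ m) \<longlonglongrightarrow> neron_tate (ell_add P P)"
    using neron_tate_bounds(1)[OF ell_add_in[OF P P]] unfolding eq .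
  moreover have "(\<lambda>m. 4 * ((1 / 2 * ?h (Suc m)) / 4 ^ Suc m)) \<longlonglongrightarrow> 4 * neron_tate P"
    by (intro tendsto_mult tendsto_const LIMSEQ_Suc[OF neron_tate_bounds(1)[OF P]])
  then have "(\<lambda>m. (1 / 2 * ?h (Suc m)) / 4 ^ m) \<longlonglongrightarrow> 4 * neron_tate P" by simp
  ultimately show ?thesis by (rule LIMSEQ_unique)
qed

lemma neron_tate_parallelogram_le:
  assumes P: "P \<in> ell_curve" and Q: "Q \<in> ell_curve"
  shows "neron_tate (ell_add P Q) + neron_tate (ell_add P (ell_neg Q)) \<le> 2 * neron_tate P + 2 * neron_tate Q"
proof -
  define a where "a R m = (1 / 2 * ln (real_of_int (hgt (ell_mult (2 ^ m) R)))) / 4 ^ m" for R m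
  have lim: "a R \<longlonglongrightarrow> neron_tate R" if "R \<in> ell_curve" for R
    unfolding a_def[abs_def] by (rule neron_tate_bounds(1)[OF that])
  have z: "(\<lambda>m. (1 / 2 * ln 12) / 4 ^ m) \<longlonglongrightarrow> (0::real)"
    by (rule tendsto_divide_0[OF tendsto_const filterlim_realpow_sequentially_gt1]) simp
  have "a (ell_add P Q) m + a (ell_add P (ell_neg Q)) m \<le> 2 * a P m + 2 * a Q m + (1 / 2 * ln 12) / 4 ^ m" for m
  proof -
    have neg: "ell_mult k (ell_neg Q) = ell_neg (ell_mult k Q)" for k
      using ell_mult_mult[OF Q, of k "- 1"] by (simp add: ell_mult_neg ell_mult_1)
    have "ln (real_of_int (hgt (ell_mult (2 ^ m) (ell_add P Q)))) + ln (real_of_int (hgt (ell_mult (2 ^ m) (ell_add P (ell_neg Q)))))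
       \<le> 2 * ln (real_of_int (hgt (ell_mult (2 ^ m) P))) + 2 * ln (real_of_int (hgt (ell_mult (2 ^ m) Q))) + ln 12"
      using ln_hgt_parallelogram[OF ell_mult_in[OF P] ell_mult_in[OF Q], of "2 ^ m" "2 ^ m"]
      by (simp add: ell_mult_ell_add P Q ell_neg_in neg)
    then have "1 / (2 * 4 ^ m) * (ln (real_of_int (hgt (ell_mult (2 ^ m) (ell_add P Q)))) + ln (real_of_int (hgt (ell_mult (2 ^ m) (ell_add P (ell_neg Q))))))
       \<le> 1 / (2 * 4 ^ m) * (2 * ln (real_of_int (hgt (ell_mult (2 ^ m) P))) + 2 * ln (real_of_int (hgt (ell_mult (2 ^ m) Q))) + ln 12)"
      by (simp add: divide_right_mono)
    then show ?thesis
      unfolding a_def by (simp add: field_simps)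
  qed
  then have "neron_tate (ell_add P Q) + neron_tate (ell_add P (ell_neg Q)) \<le> 2 * neron_tate P + 2 * neron_tate Q + 0"
    by (intro LIMSEQ_le[OF tendsto_add[OF lim lim] tendsto_add[OF tendsto_add[OF tendsto_mult[OF tendsto_const lim] tendsto_mult[OF tendsto_const lim]] z]])
      (auto simp: P Q ell_add_in ell_neg_in)
  then show ?thesis by simp
qed

text \<open>The reverse inequality is the inequality itself applied to P + Q and P - Q, whose sum
  and difference are 2P and 2Q.\<close>

lemma neron_tate_parallelogram:
  assumes P: "P \<in> ell_curve" and Q: "Q \<in> ell_curve"
  shows "neron_tate (ell_add P Q) + neron_tate (ell_add P (ell_neg Q)) = 2 * neron_tate P + 2 * neron_tate Q"
proof (rule antisym[OF neron_tate_parallelogram_le[OF P Q]])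
  define S D where "S = ell_add P Q" and "D = ell_add P (ell_neg Q)"
  have SD: "S \<in> ell_curve" "D \<in> ell_curve" using P Q by (simp_all add: S_def D_def ell_add_in ell_neg_in)
  have "S = ell_add Q P" using ell_add_commute[OF P Q] by (simp add: S_def)
  then have "ell_add S D = ell_add Q (ell_add P (ell_add P (ell_neg Q)))"
    using P Q by (simp add: D_def ell_add_assoc ell_add_in ell_neg_in)
  also have "ell_add P (ell_add P (ell_neg Q)) = ell_add (ell_neg Q) (ell_add P P)"
    using P Q by (metis ell_add_assoc ell_add_commute ell_add_in ell_neg_in)
  finally have s: "ell_add S D = ell_add P P" using ell_add_neg_cancel[OF Q ell_add_in[OF P P]] by simp
  have "ell_neg D = ell_add (ell_neg P) Q" by (simp add: D_def ell_neg_add_distrib ell_neg_neg)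
  then have "ell_add S (ell_neg D) = ell_add Q (ell_add P (ell_add (ell_neg P) Q))"
    using P Q \<open>S = ell_add Q P\<close> by (simp add: ell_add_assoc ell_add_in ell_neg_in)
  also have "\<dots> = ell_add Q Q" using ell_add_neg_cancel[OF P Q] by simp
  finally have d: "ell_add S (ell_neg D) = ell_add Q Q" .
  have "neron_tate (ell_add P P) + neron_tate (ell_add Q Q) \<le> 2 * neron_tate S + 2 * neron_tate D"
    using neron_tate_parallelogram_le[OF SD] unfolding s d .
  then show "2 * neron_tate P + 2 * neron_tate Q \<le> neron_tate (ell_add P Q) + neron_tate (ell_add P (ell_neg Q))"
    using neron_tate_double[OF P] neron_tate_double[OF Q] by (simp add: S_def D_def)
qed

lemma neron_tate_Infty: "neron_tate Infty = 0"
  using neron_tate_double[OF Infty_in_ell_curve] by simp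

lemma neron_tate_mult:
  assumes P: "P \<in> ell_curve"
  shows "neron_tate (ell_mult a P) = real_of_int a ^ 2 * neron_tate P"
proof -
  have nat: "neron_tate (ell_mult (int k) P) = real k ^ 2 * neron_tate P" for k
  proof (induction k rule: induct_nat_012)
    case 0 then show ?case by (simp add: ell_mult_0 neron_tate_Infty)
  next
    case 1 then show ?case by (simp add: ell_mult_1)
  next
    case (ge2 n)
    have p: "int (Suc (Suc n)) = int (Suc n) + 1" and m: "int n = int (Suc n) + - 1" by simp_all
    have "neron_tate (ell_mult (int (Suc (Suc n))) P) + neron_tate (ell_mult (int n) P) = 2 * neron_tate (ell_mult (int (Suc n)) P) + 2 * neron_tate P"
      unfolding p m ell_mult_add[OF P] ell_mult_neg ell_mult_1
      using neron_tate_parallelogram[OF ell_mult_in[OF P] P] .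
    then show ?case using ge2 by (simp add: power2_eq_square algebra_simps)
  qed
  show ?thesis
  proof (cases "a \<ge> 0")
    case True
    then show ?thesis using nat[of "nat a"] by simp
  next
    case False
    then have "a = - int (nat (- a))" by simp
    then show ?thesis using nat[of "nat (- a)"] by (metis ell_mult_neg neron_tate_neg of_int_minus of_int_of_nat_eq power2_minus)
  qed
qed

section \<open>The cubic ring generated by a root of $X^3 + X - 1$\<close>

text \<open>\<open>Cub a b c\<close> stands for \<open>a + b \<alpha> + c \<alpha> ^ 2\<close> with \<open>\<alpha> ^ 3 = 1 - \<alpha>\<close>. The norm is the determinant
  of multiplication, and over the reals it splits into the value at the real root \<open>al\<close> times the
  squared modulus of the value at a complex root.\<close>

datatype 'a cub = Cub 'a 'a 'a

instantiation cub :: (comm_ring_1) comm_ring_1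
begin

definition "0 = Cub 0 0 0"
definition "1 = Cub 1 0 0"
fun plus_cub where "Cub a b c + Cub a' b' c' = Cub (a + a') (b + b') (c + c')"
fun minus_cub where "Cub a b c - Cub a' b' c' = Cub (a - a') (b - b') (c - c')"
fun uminus_cub where "- Cub a b c = Cub (- a) (- b) (- c)"
fun times_cub where "Cub a b c * Cub a' b' c' =
  Cub (a * a' + (b * c' + c * b')) (a * b' + b * a' - (b * c' + c * b') + c * c')
    (a * c' + b * b' + c * a' - c * c')"

instance
proof
  fix x y z :: "'a cub"
  show "x * y * z = x * (y * z)"
    by (cases x; cases y; cases z) (simp add: algebra_simps)
  show "x * y = y * x"
    by (cases x; cases y) (simp add: algebra_simps)
  show "(x + y) * z = x * z + y * z"
    by (cases x; cases y; cases z) (simp add: algebra_simps)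
  show "x + y + z = x + (y + z)"
    by (cases x; cases y; cases z) (simp add: algebra_simps)
  show "x + y = y + x"
    by (cases x; cases y) (simp add: algebra_simps)
  show "0 + x = x" "1 * x = x" "- x + x = 0"
    by (cases x; simp add: zero_cub_def one_cub_def)+
  show "x - y = x + - y"
    by (cases x; cases y) simp
  show "(0::'a cub) \<noteq> 1"
    by (simp add: zero_cub_def one_cub_def)
qed

end

fun cub_norm :: "'a::comm_ring_1 cub \<Rightarrow> 'a"
  where "cub_norm (Cub a b c) = a * ((a - c) ^ 2 - b * (c - b)) - b * (c * (a - c) - b ^ 2)
    + c * (c * (c - b) - b * (a - c))"

fun cub_adj :: "'a::comm_ring_1 cub \<Rightarrow> 'a cub"
  where "cub_adj (Cub a b c) = Cub ((a - c) ^ 2 - b * (c - b)) (c * (c - b) - b * (a - c)) (b ^ 2 - c * (a - c))"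

lemma cub_norm_mult: "cub_norm (x * y :: 'a::idom cub) = cub_norm x * cub_norm y"
proof (cases x; cases y)
  fix a b c a' b' c'
  assume xy: "x = Cub a b c" "y = Cub a' b' c'"
  show ?thesis unfolding xy times_cub.simps cub_norm.simps by algebra
qed

lemma cub_mult_adj: "x * cub_adj x = Cub (cub_norm x) 0 0"
  by (cases x) (simp add: power2_eq_square algebra_simps)

lemma cub_norm_const: "cub_norm (Cub a 0 0) = a ^ 3"
  by (simp add: power2_eq_square power3_eq_cube)

text \<open>The element \<alpha> and its inverse: \<alpha> (1 + \<alpha>^2) = 1.\<close>

abbreviation cA :: "'a::comm_ring_1 cub" where "cA \<equiv> Cub 0 1 0"
abbreviation cAi :: "'a::comm_ring_1 cub" where "cAi \<equiv> Cub 1 0 1"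

lemma cA_cAi: "cA * cAi = 1"
  by (simp add: one_cub_def)

lemma alpha_exists: "\<exists>\<alpha>::real. \<alpha> ^ 3 = 1 - \<alpha> \<and> (341/500) < \<alpha> \<and> \<alpha> < (683/1000)"
proof -
  have "\<exists>x\<ge>6821/10000. x \<le> (6829/10000) \<and> x ^ 3 + x = (1::real)"
    by (rule IVT) (auto simp: power3_eq_cube intro!: continuous_intros)
  then obtain x :: real where x: "(6821/10000) \<le> x" "x \<le> (6829/10000)" "x ^ 3 + x = 1" by blast
  then show ?thesis by (intro exI[of _ x]) auto
qed

definition al :: real where "al = (SOME \<alpha>. \<alpha> ^ 3 = 1 - \<alpha> \<and> (341/500) < \<alpha> \<and> \<alpha> < (683/1000))"

lemma al: "al ^ 3 = 1 - al" "(341/500) < al" "al < (683/1000)"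
  using someI_ex[OF alpha_exists] by (simp_all add: al_def)

lemma al_sq: "(93/200) < al ^ 2" "al ^ 2 < (933/2000)"
proof -
  have "(341/500) * (341/500) < al * al" "al * al < (683/1000) * (683/1000)"
    using al by (intro mult_strict_mono; simp)+
  then show "(93/200) < al ^ 2" "al ^ 2 < (933/2000)" by (simp_all add: power2_eq_square)
qed

text \<open>The complex roots are -al/2 plus or minus i sqrt(1 + 3/4 al^2). The two squares are
  those of the real and imaginary parts of the value there.\<close>

lemma cub_norm_real:
  fixes a b c :: real
  shows "cub_norm (Cub a b c) = (a + b * al + c * al ^ 2) *
    ((a + b * al + c * al ^ 2 - (3/2 * al * b + (3/2 * al ^ 2 + 1) * c)) ^ 2 + (1 + 3/4 * al ^ 2) * (b - al * c) ^ 2)"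
proof -
  define X Y Z D where "X = a + b * al + c * al ^ 2" and "Y = X - (3/2 * al * b + (3/2 * al ^ 2 + 1) * c)"
    and "Z = (b - al * c) ^ 2" and "D = 1 + 3/4 * al ^ 2"
  have Y: "2 * Y = 2 * X - (3 * al * b + (3 * al ^ 2 + 2) * c)" by (simp add: Y_def algebra_simps)
  have D: "4 * D = 4 + 3 * al ^ 2" by (simp add: D_def)
  have "4 * cub_norm (Cub a b c) = X * ((2 * Y) ^ 2 + (4 * D) * Z)"
    unfolding Y D X_def Z_def using al(1) by (simp, algebra)
  then have "cub_norm (Cub a b c) = X * (Y ^ 2 + D * Z)"
    by (simp add: algebra_simps)
  then show ?thesis unfolding Y_def Z_def D_def X_def .
qed

text \<open>After reducing the last two coordinates, shift the first one so that the value \<open>r\<close> at the real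
  root lies in \<open>[-1/2, 1/2]\<close>, or in \<open>[0, 1)\<close> when the real part \<open>r - u\<close> at the complex root would
  otherwise get too large.\<close>

lemma norm_euclid_core:
  fixes r B C u :: real
  assumes B: "\<bar>B\<bar> \<le> 1/2" and C: "\<bar>C\<bar> \<le> 1/2" and u: "u = 3/2 * al * B + (3/2 * al ^ 2 + 1) * C" "u \<ge> 0"
  shows "\<exists>i::int. \<bar>(r - i) * ((r - i - u) ^ 2 + (1 + 3/4 * al ^ 2) * (B - al * C) ^ 2)\<bar> < 1"
proof -
  define k1 k2 d where "k1 = 3/2 * al" and "k2 = 3/2 * al ^ 2 + 1" and "d = 1 + 3/4 * al ^ 2"
  have k1: "(1023/1000) < k1" "k1 < (2049/2000)" and k2: "(1697/1000) < k2" "k2 < (17/10)" and d: "0 < d" "d < (27/20)"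
    using al(2,3) al_sq by (simp_all add: k1_def k2_def d_def)
  have uk: "u = k1 * B + k2 * C" using u by (simp add: k1_def k2_def)
  define V where "V = d * (B - al * C) ^ 2"
  have V0: "V \<ge> 0" using d by (simp add: V_def)
  have V_le: "V \<le> (27/20) * t ^ 2" if "\<bar>B - al * C\<bar> \<le> t" for t
  proof -
    have "(B - al * C) ^ 2 \<le> t ^ 2" using that by (rule abs_le_square_iff[THEN iffD1, OF order_trans[OF _ abs_ge_self]])
    then show ?thesis unfolding V_def using d by (intro mult_mono) auto
  qed
  have optA: ?thesis if "(1/2 + u) ^ 2 + V < 2"
  proof -
    define i where "i = round r"
    have ri: "\<bar>r - of_int i\<bar> \<le> 1/2" using of_int_round_abs_le[of r] by (simp add: i_def abs_minus_commute)
    have "(r - of_int i - u) ^ 2 \<le> (1/2 + u) ^ 2"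
      using ri u(2) by (intro abs_le_square_iff[THEN iffD1]) linarith
    then have "\<bar>r - of_int i\<bar> * ((r - of_int i - u) ^ 2 + V) \<le> 1/2 * ((1/2 + u) ^ 2 + V)"
      using ri V0 by (intro mult_mono) auto
    also have "\<dots> < 1" using that by simp
    finally have "\<bar>(r - of_int i) * ((r - of_int i - u) ^ 2 + V)\<bar> < 1"
      using V0 by (simp add: abs_mult)
    then show ?thesis unfolding V_def d_def by blast
  qed
  \<comment> \<open>Opposite signs of B and C keep u or V small enough for nearest-integer rounding.
    With equal signs u can be large, and beyond 3/4 the shift into [0, 1) takes over.\<close>
  consider "B \<ge> 0" "C \<ge> 0" "u \<le> 3/4" | "B \<ge> 0" "C \<ge> 0" "u > 3/4" | "B \<le> 0" "C \<ge> 0" | "B \<ge> 0" "C \<le> 0" | "B < 0" "C < 0"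
    by linarith
  then show ?thesis
  proof cases
    case 1
    have "al * C \<le> 1 * C" using al 1 by (intro mult_right_mono) auto
    moreover have "0 \<le> al * C" using al 1 by simp
    ultimately have "V \<le> (27/20) * (1/2) ^ 2" using B C 1 by (intro V_le) linarith
    moreover have "(1/2 + u) ^ 2 \<le> (5/4) ^ 2" using 1 u(2) by (intro power_mono) auto
    ultimately show ?thesis by (intro optA) (simp add: power2_eq_square)
  next
    case 2
    have "al * C \<le> 1 * C" using al 2 by (intro mult_right_mono) auto
    moreover have "0 \<le> al * C" using al 2 by simp
    ultimately have V: "V \<le> (27/20) * (1/2) ^ 2" using B C 2 by (intro V_le) linarith
    define t where "t = r - of_int \<lfloor>r\<rfloor>"
    have t: "0 \<le> t" "t < 1" unfolding t_def by linarith+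
    have "k1 * B \<le> (2049/2000) * (1/2)" "k2 * C \<le> (17/10) * (1/2)"
      using B C 2 k1 k2 by (intro mult_mono; simp)+
    then have u1: "u \<le> (137/100)" unfolding uk by simp
    \<comment> \<open>On [0, 4u/3] the function t (t - u)^2 has maximum 4 u^3 / 27, attained at t =
      u/3. As u > 3/4, this interval contains [0, 1).\<close>
    have "t * (t - u) ^ 2 - 4 / 27 * u ^ 3 = (t - u / 3) ^ 2 * (t - 4 * u / 3)"
      by (simp add: power2_eq_square power3_eq_cube algebra_simps)
    also have "\<dots> \<le> 0" using t 2 by (intro mult_nonneg_nonpos) auto
    finally have "t * (t - u) ^ 2 \<le> 4 / 27 * u ^ 3" by simp
    also have "\<dots> \<le> 4 / 27 * (137/100) ^ 3" using u1 u(2) by (intro mult_left_mono power_mono) auto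
    finally have 3: "t * (t - u) ^ 2 \<le> (1/2)" by (simp add: power3_eq_cube)
    have "t * V \<le> 1 * V" using t V0 by (intro mult_right_mono) auto
    then have "t * ((t - u) ^ 2 + V) < 1" using 3 V by (simp add: distrib_left power2_eq_square)
    then have "\<bar>t * ((t - u) ^ 2 + V)\<bar> < 1" using t V0 by (simp add: abs_mult)
    then show ?thesis unfolding t_def V_def d_def by blast
  next
    case 3
    define t where "t = - B"
    have t: "0 \<le> t" "t \<le> 1/2" using 3 B by (auto simp: t_def)
    have "al * C \<le> (683/1000) * (1/2)" using al 3 C by (intro mult_mono) auto
    moreover have "0 \<le> al * C" using al 3 by simp
    ultimately have V: "V \<le> (27/20) * (t + (683/2000)) ^ 2" using 3 by (intro V_le) (simp add: t_def)
    have "k2 * C \<le> (17/10) * (1/2)" using C 3 k2 by (intro mult_mono) auto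
    moreover have "(1023/1000) * t \<le> k1 * t" using k1 t by (intro mult_right_mono) auto
    ultimately have "u \<le> (17/20) - (1023/1000) * t" unfolding uk t_def by simp
    then have "(1/2 + u) ^ 2 \<le> ((27/20) - (1023/1000) * t) ^ 2" using u(2) by (intro power_mono) auto
    moreover have "((27/20) - (1023/1000) * t) ^ 2 + (27/20) * (t + (683/2000)) ^ 2 < 2"
    proof -
      have "t * t \<le> 1/2 * t" using t by (intro mult_right_mono) auto
      then show ?thesis using t by (simp add: power2_eq_square algebra_simps)
    qed
    ultimately show ?thesis using V by (intro optA) simp
  next
    case 4
    define s where "s = - C"
    have s: "s \<ge> 0" using 4 by (simp add: s_def)
    have kb: "k1 * B \<le> (2049/2000) * (1/2)" using 4 B k1 by (intro mult_mono) auto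
    have ks: "0 \<le> k2 * s" using s k2 by simp
    have u': "u = k1 * B - k2 * s" unfolding uk s_def by simp
    have "(1697/1000) * s \<le> k2 * s" using k2 s by (intro mult_right_mono) auto
    then have s1: "s \<le> (151/500)" using kb u' u(2) by simp
    have "al * s \<le> (683/1000) * (151/500)" using al s s1 by (intro mult_mono) auto
    moreover have "0 \<le> al * s" using al s by simp
    moreover have "B - al * C = B + al * s" by (simp add: s_def)
    ultimately have "V \<le> (27/20) * (707/1000) ^ 2" using 4 B by (intro V_le) simp
    moreover have "(1/2 + u) ^ 2 \<le> (10123/10000) ^ 2" using kb ks u' u(2) by (intro power_mono) auto
    ultimately show ?thesis by (intro optA) (simp add: power2_eq_square)
  next
    case 5
    then have "k1 * B < 0" "k2 * C < 0" using k1 k2 by (simp_all add: mult_pos_neg)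
    then show ?thesis using u(2) uk by simp
  qed
qed

lemma norm_euclid:
  fixes a b c :: real
  shows "\<exists>i j k. \<bar>cub_norm (Cub (a - real_of_int i) (b - real_of_int j) (c - real_of_int k))\<bar> < 1"
proof -
  define j k where "j = round b" and "k = round c"
  define B C where "B = b - j" and "C = c - k"
  have BC: "\<bar>B\<bar> \<le> 1/2" "\<bar>C\<bar> \<le> 1/2"
    using of_int_round_abs_le[of b] of_int_round_abs_le[of c] by (simp_all add: B_def C_def j_def k_def abs_minus_commute)
  define u where "u = 3/2 * al * B + (3/2 * al ^ 2 + 1) * C"
  define r where "r = a + B * al + C * al ^ 2"
  have N: "cub_norm (Cub (a - i) B C) = (r - i) * ((r - i - u) ^ 2 + (1 + 3/4 * al ^ 2) * (B - al * C) ^ 2)" for i :: int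
    unfolding cub_norm_real r_def u_def by (simp add: algebra_simps)
  have "\<exists>i::int. \<bar>cub_norm (Cub (a - i) B C)\<bar> < 1"
  proof (cases "u \<ge> 0")
    case True
    then show ?thesis unfolding N using norm_euclid_core[OF BC u_def] by blast
  next
    \<comment> \<open>Negating the element changes the sign of u and keeps the absolute value of the
      norm.\<close>
    case False
    have BC': "\<bar>- B\<bar> \<le> 1/2" "\<bar>- C\<bar> \<le> 1/2" using BC by simp_all
    have "- u = 3/2 * al * - B + (3/2 * al ^ 2 + 1) * - C" by (simp add: u_def)
    from norm_euclid_core[OF BC' this, of "- r"] False obtain i :: int
      where i: "\<bar>(- r - i) * ((- r - i - - u) ^ 2 + (1 + 3/4 * al ^ 2) * (- B - al * - C) ^ 2)\<bar> < 1" by auto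
    have gen: "(- r - i) * ((- r - i - - u) ^ 2 + d * (- B - al * - C) ^ 2)
       = - ((r - (- i)) * ((r - (- i) - u) ^ 2 + d * (B - al * C) ^ 2))" for d :: real
      by (simp add: power2_eq_square algebra_simps)
    have "(- r - i) * ((- r - i - - u) ^ 2 + (1 + 3/4 * al ^ 2) * (- B - al * - C) ^ 2)
       = - ((r - (- i)) * ((r - (- i) - u) ^ 2 + (1 + 3/4 * al ^ 2) * (B - al * C) ^ 2))"
      by (rule gen)
    then have "\<bar>cub_norm (Cub (a - (- i)) B C)\<bar> < 1" using i N[of "- i"] by simp
    then show ?thesis by (metis of_int_minus)
  qed
  then show ?thesis unfolding B_def C_def by blast
qed

text \<open>The polynomial X^3 + X + 1 is irreducible modulo 2, so 2 is inert and the norm form has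
  no nontrivial zero modulo 2.\<close>

lemma cub_norm_even: "even (cub_norm (Cub a b c)) \<Longrightarrow> even a \<and> even b \<and> even (c::int)"
  by (cases "even a"; cases "even b"; cases "even c") simp_all

text \<open>Infinite descent at the inert prime 2: a zero of the norm form could be halved
  forever.\<close>

lemma cub_norm_eq_0:
  fixes x :: "int cub"
  assumes "cub_norm x = 0" shows "x = 0"
proof -
  have main: "cub_norm (Cub a b c) = 0 \<Longrightarrow> a = 0 \<and> b = 0 \<and> c = 0" for a b c :: int
  proof (induction "nat (\<bar>a\<bar> + \<bar>b\<bar> + \<bar>c\<bar>)" arbitrary: a b c rule: less_induct)
    case less
    have "even (cub_norm (Cub a b c))" unfolding less.prems by simp
    then have "even a \<and> even b \<and> even c" by (rule cub_norm_even)
    then obtain a' b' c' where e: "a = 2 * a'" "b = 2 * b'" "c = 2 * c'" by (auto elim!: evenE)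
    have "cub_norm (Cub a b c) = 8 * cub_norm (Cub a' b' c')"
      unfolding e by (simp add: power2_eq_square algebra_simps)
    then have z: "cub_norm (Cub a' b' c') = 0" using less.prems by simp
    show ?case
    proof (rule ccontr)
      assume "\<not> (a = 0 \<and> b = 0 \<and> c = 0)"
      then have "nat (\<bar>a'\<bar> + \<bar>b'\<bar> + \<bar>c'\<bar>) < nat (\<bar>a\<bar> + \<bar>b\<bar> + \<bar>c\<bar>)" using e by auto
      from less.hyps[OF this z] show False using e \<open>\<not> (a = 0 \<and> b = 0 \<and> c = 0)\<close> by simp
    qed
  qed
  obtain a b c where x: "x = Cub a b c" by (cases x)
  show ?thesis using main[OF assms[unfolded x]] by (simp add: x zero_cub_def)
qed

section \<open>Euclidean division, Bezout identities and square factors in the cubic ring\<close>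

lemma cub_division:
  fixes x y :: "int cub"
  assumes "y \<noteq> 0"
  shows "\<exists>q. \<bar>cub_norm (x - q * y)\<bar> < \<bar>cub_norm y\<bar>"
proof -
  define n where "n = cub_norm y"
  have n0: "n \<noteq> 0" using cub_norm_eq_0 assms by (auto simp: n_def)
  obtain a b c where z: "x * cub_adj y = Cub a b c" by (cases "x * cub_adj y")
  obtain i j k :: int where ijk: "\<bar>cub_norm (Cub (real_of_int a / n - i) (real_of_int b / n - j) (real_of_int c / n - k))\<bar> < 1"
    using norm_euclid[of "real_of_int a / n" "real_of_int b / n" "real_of_int c / n"] by blast
  define q where "q = Cub i j k"
  have yn: "y * cub_adj y = Cub n 0 0" by (simp add: cub_mult_adj n_def)
  have "n * cub_norm (cub_adj y) = n * n ^ 2"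
    using arg_cong[OF yn, of cub_norm] unfolding cub_norm_mult cub_norm_const
    by (simp add: n_def power2_eq_square power3_eq_cube)
  then have adj: "cub_norm (cub_adj y) = n ^ 2" using n0 by simp
  have "(x - q * y) * cub_adj y = Cub a b c - q * (y * cub_adj y)"
    by (simp add: left_diff_distrib z mult.assoc)
  also have "\<dots> = Cub (a - n * i) (b - n * j) (c - n * k)"
    unfolding yn q_def by (simp add: mult.commute)
  finally have "cub_norm (x - q * y) * n ^ 2 = cub_norm (Cub (a - n * i) (b - n * j) (c - n * k))"
    by (simp only: cub_norm_mult[symmetric] adj[symmetric])
  then have "real_of_int (cub_norm (x - q * y)) * real_of_int n ^ 2 = real_of_int (cub_norm (Cub (a - n * i) (b - n * j) (c - n * k)))"
    by (metis of_int_mult of_int_power)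
  also have "\<dots> = real_of_int n ^ 3 * cub_norm (Cub (real_of_int a / n - i) (real_of_int b / n - j) (real_of_int c / n - k))"
  proof -
    have "cub_norm (Cub (t * a) (t * b) (t * c)) = t ^ 3 * cub_norm (Cub a b c)" for t a b c :: real
      by (simp add: power2_eq_square power3_eq_cube algebra_simps)
    from this[of n "real_of_int a / n - i" "real_of_int b / n - j" "real_of_int c / n - k"]
    show ?thesis using n0 by (simp add: right_diff_distrib)
  qed
  finally have "real_of_int (cub_norm (x - q * y)) * real_of_int n ^ 2
      = real_of_int n * cub_norm (Cub (real_of_int a / n - i) (real_of_int b / n - j) (real_of_int c / n - k)) * real_of_int n ^ 2"
    by (simp add: power2_eq_square power3_eq_cube)
  then have "real_of_int (cub_norm (x - q * y)) = real_of_int n * cub_norm (Cub (real_of_int a / n - i) (real_of_int b / n - j) (real_of_int c / n - k))"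
    using n0 by simp
  then have "\<bar>real_of_int (cub_norm (x - q * y))\<bar> < \<bar>real_of_int n\<bar>"
    using mult_strict_left_mono[OF ijk, of "\<bar>real_of_int n\<bar>"] n0 by (simp add: abs_mult)
  then show ?thesis unfolding n_def by (intro exI[of _ q]) linarith
qed

lemma cub_bezout:
  fixes x y :: "int cub"
  shows "\<exists>d u v. d = u * x + v * y \<and> d dvd x \<and> d dvd y"
proof (induction "nat \<bar>cub_norm y\<bar>" arbitrary: x y rule: less_induct)
  case less
  show ?case
  proof (cases "y = 0")
    case True
    then show ?thesis by (intro exI[of _ x] exI[of _ 1] exI[of _ 0]) simp
  next
    case False
    obtain q where q: "\<bar>cub_norm (x - q * y)\<bar> < \<bar>cub_norm y\<bar>" using cub_division[OF False] by blast
    then have "nat \<bar>cub_norm (x - q * y)\<bar> < nat \<bar>cub_norm y\<bar>" by simp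
    from less.hyps[OF this, of y] obtain d u v where d: "d = u * y + v * (x - q * y)" "d dvd y" "d dvd x - q * y"
      by blast
    have "d = v * x + (u - v * q) * y" unfolding d(1) by (simp add: algebra_simps)
    moreover have "d dvd x" using dvd_add[OF d(3) dvd_mult[OF d(2), of q]] by simp
    ultimately show ?thesis using d(2) by blast
  qed
qed

text \<open>In terms of ideals, (x, r)^2 = (x^2, x r, r^2) = x (x, r, x') = (x). A generator d of
  (x, r) therefore has d^2 associated to x, and the two cofactors record this without
  dividing.\<close>

lemma cub_square_factor:
  fixes x x' r :: "int cub"
  assumes "x * x' = r ^ 2" "a * x + b * x' + c * r = 1"
  shows "\<exists>d w w'. x = d ^ 2 * w \<and> d ^ 2 = x * w'"
proof -
  obtain d u v where d: "d = u * x + v * r" "d dvd x" "d dvd r" using cub_bezout by blast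
  obtain s t where st: "x = d * s" "r = d * t" using d(2,3) unfolding dvd_def by blast
  have "d ^ 2 = x * (u ^ 2 * x + 2 * u * v * r) + v ^ 2 * r ^ 2"
    unfolding d(1) by (simp add: power2_eq_square algebra_simps)
  also have "\<dots> = x * (u ^ 2 * x + 2 * u * v * r + v ^ 2 * x')"
    unfolding assms(1)[symmetric] by (simp add: algebra_simps)
  finally have 1: "d ^ 2 = x * (u ^ 2 * x + 2 * u * v * r + v ^ 2 * x')" .
  have "x = x * (a * x + b * x' + c * r)" by (simp add: assms(2))
  also have "\<dots> = a * x ^ 2 + b * (x * x') + c * x * r" by (simp add: power2_eq_square algebra_simps)
  also have "\<dots> = a * (d * s) ^ 2 + b * (d * t) ^ 2 + c * (d * s) * (d * t)"
    unfolding assms(1) st[symmetric] by simp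
  also have "\<dots> = d ^ 2 * (a * s ^ 2 + b * t ^ 2 + c * s * t)" by (simp add: power2_eq_square algebra_simps)
  finally show ?thesis using 1 by blast
qed


section \<open>The real embedding and the units of norm 1\<close>

definition rho :: "int cub \<Rightarrow> real"
  where "rho x = (case x of Cub a b c \<Rightarrow> a + b * al + c * al ^ 2)"

lemma rho_mult: "rho (x * y) = rho x * rho y"
proof (cases x; cases y)
  fix a b c a' b' c'
  assume xy: "x = Cub a b c" "y = Cub a' b' c'"
  show ?thesis unfolding xy times_cub.simps rho_def cub.case using al(1)
    by (simp only: of_int_add of_int_mult of_int_diff) algebra
qed

lemma rho_1: "rho 1 = 1"
  by (simp add: rho_def one_cub_def)

lemma rho_power: "rho (x ^ k) = rho x ^ k"
  by (induction k) (simp_all add: rho_mult rho_1)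

lemma rho_cA: "rho cA = al"
  by (simp add: rho_def)

lemma cub_norm_of_int:
  "real_of_int (cub_norm (Cub a b c)) = cub_norm (Cub (real_of_int a) (real_of_int b) (real_of_int c))"
  by simp

lemma cub_norm_rho:
  "real_of_int (cub_norm (Cub a b c)) = rho (Cub a b c) *
    ((rho (Cub a b c) - (3/2 * al * b + (3/2 * al ^ 2 + 1) * c)) ^ 2 + (1 + 3/4 * al ^ 2) * (b - al * c) ^ 2)"
  unfolding cub_norm_of_int cub_norm_real rho_def cub.case ..

lemma cub_norm_1: "cub_norm (1 :: 'a::idom cub) = 1"
  by (simp add: one_cub_def)

lemma cub_norm_power: "cub_norm (x ^ k :: 'a::idom cub) = cub_norm x ^ k"
  by (induction k) (simp_all add: cub_norm_mult cub_norm_1)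

lemma unit_rho_pos:
  assumes "cub_norm x = 1"
  shows "rho x > 0"
proof -
  obtain a b c where x: "x = Cub a b c" by (cases x)
  define Q where "Q = (rho x - (3/2 * al * b + (3/2 * al ^ 2 + 1) * c)) ^ 2 + (1 + 3/4 * al ^ 2) * (b - al * c) ^ 2"
  have "rho x * Q = real_of_int (cub_norm x)" unfolding Q_def x cub_norm_rho ..
  then have "rho x * Q = 1" by (simp only: assms of_int_1)
  moreover have "Q \<ge> 0" by (simp add: Q_def)
  ultimately show ?thesis using mult_nonpos_nonneg[of "rho x" Q] by linarith
qed

text \<open>The upper limit is al^(-2). Norm 1 and real value at least 1 force the squared modulus
  at the complex root to be at most 1, so every embedding is bounded and few coefficients
  remain.\<close>

lemma unit_bounded:
  fixes x :: "int cub"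
  assumes n: "cub_norm x = 1" and r: "1 \<le> rho x" "rho x < 1 + al + al ^ 2"
  shows "x = 1 \<or> x = cAi"
proof -
  obtain a b c where x: "x = Cub a b c" by (cases x)
  define k1 k2 d where "k1 = 3/2 * al" and "k2 = 3/2 * al ^ 2 + 1" and "d = 1 + 3/4 * al ^ 2"
  define t where "t = real_of_int b - al * real_of_int c"
  define Re where "Re = rho x - (k1 * b + k2 * c)"
  have k: "(1023/1000) < k1" "k1 < (2049/2000)" "(1697/1000) < k2" "k2 < (17/10)" "(337/250) < d"
    using al(2,3) al_sq by (simp_all add: k1_def k2_def d_def)
  have "rho x * (Re ^ 2 + d * t ^ 2) = real_of_int (cub_norm x)"
    unfolding Re_def k1_def k2_def d_def t_def x cub_norm_rho ..
  then have rQ: "rho x * (Re ^ 2 + d * t ^ 2) = 1" by (simp only: n of_int_1)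
  have Q0: "Re ^ 2 \<ge> 0" "d * t ^ 2 \<ge> 0" using k by simp_all
  then have "1 * (Re ^ 2 + d * t ^ 2) \<le> rho x * (Re ^ 2 + d * t ^ 2)" using r by (intro mult_right_mono) auto
  then have Q1: "Re ^ 2 + d * t ^ 2 \<le> 1" unfolding rQ by simp
  then have "Re ^ 2 \<le> 1" using Q0 by linarith
  then have Re: "\<bar>Re\<bar> \<le> 1" using abs_le_square_iff[of Re 1] by simp
  have "(337/250) * t ^ 2 \<le> d * t ^ 2" using k by (intro mult_right_mono) auto
  then have "t ^ 2 \<le> (185761/250000)" using Q1 Q0 by linarith
  also have "(185761/250000) = ((431/500) :: real) ^ 2" by (simp add: power2_eq_square)
  finally have "t ^ 2 \<le> (431/500) ^ 2" .
  then have t: "\<bar>t\<bar> \<le> (431/500)" using abs_le_square_iff[of t "(431/500)"] by simp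
  define K0 where "K0 = 3/2 * al ^ 2 + k2"
  \<comment> \<open>This is the real value minus the real part at the complex root, so it lies
    between 0 and 63/20. Expressed through the bounded \<open>t\<close>, it isolates the integer
    \<open>c\<close>, whose coefficient exceeds 239/100.\<close>
  have sum: "k1 * b + k2 * c = k1 * t + K0 * c"
    unfolding t_def k1_def K0_def by algebra
  have lo: "0 \<le> k1 * t + K0 * c" and hi: "k1 * t + K0 * c < (63/20)"
    using Re r al(3) al_sq unfolding sum[symmetric] Re_def by linarith+
  have K: "(239/100) < K0" using al_sq k by (simp add: K0_def)
  have kt: "\<bar>k1 * t\<bar> \<le> (2049/2000) * (431/500)" unfolding abs_mult using k t by (intro mult_mono) auto
  have "c \<ge> 0"
  proof (rule ccontr)
    assume "\<not> c \<ge> 0"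
    then have "real_of_int c \<le> - 1" by linarith
    then have "K0 * c \<le> K0 * (- 1)" using K by (intro mult_left_mono) auto
    then show False using lo kt K by linarith
  qed
  moreover have "c \<le> 1"
  proof (rule ccontr)
    assume "\<not> c \<le> 1"
    then have "K0 * 2 \<le> K0 * c" using K by (intro mult_left_mono) auto
    then show False using hi kt K by linarith
  qed
  ultimately consider "c = 0" | "c = 1" by linarith
  then show ?thesis
  proof cases
    case 1
    then have "b = 0" using t by (simp add: t_def)
    then have "a ^ 3 = 1" using n 1 by (simp add: x cub_norm_const del: cub_norm.simps)
    moreover have "1 \<le> a" "real_of_int a < 1 + al + al ^ 2"
      using r 1 \<open>b = 0\<close> by (auto simp: x rho_def)
    then have "a = 1 \<or> a = 2" using al(3) al_sq(2) by linarith
    ultimately have "a = 1" by auto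
    then show ?thesis using 1 \<open>b = 0\<close> by (simp add: x one_cub_def)
  next
    case 2
    have "\<bar>real_of_int b - al\<bar> \<le> 431/500" using t 2 by (simp add: t_def)
    then have "real_of_int b > -1" "real_of_int b < 2" using al(2,3) by linarith+
    then have "b = 0 \<or> b = 1" by linarith
    then show ?thesis
    proof
      assume b: "b = 0"
      have "a * (a - 1) ^ 2 = 0" using n by (simp add: x b 2)
      then have "a = 0 \<or> a = 1" by simp
      moreover have "a \<noteq> 0" using r(1) al_sq by (auto simp: x rho_def b 2)
      ultimately show ?thesis by (simp add: x b 2)
    next
      assume b: "b = 1"
      have "(a - 1) * ((a + 1) * (a - 2)) = 0" using n by (simp add: x b 2 power2_eq_square algebra_simps)
      then have "a = 1 \<or> a = - 1 \<or> a = 2" by auto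
      then show ?thesis using r al al_sq by (auto simp: x rho_def b 2)
    qed
  qed
qed

text \<open>Multiplying by even powers of \<open>\<alpha>\<close> moves the real value of a unit into \<open>[1, \<alpha> ^ (-2))\<close>, where only
  \<open>1\<close> and \<open>1 / \<alpha> = 1 + \<alpha> ^ 2\<close> remain.\<close>

lemma unit_class:
  fixes x :: "int cub"
  assumes n: "cub_norm x = 1"
  shows "\<exists>y. x = y ^ 2 \<or> x = cA * y ^ 2"
proof -
  define g where "g = 1 + al + al ^ 2"
  have g2: "g > 2" using al(2) al_sq(1) unfolding g_def by linarith
  have ag: "al ^ 2 * g = 1" using al(1) unfolding g_def by algebra
  have inv: "cA ^ k * cAi ^ k = (1 :: int cub)" for k
    by (simp only: power_mult_distrib[symmetric] cA_cAi power_one)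
  have nA: "cub_norm (cA :: int cub) = 1" "cub_norm (cAi :: int cub) = 1" by simp_all
  have rAi: "rho cAi ^ 2 = g"
  proof -
    have "rho cA * rho cAi = 1" unfolding rho_mult[symmetric] cA_cAi by (simp add: rho_def one_cub_def)
    then have "al ^ 2 * rho cAi ^ 2 = al ^ 2 * g" unfolding ag rho_cA by (simp flip: power_mult_distrib)
    then show ?thesis using al by simp
  qed
  \<comment> \<open>As 1/\<alpha> = \<alpha> (1/\<alpha>)^2, the residual unit \<open>cAi\<close>
    belongs to the class of \<open>cA\<close> modulo squares.\<close>
  have fin: ?thesis if "x = z * (w ^ 2)" "z = 1 \<or> z = cAi" for z w
  proof -
    have "cA * cAi ^ 2 = (cA * cAi) * (cAi :: int cub)" by (simp only: power2_eq_square mult.assoc)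
    then have "cA * cAi ^ 2 = (cAi :: int cub)" by (simp only: cA_cAi mult_1)
    then have "cA * (cAi * w) ^ 2 = cAi * w ^ 2" by (simp only: power_mult_distrib mult.assoc[symmetric])
    then show ?thesis using that by (metis mult_1)
  qed
  have r0: "rho x > 0" using unit_rho_pos[OF n] .
  show ?thesis
  proof (cases "rho x \<ge> 1")
    case True
    obtain k0 where k0: "rho x < g ^ Suc k0"
    proof -
      obtain k0 where "rho x < g ^ k0" using real_arch_pow[of g "rho x"] g2 by auto
      also have "g ^ k0 \<le> g ^ Suc k0" using g2 by (intro power_increasing) auto
      finally show thesis by (rule that)
    qed
    define k where "k = (LEAST k. rho x < g ^ Suc k)"
    have k: "rho x < g ^ Suc k" unfolding k_def using k0 by (rule LeastI)
    have k': "g ^ k \<le> rho x"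
    proof (cases k)
      case 0 then show ?thesis using True by simp
    next
      case (Suc j)
      then have "\<not> rho x < g ^ Suc j" unfolding k_def by (metis lessI not_less_Least)
      then show ?thesis using Suc by simp
    qed
    define z where "z = x * (cA ^ k) ^ 2"
    have "rho z * g ^ k = rho x * (al ^ 2 * g) ^ k"
      by (simp add: z_def rho_mult rho_power rho_cA power_mult_distrib power_mult[symmetric] mult.commute del: power_mult)
    then have rz: "rho z * g ^ k = rho x" by (simp add: ag)
    have gk: "g ^ k > 0" using g2 by simp
    have "rho z = rho x / g ^ k" unfolding rz[symmetric] using g2 by simp
    then have "1 \<le> rho z" "rho z < g" using k k' gk by (simp_all add: field_simps)
    moreover have "cub_norm z = 1" by (simp only: z_def cub_norm_mult cub_norm_power n nA power_one mult_1)
    ultimately have "z = 1 \<or> z = cAi" using unit_bounded unfolding g_def by blast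
    moreover have "x = z * (cAi ^ k) ^ 2"
    proof -
      have "z * (cAi ^ k) ^ 2 = x * (cA ^ k * cAi ^ k) ^ 2" unfolding z_def power_mult_distrib by (simp only: mult.assoc)
      then show ?thesis by (simp only: inv power_one mult_1_right)
    qed
    ultimately show ?thesis using fin by blast
  next
    case False
    obtain k0 where "1 / rho x < g ^ k0" using real_arch_pow[of g "1 / rho x"] g2 by auto
    then have k0: "rho x * g ^ k0 \<ge> 1" using r0 by (simp add: field_simps)
    define k where "k = (LEAST k. rho x * g ^ k \<ge> 1)"
    have k: "rho x * g ^ k \<ge> 1" unfolding k_def using k0 by (rule LeastI)
    have k': "rho x * g ^ k < g"
    proof (cases k)
      case 0 then show ?thesis using False g2 by simp
    next
      case (Suc j)
      then have "\<not> rho x * g ^ j \<ge> 1" unfolding k_def by (metis lessI not_less_Least)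
      then have "rho x * g ^ j * g < 1 * g" using g2 by (intro mult_strict_right_mono) auto
      then show ?thesis using Suc by (simp add: mult_ac)
    qed
    define z where "z = x * (cAi ^ k) ^ 2"
    have "rho z = rho x * (rho cAi ^ 2) ^ k"
      by (simp only: z_def rho_mult rho_power power_mult[symmetric] mult.commute[of k 2])
    then have rz: "rho z = rho x * g ^ k" by (simp only: rAi)
    moreover have "cub_norm z = 1" by (simp only: z_def cub_norm_mult cub_norm_power n nA power_one mult_1)
    ultimately have "z = 1 \<or> z = cAi" using unit_bounded k k' unfolding g_def by metis
    moreover have "x = z * (cA ^ k) ^ 2"
    proof -
      have "z * (cA ^ k) ^ 2 = x * (cAi ^ k * cA ^ k) ^ 2" unfolding z_def power_mult_distrib by (simp only: mult.assoc)
      then show ?thesis using inv[of k] by (simp only: mult.commute[of "cAi ^ k"] power_one mult_1_right)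
    qed
    ultimately show ?thesis using fin by blast
  qed
qed

section \<open>The Mordell--Weil group\<close>

fun rcub :: "int cub \<Rightarrow> rat cub"
  where "rcub (Cub a b c) = Cub (of_int a) (of_int b) (of_int c)"

lemma rcub_mult: "rcub (x * y) = rcub x * rcub y"
  by (cases x; cases y) simp

text \<open>The discriminant of X^3 + X - 1 is -31, so only the prime 31 could be common. Expanding
  about the double root 2p = 3q^2 modulo 31 gives 8 r^2 = 31 q^6 modulo 31^2; since 31 divides r, it
  would then divide q, contrary to coprimality.\<close>

lemma coprime_derivative:
  fixes p q r :: int
  assumes "coprime p q" "r \<noteq> 0" and r: "r ^ 2 = p ^ 3 + p * q ^ 4 - q ^ 6"
  shows "coprime r (3 * p ^ 2 + q ^ 4)"
  using assms(2)
proof (rule coprimeI_prime)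
  fix l :: int
  assume l: "prime l" "l dvd r" "l dvd 3 * p ^ 2 + q ^ 4"
  have lr: "l dvd p ^ 3 + p * q ^ 4 - q ^ 6" using l(2) by (simp add: r[symmetric] power2_eq_square)
  have "3 * (p ^ 3 + p * q ^ 4 - q ^ 6) - p * (3 * p ^ 2 + q ^ 4) = q ^ 4 * (2 * p - 3 * q ^ 2)"
    by (simp add: algebra_simps power_numeral_reduce)
  then have d: "l dvd q ^ 4 * (2 * p - 3 * q ^ 2)"
    using l(3) lr by (metis dvd_diff dvd_mult)
  have nq: "\<not> l dvd q"
  proof
    assume lq: "l dvd q"
    have "p ^ 3 = (p ^ 3 + p * q ^ 4 - q ^ 6) - q * (p * q ^ 3 - q ^ 5)"
      by (simp add: algebra_simps power_numeral_reduce)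
    then have "l dvd p ^ 3" using lr lq by (metis dvd_diff dvd_mult2)
    then have "l dvd p" using l(1) by (rule prime_dvd_power[rotated])
    then show False using lq assms(1) l(1) by (meson coprime_common_divisor not_prime_unit)
  qed
  then have "\<not> l dvd q ^ 4" using l(1) prime_dvd_power by blast
  then have d2: "l dvd 2 * p - 3 * q ^ 2" using d l(1) by (simp add: prime_dvd_mult_iff)
  have "4 * (3 * p ^ 2 + q ^ 4) - (2 * p - 3 * q ^ 2) * (3 * (2 * p + 3 * q ^ 2)) = 31 * q ^ 4"
    by (simp add: algebra_simps power_numeral_reduce)
  then have "l dvd 31 * q ^ 4" using d2 l(3) by (metis dvd_diff dvd_mult dvd_mult2)
  then have "l dvd 31" using \<open>\<not> l dvd q ^ 4\<close> l(1) by (simp add: prime_dvd_mult_iff)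
  have "prime (31::int)"
  proof -
    have "prime (31::nat)" by (simp add: prime_nat_numeral_eq)
    then show ?thesis by (simp only: prime_int_numeral_eq)
  qed
  then have "l = 31" using \<open>l dvd 31\<close> l(1) by (simp add: primes_dvd_imp_eq)
  then obtain k where k: "2 * p = 3 * q ^ 2 + 31 * k" using d2 by (metis add.commute diff_add_cancel dvdE)
  obtain m where m: "r = 31 * m" using l(2) \<open>l = 31\<close> by (auto simp: dvd_def)
  have "8 * r ^ 2 = (2 * p) ^ 3 + 4 * (2 * p) * q ^ 4 - 8 * q ^ 6"
    unfolding r by (simp add: power_mult_distrib)
  also have "\<dots> = 31 * q ^ 6 + 961 * (k * q ^ 4 + 9 * k ^ 2 * q ^ 2 + 31 * k ^ 3)"
    unfolding k by (simp add: algebra_simps power_numeral_reduce)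
  finally have "31 * q ^ 6 = 31 * (31 * (8 * m ^ 2 - (k * q ^ 4 + 9 * k ^ 2 * q ^ 2 + 31 * k ^ 3)))"
    unfolding m by (simp add: power2_eq_square algebra_simps)
  then have "q ^ 6 = 31 * (8 * m ^ 2 - (k * q ^ 4 + 9 * k ^ 2 * q ^ 2 + 31 * k ^ 3))" by simp
  then have "31 dvd q ^ 6" by simp
  then have "l dvd q" using l(1) \<open>l = 31\<close> prime_dvd_power by blast
  then show False using nq by simp
qed

text \<open>The cubic splits as \<theta> \<theta>' = r^2 with \<theta> = p - q^2 \<alpha>, and
  \<theta>' is congruent to the derivative 3p^2 + q^4 modulo \<theta>. By
  \<open>coprime_derivative\<close> the elements \<theta>, \<theta>', r generate the unit ideal, so
  \<theta> is a square times a unit; that unit has norm 1 because the norm of \<theta> is r^2 >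
  0.\<close>

lemma two_descent:
  fixes x y :: rat
  assumes c: "y ^ 2 = x ^ 3 + x - 1"
  shows "\<exists>\<beta>. Cub x (- 1) 0 = \<beta> ^ 2 \<or> Cub x (- 1) 0 = cA * \<beta> ^ 2"
proof -
  obtain p r q :: int where pq: "q > 0" "coprime p q" "x = of_int p / of_int q ^ 2" "y = of_int r / of_int q ^ 3" and r: "r ^ 2 = p ^ 3 + p * q ^ 4 - q ^ 6"
    using curve_lowest_terms[OF c] by blast
  have r0: "r \<noteq> 0" using no_two_torsion[OF c] pq by auto
  define \<theta> where "\<theta> = Cub p (- (q ^ 2)) 0"
  define \<theta>' where "\<theta>' = Cub (p ^ 2 + q ^ 4) (p * q ^ 2) (q ^ 4)"
  define R where "R = Cub r 0 0"
  have 1: "\<theta> * \<theta>' = R ^ 2"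
    by (simp add: \<theta>_def \<theta>'_def R_def power2_eq_square[of "Cub r 0 0"] r[unfolded power2_eq_square[of r]])
      (simp add: algebra_simps power_numeral_reduce)
  have "coprime r (3 * p ^ 2 + q ^ 4)" by (rule coprime_derivative[OF pq(2) r0 r])
  then obtain s t where st: "s * r + t * (3 * p ^ 2 + q ^ 4) = 1"
    using bezout_int[of r "3 * p ^ 2 + q ^ 4"] by auto
  have "Cub (3 * p ^ 2 + q ^ 4) 0 0 = \<theta>' - \<theta> * (\<theta> - Cub (3 * p) 0 0)"
    by (simp add: \<theta>_def \<theta>'_def algebra_simps power_numeral_reduce)
  then have "Cub t 0 0 * (\<theta>' - \<theta> * (\<theta> - Cub (3 * p) 0 0)) + Cub s 0 0 * R = Cub t 0 0 * Cub (3 * p ^ 2 + q ^ 4) 0 0 + Cub s 0 0 * R"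
    by (simp only:)
  also have "\<dots> = Cub (t * (3 * p ^ 2 + q ^ 4)) 0 0 + Cub (s * r) 0 0"
    by (simp add: R_def)
  also have "\<dots> = 1" using st by (simp add: one_cub_def)
  finally have eq1: "Cub t 0 0 * (\<theta>' - \<theta> * (\<theta> - Cub (3 * p) 0 0)) + Cub s 0 0 * R = 1" .
  have gen: "(- A * (B - K)) * B + A * B' + S * R = A * (B' - B * (B - K)) + S * R" for A B B' K S R :: "int cub"
    by (simp add: algebra_simps)
  have 2: "(- Cub t 0 0 * (\<theta> - Cub (3 * p) 0 0)) * \<theta> + Cub t 0 0 * \<theta>' + Cub s 0 0 * R = 1"
    unfolding gen by (rule eq1)
  obtain d w w' where d: "\<theta> = d ^ 2 * w" "d ^ 2 = \<theta> * w'" using cub_square_factor[OF 1 2] by blast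
  have n\<theta>: "cub_norm \<theta> = r ^ 2"
    unfolding r by (simp add: \<theta>_def algebra_simps power_numeral_reduce)
  have "cub_norm \<theta> = cub_norm d ^ 2 * cub_norm w" "cub_norm d ^ 2 = cub_norm \<theta> * cub_norm w'"
    using d by (metis cub_norm_mult cub_norm_power)+
  then have n: "r ^ 2 = cub_norm d ^ 2 * cub_norm w" "r ^ 2 * 1 = r ^ 2 * (cub_norm w' * cub_norm w)"
    unfolding n\<theta> by (simp_all add: mult.assoc)
  then have "cub_norm w' * cub_norm w = 1" using r0 by (metis mult_cancel_left zero_eq_power2)
  moreover have "cub_norm w > 0"
  proof -
    have "0 < cub_norm d ^ 2 * cub_norm w" using n(1) r0 by (metis zero_less_power2)
    then show ?thesis by (simp add: zero_less_mult_iff)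
  qed
  ultimately have "cub_norm w = 1" by (metis dvd_triv_right zdvd1_eq abs_of_pos)
  then obtain y where y: "w = y ^ 2 \<or> w = cA * y ^ 2" using unit_class by blast
  define k where "k = Cub (1 / of_int q :: rat) 0 0"
  define \<beta> where "\<beta> = k * rcub (d * y)"
  have "Cub x (- 1) 0 = k ^ 2 * rcub \<theta>"
    using pq(1) by (simp add: k_def \<theta>_def pq(3) power2_eq_square)
  also have "k ^ 2 * rcub \<theta> = \<beta> ^ 2 \<or> k ^ 2 * rcub \<theta> = cA * \<beta> ^ 2"
  proof -
    have "rcub (z ^ 2) = rcub z ^ 2" for z by (simp only: power2_eq_square rcub_mult)
    moreover have "rcub cA = cA" by simp
    ultimately show ?thesis
      using y unfolding d(1) \<beta>_def by (auto simp only: rcub_mult power_mult_distrib mult_ac)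
  qed
  finally show ?thesis by blast
qed

text \<open>Converse of \<open>ell_add_chord\<close>: it turns a line found by algebra into a
  statement about the sum.\<close>

lemma chord_add:
  assumes ch: "chord l c x1 y1 x2 y2 x3 y3"
    and t: "x1 = x2 \<Longrightarrow> y1 = y2"
  shows "ell_add (Aff x1 y1) (Aff x2 y2) = Aff x3 y3"
proof -
  note on = chord_on_curve[OF ch]
  have y1: "y1 \<noteq> 0" using no_two_torsion[OF on(1)] .
  have n: "\<not> (x1 = x2 \<and> y1 = - y2)" using t y1 by auto
  obtain l' c' x' y' where s: "ell_add (Aff x1 y1) (Aff x2 y2) = Aff x' y'"
    and ch': "chord l' c' x1 y1 x2 y2 x' y'" and tg: "x1 = x2 \<longrightarrow> 2 * y1 * l' = 3 * x1 ^ 2 + 1"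
    using ell_add_chord[OF on(1,2) n] by metis
  have "l' = l"
  proof (cases "x1 = x2")
    case True
    then have "chord l c x3 (- y3) x1 y1 x1 (- y1)" using ch t by (auto simp: chord_def ac_simps)
    then have "2 * y1 * l = 3 * x1 ^ 2 + 1" by (rule chord_tangent)
    then have "2 * y1 * l' = 2 * y1 * l" using tg True by simp
    then show ?thesis using y1 by simp
  next
    case False
    have "y1 = l * x1 + c" "y2 = l * x2 + c" "y1 = l' * x1 + c'" "y2 = l' * x2 + c'"
      using ch ch' by (simp_all add: chord_def)
    then have "(l' - l) * (x1 - x2) = 0" by algebra
    then show ?thesis using False by simp
  qed
  moreover from this have "c' = c" using ch ch' by (simp add: chord_def)
  ultimately have "x' = x3 \<and> y' = y3" using ch ch' by (simp add: chord_def)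
  then show ?thesis using s by simp
qed

text \<open>If \<open>x - \<alpha> = (u + v \<alpha> + w \<alpha> ^ 2) ^ 2\<close>, then with \<open>a = v / w\<close> the product of the root with
  \<open>\<alpha> - a\<close> is linear in \<open>\<alpha>\<close>, and it is the tangent line at a point with abscissa \<open>a\<close>.\<close>

lemma square_imp_double:
  fixes x y :: rat
  assumes c: "y ^ 2 = x ^ 3 + x - 1" and sq: "Cub x (- 1) 0 = \<beta> ^ 2"
  shows "\<exists>Q \<in> ell_curve. Aff x y = ell_add Q Q"
proof -
  obtain u v w where b: "\<beta> = Cub u v w" by (cases \<beta>)
  have e: "x = u * u + 2 * v * w" "- 1 = 2 * u * v - 2 * v * w + w * w" "0 = 2 * u * w + v * v - w * w"
    using sq by (simp_all add: b power2_eq_square algebra_simps)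
  have w0: "w \<noteq> 0" using e(2,3) by auto
  define a where "a = v / w"
  have v: "v = a * w" using w0 by (simp add: a_def)
  have "w * (2 * u) = w * (w * (1 - a ^ 2))" using e(3) unfolding v by algebra
  then have u: "2 * u = w * (1 - a ^ 2)" using w0 by (simp only: mult_cancel_left) simp
  have w1: "w ^ 2 * (a ^ 3 + a - 1) = 1" using e(2) u unfolding v by algebra
  \<comment> \<open>m + l \<alpha> is the product of \<beta> with \<alpha> - a. Squaring it gives (x
    - \<alpha>) (\<alpha> - a)^2, that is, X^3 + X - 1 - (l X + m)^2 = (X - a)^2 (X - x): the line
    touches the curve at abscissa a.\<close>
  define l m where "l = u - a ^ 2 * w - w" and "m = w - u * a"
  have l2: "2 * l = - (w * (1 + 3 * a ^ 2))" using u unfolding l_def by algebra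
  have m2: "2 * m = w * (2 - a + a ^ 3)" using u unfolding m_def by algebra
  have x4: "4 * x = w ^ 2 * ((1 - a ^ 2) ^ 2 + 8 * a)" using e(1) u unfolding v by algebra
  have v1: "4 * (a + a + x) = 4 * l ^ 2" using x4 l2 w1 by algebra
  have v2: "4 * (a * a + a * x + a * x) = 4 * (1 - 2 * l * m)" using x4 l2 m2 w1 by algebra
  have v3: "4 * (a * a * x) = 4 * (1 + m ^ 2)" using x4 m2 w1 by algebra
  have ch: "chord l m a (l * a + m) a (l * a + m) x (- (l * x + m))"
    using v1 v2 v3 unfolding chord_def by simp
  define Q where "Q = Aff a (l * a + m)"
  have Q: "Q \<in> ell_curve" using chord_on_curve(1)[OF ch] by (simp add: Q_def ell_curve_Aff)
  have d: "ell_add Q Q = Aff x (- (l * x + m))" unfolding Q_def by (rule chord_add[OF ch]) simp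
  have "y ^ 2 = (- (l * x + m)) ^ 2" using chord_on_curve(3)[OF ch] c by simp
  then consider "y = - (l * x + m)" | "y = l * x + m" by (auto simp: power2_eq_iff)
  then show ?thesis
  proof cases
    case 1 then show ?thesis using d Q by (intro bexI[of _ Q]) simp_all
  next
    case 2
    then have "Aff x y = ell_neg (ell_add Q Q)" using d by simp
    then have "Aff x y = ell_add (ell_neg Q) (ell_neg Q)" by (simp add: ell_neg_add_distrib)
    then show ?thesis using ell_neg_in[OF Q] by blast
  qed
qed

text \<open>Three collinear points satisfy (x - \<alpha>) (1 - \<alpha>) (x3 - \<alpha>) = (m + l
  \<alpha>)^2, and 1 - \<alpha> = \<alpha>^3. Adding g thus moves the class of \<alpha> to the
  trivial class modulo squares. Divisions are made by explicit inverses: \<open>Yc * K ^ 2\<close>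
  inverts x - \<alpha>, and \<open>cAi\<close> inverts \<alpha>.\<close>

lemma gen_add_square:
  fixes x y :: rat
  assumes c: "y ^ 2 = x ^ 3 + x - 1" and sq: "Cub x (- 1) 0 = cA * \<beta> ^ 2" and x1: "x \<noteq> 1"
  shows "\<exists>x3 y3 \<gamma>. ell_add (Aff x y) gen = Aff x3 y3 \<and> Cub x3 (- 1) 0 = \<gamma> ^ 2"
proof -
  obtain l m x3 y3 where s: "ell_add (Aff x y) (Aff 1 1) = Aff x3 y3" and ch: "chord l m x y 1 1 x3 y3"
    using ell_add_chord[OF c, of 1 1] x1 by auto
  define X X3 L Yc K where "X = Cub x (- 1) 0" and "X3 = Cub x3 (- 1) 0" and "L = Cub m l 0"
    and "Yc = Cub (x ^ 2 + 1) x 1" and "K = Cub (1 / y) 0 0"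
  have y0: "y \<noteq> 0" using no_two_torsion[OF c] .
  have v: "x + 1 + x3 = l ^ 2" "x + x * x3 + x3 = 1 - 2 * l * m" "x * x3 = 1 + m ^ 2"
    using ch by (simp_all add: chord_def)
  have L: "L ^ 2 = X * X3 * (cA * cA * cA)"
  proof -
    have "m * m = x * x3 - 1" "2 * l * m = 1 - x - x * x3 - x3" "l * l = x + 1 + x3"
      using v by (simp_all add: power2_eq_square)
    then show ?thesis
      by (simp add: X_def X3_def L_def power2_eq_square algebra_simps)
  qed
  have XY: "X * Yc * K ^ 2 = 1"
  proof -
    have "X * Yc = Cub (y ^ 2) 0 0" unfolding c
      by (simp add: X_def Yc_def power2_eq_square power3_eq_cube algebra_simps)
    then show ?thesis using y0 by (simp add: K_def power2_eq_square one_cub_def)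
  qed
  define \<gamma> where "\<gamma> = L * \<beta> * cAi * Yc * K ^ 2"
  have inv: "cA * cAi = (1 :: rat cub)" by (rule cA_cAi)
  have "\<gamma> ^ 2 = L ^ 2 * \<beta> ^ 2 * cAi ^ 2 * Yc ^ 2 * (K ^ 2) ^ 2"
    unfolding \<gamma>_def by (simp only: power_mult_distrib)
  also have "\<dots> = X3 * (cA * \<beta> ^ 2) * X * Yc ^ 2 * (K ^ 2) ^ 2 * (cA * cAi) ^ 2"
    unfolding L by (simp only: power2_eq_square mult_ac)
  also have "\<dots> = X3 * (X * Yc * K ^ 2) ^ 2"
    unfolding sq[symmetric] X_def[symmetric] inv by (simp only: power2_eq_square mult_ac mult_1_left mult_1_right)
  finally have "X3 = \<gamma> ^ 2" unfolding XY by simp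
  then show ?thesis using s unfolding X3_def gen_def by blast
qed

lemma halving:
  fixes P :: "rat point"
  assumes P: "P \<in> ell_curve"
  shows "\<exists>Q \<in> ell_curve. P = ell_add Q Q \<or> ell_add P gen = ell_add Q Q"
proof (cases P)
  case Infty
  then show ?thesis using Infty_in_ell_curve by (intro bexI[of _ Infty]) auto
next
  case (Aff x y)
  then have c: "y ^ 2 = x ^ 3 + x - 1" using P by (simp add: ell_curve_Aff)
  obtain \<beta> where b: "Cub x (- 1) 0 = \<beta> ^ 2 \<or> Cub x (- 1) 0 = cA * \<beta> ^ 2" using two_descent[OF c] by blast
  show ?thesis
  proof (cases "Cub x (- 1) 0 = \<beta> ^ 2")
    case True
    then show ?thesis using square_imp_double[OF c] Aff by blast
  next
    case False
    then have sq: "Cub x (- 1) 0 = cA * \<beta> ^ 2" using b by blast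
    show ?thesis
    proof (cases "x = 1")
      case True
      then have "y = 1 \<or> y = - 1" using c by (simp add: power2_eq_1_iff)
      then show ?thesis
      proof
        assume "y = 1"
        then show ?thesis using True Aff gen_in_ell_curve by (intro bexI[of _ gen]) (auto simp: gen_def)
      next
        assume "y = - 1"
        then show ?thesis using True Aff Infty_in_ell_curve by (intro bexI[of _ Infty]) (auto simp: gen_def)
      qed
    next
      case False
      obtain x3 y3 \<gamma> where 3: "ell_add P gen = Aff x3 y3" "Cub x3 (- 1) 0 = \<gamma> ^ 2"
        using gen_add_square[OF c sq False] Aff by blast
      have "ell_add P gen \<in> ell_curve" using ell_add_in[OF P gen_in_ell_curve] .
      then show ?thesis using square_imp_double[OF _ 3(2)] 3(1) by (auto simp: ell_curve_Aff)
    qed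
  qed
qed


section \<open>Descent with the canonical height\<close>

lemma neron_tate_nonneg:
  assumes P: "P \<in> ell_curve"
  shows "neron_tate P \<ge> 0"
  by (rule LIMSEQ_le_const[OF neron_tate_bounds(1)[OF P]]) (auto simp: ln_hgt_nonneg hgt_ge_1)

text \<open>The point 2g has height only 2, so estimating it and dividing by 4 also quarters the
  error term; the result is ln 80 / 24. The bound claimed is the threshold that the descent to
  height at most 8 = 512^(1/3) requires.\<close>

lemma neron_tate_gen_less: "neron_tate gen < ln (512 / 265) / 2"
proof -
  have "rat_height 2 = 2" using rat_height_quotient[of 2 1] by simp
  then have "neron_tate (ell_mult 2 gen) \<le> (ln 2 + ln 10 / 3) / 2"
    using neron_tate_bounds(2)[OF ell_mult_in[OF gen_in_ell_curve], of 2] by (simp add: ell_mult_2_gen)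
  then have "4 * neron_tate gen \<le> (ln 2 + ln 10 / 3) / 2"
    unfolding neron_tate_mult[OF gen_in_ell_curve] by simp
  moreover have "3 * ln 2 + ln 10 = ln (80::real)"
  proof -
    have "ln (2 ^ 3 * 10 :: real) = 3 * ln 2 + ln 10" by (simp only: ln_mult ln_realpow) (simp add: ln_mult ln_realpow)
    then show ?thesis by simp
  qed
  moreover have "ln (80::real) < 12 * ln (512 / 265)"
  proof -
    have "(80::real) < (512 / 265) ^ 12" by (simp add: power_divide)
    then have "ln (80::real) < ln ((512 / 265) ^ 12)" by (subst ln_less_cancel_iff) auto
    then show ?thesis by (simp add: ln_realpow)
  qed
  ultimately show ?thesis by simp
qed

lemma between_squares:
  fixes r a :: int
  assumes "a ^ 2 < r ^ 2" "r ^ 2 < (a + 1) ^ 2" "a \<ge> 0"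
  shows False
proof -
  have "\<bar>a\<bar> < \<bar>r\<bar>" "\<bar>r\<bar> < \<bar>a + 1\<bar>" using assms abs_le_square_iff by (metis linorder_not_le)+
  then show False using assms(3) by linarith
qed

lemma small_height_points:
  assumes P: "P \<in> ell_curve" and h: "hgt P \<le> 8"
  shows "\<exists>a. P = ell_mult a gen"
proof (cases P)
  case Infty
  then show ?thesis by (intro exI[of _ 0]) (simp add: ell_mult_0)
next
  case (Aff x y)
  then have c: "y ^ 2 = x ^ 3 + x - 1" using P by (simp add: ell_curve_Aff)
  obtain p r q :: int where pq: "q > 0" "coprime p q" "x = of_int p / of_int q ^ 2" "y = of_int r / of_int q ^ 3" and r: "r ^ 2 = p ^ 3 + p * q ^ 4 - q ^ 6"
    using curve_lowest_terms[OF c] by blast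
  have p0: "p > 0" using curve_pos[OF c] pq(1,3) by (simp add: zero_less_divide_iff)
  have "hgt P = max p (q ^ 2)"
    using Aff rat_height_quotient[of p "q ^ 2"] pq p0 by simp
  then have p8: "p \<le> 8" and q8: "q ^ 2 \<le> 8" using h by simp_all
  have q2: "q \<le> 2"
  proof (rule ccontr)
    assume "\<not> q \<le> 2"
    then have "3 ^ 2 \<le> q ^ 2" by (intro power_mono) auto
    then show False using q8 by simp
  qed
  have gens: "ell_mult 1 gen = Aff 1 1" "ell_mult (- 1) gen = Aff 1 (- 1)" "ell_mult 2 gen = Aff 2 (- 3)" "ell_mult (- 2) gen = Aff 2 3"
    unfolding ell_mult_neg ell_mult_2_gen ell_mult_1 by (simp_all add: gen_def)
  have "p = 1 \<or> p = 2 \<or> p = 3 \<or> p = 4 \<or> p = 5 \<or> p = 6 \<or> p = 7 \<or> p = 8" using p0 p8 by linarith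
  moreover have "q = 1 \<or> q = 2" using pq(1) q2 by linarith
  moreover have "\<not> (2 dvd p \<and> q = 2)" using pq(2) by auto
  \<comment> \<open>These numbers, together with -47 below, are the values of p^3 + p q^4 - q^6 for
    the remaining admissible pairs (p, q).\<close>
  moreover have "r ^ 2 \<noteq> 29" "r ^ 2 \<noteq> 67" "r ^ 2 \<noteq> 129" "r ^ 2 \<noteq> 221" "r ^ 2 \<noteq> 349" "r ^ 2 \<noteq> 519"
    "r ^ 2 \<noteq> 11" "r ^ 2 \<noteq> 141" "r ^ 2 \<noteq> 391"
    using between_squares[of 5 r] between_squares[of 8 r] between_squares[of 11 r] between_squares[of 14 r]
      between_squares[of 18 r] between_squares[of 22 r] between_squares[of 3 r] between_squares[of 19 r] by auto
  moreover have "r ^ 2 \<noteq> - 47" by (metis neg_numeral_less_zero not_less zero_le_power2)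
  ultimately have "q = 1 \<and> (p = 1 \<and> r ^ 2 = 1 ^ 2 \<or> p = 2 \<and> r ^ 2 = 3 ^ 2)"
    using r by (elim disjE) simp_all
  then have "q = 1 \<and> (p = 1 \<and> (r = 1 \<or> r = - 1) \<or> p = 2 \<and> (r = 3 \<or> r = - 3))"
    by (simp only: power2_eq_iff)
  then have "x = 1 \<and> (y = 1 \<or> y = - 1) \<or> x = 2 \<and> (y = 3 \<or> y = - 3)"
    using pq by auto
  then show ?thesis unfolding Aff using gens by metis
qed

text \<open>Halving replaces a height h by at most (h + G)/4 with G the height of g, and G/3 is the
  fixed point of this map; the excess over it shrinks by the factor 4. The value \<open>T\<close>
  satisfies 2T + ln 265 / 3 = ln 8, so k = 0 is the list of small points.\<close>

theorem mordell_weil: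
  assumes "P \<in> ell_curve"
  shows "\<exists>a. P = ell_mult a gen"
proof -
  define T where "T = ln (512 / 265 :: real) / 6"
  define \<delta> where "\<delta> = T - neron_tate gen / 3"
  have \<delta>: "\<delta> > 0" using neron_tate_gen_less by (simp add: \<delta>_def T_def)
  have g: "gen \<in> ell_curve" "ell_neg gen \<in> ell_curve" using gen_in_ell_curve ell_neg_in by blast+
  have g0: "neron_tate gen \<ge> 0" using neron_tate_nonneg[OF g(1)] .
  have main: "P \<in> ell_curve \<Longrightarrow> neron_tate P \<le> neron_tate gen / 3 + 4 ^ k * \<delta> \<Longrightarrow> \<exists>a. P = ell_mult a gen" for k P
  proof (induction k arbitrary: P)
    case 0
    then have "neron_tate P \<le> T" by (simp add: \<delta>_def)
    then have "ln (hgt P) \<le> 2 * T + ln 265 / 3" using neron_tate_bounds(3)[OF 0(1)] by simp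
    also have "\<dots> = ln 8"
    proof -
      have "6 * T = ln 512 - ln 265" by (simp add: T_def ln_div)
      moreover have "ln (512::real) = 3 * ln 8" using ln_realpow[of 8 3] by simp
      ultimately show ?thesis by simp
    qed
    finally have "real_of_int (hgt P) \<le> 8"
      using hgt_ge_1[of P] by (subst (asm) ln_le_cancel_iff) auto
    then have "hgt P \<le> 8" by linarith
    then show ?case using small_height_points[OF 0(1)] by blast
  next
    case (Suc k)
    have dbl: "\<exists>a. ell_add Q Q = ell_mult a gen" if Qc: "Q \<in> ell_curve" and Qh: "4 * neron_tate Q \<le> neron_tate P + neron_tate gen" for Q
    proof -
      have "4 * neron_tate Q \<le> 4 * (neron_tate gen / 3 + 4 ^ k * \<delta>)" using Qh Suc.prems(2) by simp
      then have "neron_tate Q \<le> neron_tate gen / 3 + 4 ^ k * \<delta>" by simp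
      then obtain a where "Q = ell_mult a gen" using Suc.IH[OF Qc] by blast
      then have "ell_add Q Q = ell_mult (a + a) gen" by (simp only: ell_mult_add[OF g(1), of a a])
      then show ?thesis by blast
    qed
    obtain Q where Q: "Q \<in> ell_curve" "P = ell_add Q Q \<or> ell_add P gen = ell_add Q Q"
      using halving[OF Suc.prems(1)] by blast
    show ?case
    proof (cases "P = ell_add Q Q")
      case True
      then show ?thesis using dbl[OF Q(1)] neron_tate_double[OF Q(1)] g0 by simp
    next
      case False
      then have PQ: "ell_add P gen = ell_add Q Q" using Q by blast
      have undo: "P = ell_add (ell_add P gen) (ell_neg gen)" "P = ell_add (ell_add P (ell_neg gen)) gen"
        using ell_add_cancel[OF Suc.prems(1) g(1)] ell_add_cancel[OF Suc.prems(1) g(2)] by (simp_all add: ell_neg_neg)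
      have mg: "ell_neg gen = ell_mult (- 1) gen" "gen = ell_mult 1 gen" by (simp_all add: ell_mult_neg ell_mult_1)
      have "neron_tate (ell_add P gen) + neron_tate (ell_add P (ell_neg gen)) = 2 * neron_tate P + 2 * neron_tate gen"
        by (rule neron_tate_parallelogram[OF Suc.prems(1) g(1)])
      \<comment> \<open>One of P + g and P - g has height at most the average of the two, and both
        are doubles: if P + g = 2Q, then P - g = 2(Q - g). The descent continues with that
        one.\<close>
      then consider "neron_tate (ell_add P gen) \<le> neron_tate P + neron_tate gen"
        | "neron_tate (ell_add P (ell_neg gen)) \<le> neron_tate P + neron_tate gen" by linarith
      then show ?thesis
      proof cases
        case 1
        then obtain a where "ell_add P gen = ell_mult a gen"
          using dbl[OF Q(1)] neron_tate_double[OF Q(1)] unfolding PQ by auto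
        then have "P = ell_mult (a + - 1) gen" using undo(1) ell_mult_add[OF g(1)] mg(1) by metis
        then show ?thesis by blast
      next
        case 2
        define R where "R = ell_add Q (ell_neg gen)"
        have R: "R \<in> ell_curve" unfolding R_def by (rule ell_add_in[OF Q(1) g(2)])
        have "ell_add R R = ell_add (ell_add Q Q) (ell_add (ell_neg gen) (ell_neg gen))"
          using ell_mult_ell_add[OF Q(1) g(2), of 2] by (simp add: ell_mult_2 R_def)
        also have "\<dots> = ell_add (ell_add (ell_add P gen) (ell_neg gen)) (ell_neg gen)"
          unfolding PQ[symmetric] using Suc.prems(1) g by (simp add: ell_add_assoc ell_add_in)
        finally have "ell_add P (ell_neg gen) = ell_add R R" using undo(1) by simp
        then obtain a where "ell_add P (ell_neg gen) = ell_mult a gen"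
          using dbl[OF R] neron_tate_double[OF R] 2 by auto
        then have "P = ell_mult (a + 1) gen" using undo(2) ell_mult_add[OF g(1)] mg(2) by metis
        then show ?thesis by blast
      qed
    qed
  qed
  obtain k where "neron_tate P / \<delta> < 4 ^ k" using real_arch_pow[of 4 "neron_tate P / \<delta>"] by auto
  then have "neron_tate P \<le> neron_tate gen / 3 + 4 ^ k * \<delta>" using \<delta> g0 by (simp add: field_simps)
  then show ?thesis using main[OF assms] by blast
qed

section \<open>Points at infinity of the closure\<close>

text \<open>Coinciding exponents add up, so a form may be specified by any finite family of
  monomials.\<close>

lemma eval_form_sum:
  assumes "finite S" "\<And>s. s \<in> S \<Longrightarrow> us s \<in> exponents d \<and> vs s \<in> exponents e"
  shows "eval_form (d, e, \<lambda>u v. \<Sum>s\<in>S. if u = us s \<and> v = vs s then a s else 0) (P, Q) =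
    (\<Sum>s\<in>S. a s * monomial (us s) (hom_coords P) * monomial (vs s) (hom_coords Q))"
proof -
  let ?m = "\<lambda>u. monomial u (hom_coords P)" and ?m' = "\<lambda>v. monomial v (hom_coords Q)"
  let ?t = "\<lambda>s u v. if u = us s then if v = vs s then a s * ?m u * ?m' v else 0 else 0"
  have "eval_form (d, e, \<lambda>u v. \<Sum>s\<in>S. if u = us s \<and> v = vs s then a s else 0) (P, Q)
      = (\<Sum>u\<in>exponents d. \<Sum>v\<in>exponents e. \<Sum>s\<in>S. ?t s u v)"
    unfolding eval_form_def prod.case sum_distrib_right by (intro sum.cong refl) auto
  also have "\<dots> = (\<Sum>u\<in>exponents d. \<Sum>s\<in>S. \<Sum>v\<in>exponents e. ?t s u v)"
    by (intro sum.cong refl sum.swap)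
  also have "\<dots> = (\<Sum>s\<in>S. \<Sum>u\<in>exponents d. \<Sum>v\<in>exponents e. ?t s u v)"
    by (rule sum.swap)
  also have "\<dots> = (\<Sum>s\<in>S. a s * ?m (us s) * ?m' (vs s))"
  proof (rule sum.cong[OF refl])
    fix s assume s: "s \<in> S"
    have "(\<Sum>u\<in>exponents d. \<Sum>v\<in>exponents e. ?t s u v)
      = (\<Sum>u\<in>exponents d. if u = us s then (\<Sum>v\<in>exponents e. if v = vs s then a s * ?m u * ?m' v else 0) else 0)"
      by (intro sum.cong refl) simp
    also have "\<dots> = a s * ?m (us s) * ?m' (vs s)"
      using assms(2)[OF s] by (simp add: finite_exponents)
    finally show "(\<Sum>u\<in>exponents d. \<Sum>v\<in>exponents e. ?t s u v) = a s * ?m (us s) * ?m' (vs s)" .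
  qed
  finally show ?thesis .
qed

lemma affine_C_in: "R \<in> affine_C n \<Longrightarrow> R \<in> ell_curve \<times> ell_curve"
  by (auto simp: affine_C_def ell_curve_def)

lemma curve_C_form:
  assumes "R \<in> curve_C n" "\<And>S. S \<in> affine_C n \<Longrightarrow> eval_form f S = 0"
  shows "R \<in> ell_curve \<times> ell_curve" "eval_form f R = 0"
proof -
  define Z where "Z = {R \<in> ell_curve \<times> ell_curve. \<forall>g\<in>{f}. eval_form g R = 0}"
  have "zariski_closed Z" unfolding zariski_closed_def Z_def by blast
  moreover have "affine_C n \<subseteq> Z" unfolding Z_def using assms(2) affine_C_in by blast
  ultimately have "curve_C n \<subseteq> Z" unfolding curve_C_def by (rule hull_minimal[rotated])
  then have "R \<in> Z" using assms(1) by blast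
  then show "R \<in> ell_curve \<times> ell_curve" "eval_form f R = 0" by (simp_all add: Z_def)
qed

text \<open>The form X1^n Z2 - Z1^n Y2 vanishes on the affine curve, hence on its closure. With Z1 =
  1 its value at (0, 1, 0) in the second factor is -1, which excludes \<open>Infty\<close>
  there.\<close>

lemma curve_C_affine_left:
  assumes R: "(Aff x1 y1, Q) \<in> curve_C n"
  shows "\<exists>x2 y2. Q = Aff x2 y2 \<and> x1 ^ n = y2"
proof -
  define us :: "bool \<Rightarrow> nat \<times> nat \<times> nat" where "us s = (if s then (n, 0, 0) else (0, 0, n))" for s
  define vs :: "bool \<Rightarrow> nat \<times> nat \<times> nat" where "vs s = (if s then (0, 0, 1) else (0, 1, 0))" for s
  define f :: "nat \<times> nat \<times> (nat \<times> nat \<times> nat \<Rightarrow> nat \<times> nat \<times> nat \<Rightarrow> complex)"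
    where "f = (n, 1, \<lambda>u v. \<Sum>s\<in>UNIV. if u = us s \<and> v = vs s then (if s then 1 else - 1) else 0)"
  have ev: "eval_form f (P, Q) = (\<Sum>s\<in>UNIV. (if s then 1 else - 1) * monomial (us s) (hom_coords P) * monomial (vs s) (hom_coords Q))" for P Q
    unfolding f_def by (rule eval_form_sum) (auto simp: us_def vs_def exponents_def)
  have "eval_form f S = 0" if "S \<in> affine_C n" for S
    using that by (auto simp: affine_C_def ev UNIV_bool us_def vs_def)
  from curve_C_form(2)[OF R this] show ?thesis
    by (cases Q) (simp_all add: ev UNIV_bool us_def vs_def)
qed

text \<open>The form used here is \<open>Y1 ^ (2 n) Z2\<close> minus the homogenization of \<open>(x1 ^ 3 + x1 - 1) ^ n\<close>, where
  the monomials of degree greater than \<open>2 n\<close> are lowered by means of \<open>x1 ^ n = y2\<close>.\<close>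

lemma curve_C_not_Infty_left:
  assumes n: "n \<ge> 1"
  shows "(Infty, Aff x2 y2) \<notin> curve_C n"
proof
  assume R: "(Infty, Aff x2 y2) \<in> curve_C n"
  define p :: "complex poly" where "p = [:- 1, 1, 0, 1:] ^ n"
  have deg: "degree p \<le> 3 * n"
    unfolding p_def using degree_power_le[of "[:- 1, 1, 0, 1:] :: complex poly" n] by simp
  \<comment> \<open>The indices up to 3n are the coefficients of \<open>p\<close>, and 3n + 1 is
    Y1^(2n) Z2. Without lowering the degrees above 2n, homogenizing would multiply Y1^(2n) by Z1^n
    and the form would carry no information at \<open>Infty\<close>; now every other monomial
    contains X1 or Z1.\<close>
  define us where "us s = (if s \<le> 2 * n then (s, 0, 2 * n - s) else if s \<le> 3 * n then (s - n, 0, 3 * n - s) else (0, 2 * n, 0))" for s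
  define vs :: "nat \<Rightarrow> nat \<times> nat \<times> nat" where "vs s = (if 2 * n < s \<and> s \<le> 3 * n then (0, 1, 0) else (0, 0, 1))" for s
  define a where "a s = (if s \<le> 3 * n then - coeff p s else 1)" for s
  define f :: "nat \<times> nat \<times> (nat \<times> nat \<times> nat \<Rightarrow> nat \<times> nat \<times> nat \<Rightarrow> complex)"
    where "f = (2 * n, 1, \<lambda>u v. \<Sum>s\<in>{..Suc (3 * n)}. if u = us s \<and> v = vs s then a s else 0)"
  have ev: "eval_form f (P, Q) = (\<Sum>s\<le>3 * n. - coeff p s * monomial (us s) (hom_coords P) * monomial (vs s) (hom_coords Q))
      + monomial (0, 2 * n, 0) (hom_coords P) * monomial (0, 0, 1) (hom_coords Q)" for P Q
  proof -
    have "eval_form f (P, Q) = (\<Sum>s\<in>{..Suc (3 * n)}. a s * monomial (us s) (hom_coords P) * monomial (vs s) (hom_coords Q))"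
      unfolding f_def by (rule eval_form_sum) (auto simp: us_def vs_def exponents_def)
    also have "\<dots> = (\<Sum>s\<le>3 * n. a s * monomial (us s) (hom_coords P) * monomial (vs s) (hom_coords Q))
      + monomial (0, 2 * n, 0) (hom_coords P) * monomial (0, 0, 1) (hom_coords Q)"
      by (simp add: a_def us_def vs_def)
    also have "(\<Sum>s\<le>3 * n. a s * monomial (us s) (hom_coords P) * monomial (vs s) (hom_coords Q))
      = (\<Sum>s\<le>3 * n. - coeff p s * monomial (us s) (hom_coords P) * monomial (vs s) (hom_coords Q))"
      by (intro sum.cong refl) (simp add: a_def)
    finally show ?thesis .
  qed
  have "eval_form f S = 0" if S: "S \<in> affine_C n" for S
  proof -
    obtain x1 y1 x2 y2 where S: "S = (Aff x1 y1, Aff x2 y2)" and c: "y1 ^ 2 = x1 ^ 3 + x1 - 1" and e: "x1 ^ n = y2"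
      using S by (auto simp: affine_C_def)
    have "(\<Sum>s\<le>3 * n. - coeff p s * monomial (us s) (hom_coords (Aff x1 y1)) * monomial (vs s) (hom_coords (Aff x2 y2)))
      = (\<Sum>s\<le>3 * n. - (coeff p s * x1 ^ s))"
    proof (intro sum.cong refl)
      fix s assume "s \<in> {..3 * n}"
      then have "2 * n < s \<Longrightarrow> x1 ^ (s - n) * x1 ^ n = x1 ^ s" by (simp flip: power_add)
      then show "- coeff p s * monomial (us s) (hom_coords (Aff x1 y1)) * monomial (vs s) (hom_coords (Aff x2 y2)) = - (coeff p s * x1 ^ s)"
        using \<open>s \<in> {..3 * n}\<close> by (auto simp: us_def vs_def e[symmetric])
    qed
    also have "\<dots> = - poly p x1"
    proof -
      have "poly p x1 = (\<Sum>s\<le>3 * n. coeff p s * x1 ^ s)"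
        unfolding poly_altdef using deg by (intro sum.mono_neutral_left) (auto simp: coeff_eq_0)
      then show ?thesis by (simp add: sum_negf)
    qed
    also have "\<dots> = - (y1 ^ (2 * n))"
    proof -
      have "poly [:- 1, 1, 0, 1:] x1 = x1 ^ 3 + x1 - 1" by (simp add: algebra_simps power3_eq_cube)
      then show ?thesis unfolding p_def power_mult c poly_power by simp
    qed
    finally show ?thesis unfolding S ev by simp
  qed
  from curve_C_form(2)[OF R this] have "eval_form f (Infty, Aff x2 y2) = 0" .
  moreover have "monomial (us s) (hom_coords (Infty :: complex point)) = 0" if "s \<le> 3 * n" for s
    using that n by (cases "s = 0") (auto simp: us_def)
  ultimately show False unfolding ev by simp
qed

lemma rational_C_cases:
  assumes n: "n \<ge> 1" and R: "(P, Q) \<in> rational_C n"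
  shows "P = Infty \<and> Q = Infty \<or> (\<exists>x1 y1 x2 y2. P = Aff x1 y1 \<and> Q = Aff x2 y2 \<and>
    y1 ^ 2 = x1 ^ 3 + x1 - 1 \<and> y2 ^ 2 = x2 ^ 3 + x2 - 1 \<and> x1 ^ n = y2)"
proof -
  have C: "(map_point of_rat P, map_point of_rat Q) \<in> curve_C n" using R by (simp add: rational_C_def)
  \<comment> \<open>The zero form imposes no condition; it serves to extract from
    \<open>curve_C_form\<close> that the closure lies in E^2.\<close>
  have zero: "eval_form (0, 0, \<lambda>_ _. 0) S = (0 :: complex)" for S
    by (cases S) (simp add: eval_form_def)
  have on: "(map_point of_rat P, map_point of_rat Q) \<in> (ell_curve :: complex point set) \<times> (ell_curve :: complex point set)"
    by (rule curve_C_form(1)[OF C, of "(0, 0, \<lambda>_ _. 0)"]) (rule zero)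
  have tr: "y ^ 2 = x ^ 3 + x - 1" if "Aff (of_rat x) (of_rat y) \<in> (ell_curve :: complex point set)" for x y
  proof -
    have "of_rat (y ^ 2) = (of_rat (x ^ 3 + x - 1) :: complex)"
      using that by (simp add: ell_curve_def of_rat_power of_rat_add of_rat_diff)
    then show ?thesis by (simp only: of_rat_eq_iff)
  qed
  show ?thesis
  proof (cases P; cases Q)
    fix x1 y1 x2 y2
    assume PQ: "P = Aff x1 y1" "Q = Aff x2 y2"
    have "(of_rat x1 :: complex) ^ n = of_rat y2"
      using curve_C_affine_left C PQ by fastforce
    then have "(of_rat (x1 ^ n) :: complex) = of_rat y2" by (simp add: of_rat_power)
    then have "x1 ^ n = y2" by (simp only: of_rat_eq_iff)
    then show ?thesis using PQ on tr by auto
  qed (use C curve_C_affine_left curve_C_not_Infty_left[OF n] in \<open>fastforce+\<close>)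
qed

section \<open>Points close to the origin\<close>

text \<open>Up to sign, \<open>zc\<close> is the parameter of the formal group. Both coordinates
  really vanish at the origin, so the value at \<open>Infty\<close> fits the formulas.\<close>

fun zc :: "rat point \<Rightarrow> rat" where "zc Infty = 0" | "zc (Aff x y) = x / y"
fun wc :: "rat point \<Rightarrow> rat" where "wc Infty = 0" | "wc (Aff x y) = 1 / y"

lemma zc_neg: "zc (ell_neg P) = - zc P"
  by (cases P) auto

lemma wc_neg: "wc (ell_neg P) = - wc P"
  by (cases P) auto

lemma zw_curve:
  assumes "P \<in> ell_curve"
  shows "wc P = zc P ^ 3 + zc P * wc P ^ 2 - wc P ^ 3"
proof (cases P)
  case (Aff x y)
  then have c: "y ^ 2 = x ^ 3 + x - 1" using assms by (simp add: ell_curve_Aff)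
  have "y \<noteq> 0" using no_two_torsion[OF c] .
  then have "(x / y) ^ 3 + x / y * (1 / y) ^ 2 - (1 / y) ^ 3 = (x ^ 3 + x - 1) / y ^ 3"
    by (simp add: power_divide add_divide_distrib diff_divide_distrib power2_eq_square power3_eq_cube)
  also have "\<dots> = 1 / y" using \<open>y \<noteq> 0\<close> unfolding c[symmetric] by (simp add: power2_eq_square power3_eq_cube)
  finally show ?thesis by (simp add: Aff)
qed simp

text \<open>In the coordinates \<open>z = x / y\<close>, \<open>w = 1 / y\<close> the line through \<open>P\<close> and \<open>Q\<close> is \<open>w = la z + nu\<close>. The slope
  is written without the difference quotient, so that the formula covers tangents and shows that
  the correction to \<open>z1 + z2\<close> is of fifth order.\<close>

lemma zw_add:
  assumes P: "P \<in> ell_curve" and Q: "Q \<in> ell_curve" and fin: "P \<noteq> Infty" "Q \<noteq> Infty" "ell_add P Q \<noteq> Infty"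
  defines "z1 \<equiv> zc P" and "z2 \<equiv> zc Q" and "w1 \<equiv> wc P" and "w2 \<equiv> wc Q"
  defines "V \<equiv> z1 ^ 2 + z1 * z2 + z2 ^ 2 + w2 ^ 2" and "U \<equiv> 1 - z1 * (w1 + w2) + w1 ^ 2 + w1 * w2 + w2 ^ 2"
  defines "la \<equiv> V / U" defines "nu \<equiv> w1 - la * z1"
  assumes U: "U \<noteq> 0"
  shows "zc (ell_add P Q) = z1 + z2 + (2 * la * nu - 3 * la ^ 2 * nu) / (1 + la ^ 2 - la ^ 3)"
    "wc (ell_add P Q) = la * zc (ell_add P Q) - nu"
proof -
  obtain x1 y1 x2 y2 where PQ: "P = Aff x1 y1" "Q = Aff x2 y2" using fin by (cases P; cases Q) auto
  have c1: "y1 ^ 2 = x1 ^ 3 + x1 - 1" and c2: "y2 ^ 2 = x2 ^ 3 + x2 - 1"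
    using P Q by (simp_all add: PQ ell_curve_Aff)
  have n: "\<not> (x1 = x2 \<and> y1 = - y2)" using fin(3) PQ by auto
  obtain l c x3 y3 where s: "ell_add P Q = Aff x3 y3" and ch: "chord l c x1 y1 x2 y2 x3 y3"
    and tg: "x1 = x2 \<longrightarrow> 2 * y1 * l = 3 * x1 ^ 2 + 1"
    using ell_add_chord[OF c1 c2 n] unfolding PQ by metis
  have c3: "y3 ^ 2 = x3 ^ 3 + x3 - 1" using chord_on_curve(3)[OF ch] .
  have y0: "y1 \<noteq> 0" "y2 \<noteq> 0" "y3 \<noteq> 0" using no_two_torsion c1 c2 c3 by blast+
  have y: "y1 = l * x1 + c" "y2 = l * x2 + c" "- y3 = l * x3 + c"
    and v: "x1 + x2 + x3 = l ^ 2" "x1 * x2 + x1 * x3 + x2 * x3 = 1 - 2 * l * c" "x1 * x2 * x3 = 1 + c ^ 2"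
    using ch by (simp_all add: chord_def)
  have z: "z1 = x1 * w1" "z2 = x2 * w2" "w1 * y1 = 1" "w2 * y2 = 1"
    using y0 by (simp_all add: z1_def z2_def w1_def w2_def PQ)
  have e1: "w1 = z1 ^ 3 + z1 * w1 ^ 2 - w1 ^ 3" "w2 = z2 ^ 3 + z2 * w2 ^ 2 - w2 ^ 3"
    using zw_curve[OF P] zw_curve[OF Q] by (simp_all add: z1_def z2_def w1_def w2_def)
  have line: "l * z1 + c * w1 = 1" "l * z2 + c * w2 = 1"
    using z(3,4) unfolding y z(1,2) by (simp_all add: algebra_simps)
  have UV: "U * (w2 - w1) = V * (z2 - z1)" using e1 unfolding U_def V_def by algebra
  \<comment> \<open>The line y = l x + c reads l z + c w = 1 in these coordinates, so the claim is
    that V / U equals its slope -l / c. For distinct z it follows from the difference of the two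
    curve equations, otherwise from the tangent slope.\<close>
  have lUcV: "l * U + c * V = 0"
  proof (cases "z1 = z2")
    case False
    have "(z2 - z1) * (l * U + c * V) = 0" using UV line by algebra
    then show ?thesis using False by simp
  next
    case True
    then have "w1 = w2" using UV U by simp
    then have "y1 = y2" using z(3,4) by (metis mult_cancel_left mult_zero_left zero_neq_one)
    moreover have "x1 = x2" using z True \<open>w1 = w2\<close> by (metis mult_cancel_right mult_zero_left zero_neq_one)
    ultimately have t: "2 * y1 * l = 3 * x1 ^ 2 + 1" using tg by simp
    have lw: "2 * l * w1 = 3 * z1 ^ 2 + w1 ^ 2"
    proof -
      have "2 * l * w1 = (2 * y1 * l) * w1 ^ 2" using z(3) by algebra
      then show ?thesis unfolding t z(1) by algebra
    qed
    have "U = 1 - 2 * z1 * w1 + 3 * w1 ^ 2" "V = 3 * z1 ^ 2 + w1 ^ 2"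
      unfolding U_def V_def True[symmetric] \<open>w1 = w2\<close>[symmetric] by algebra+
    moreover have "w1 \<noteq> 0" using z(3) by auto
    moreover have "w1 * (l * (1 - 2 * z1 * w1 + 3 * w1 ^ 2) + c * (3 * z1 ^ 2 + w1 ^ 2)) = 0"
      using lw line(1) e1(1) by algebra
    ultimately show ?thesis by simp
  qed
  have c0: "c \<noteq> 0"
  proof
    assume "c = 0"
    then have "l = 0" using lUcV U by simp
    then show False using line \<open>c = 0\<close> by simp
  qed
  have la: "la = - l / c"
  proof -
    have "V * c = - l * U" using lUcV by algebra
    then show ?thesis using U c0 by (simp add: la_def field_simps)
  qed
  have nu: "nu = 1 / c"
  proof -
    have "nu * c = 1" unfolding nu_def la using line(1) c0 by (simp add: field_simps)
    then show ?thesis using c0 by (simp add: field_simps)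
  qed
  have D: "c ^ 3 * (1 + la ^ 2 - la ^ 3) = - (y1 * y2 * y3)"
  proof -
    have "c ^ 3 * (1 + la ^ 2 - la ^ 3) = c ^ 3 + l ^ 2 * c + l ^ 3"
      unfolding la using c0 by (simp add: field_simps power2_eq_square power3_eq_cube)
    also have "\<dots> = (l * x1 + c) * (l * x2 + c) * (l * x3 + c)"
      using v by algebra
    finally show ?thesis unfolding y(1,2) y(3)[symmetric] by simp
  qed
  have D0: "1 + la ^ 2 - la ^ 3 \<noteq> 0" using D y0 by auto
  have N: "c ^ 3 * (2 * la * nu - 3 * la ^ 2 * nu) = - (2 * l * c + 3 * l ^ 2)"
    unfolding la nu using c0 by (simp add: field_simps power2_eq_square power3_eq_cube)
  have "x1 * (l * x2 + c) * (l * x3 + c) + x2 * (l * x1 + c) * (l * x3 + c) + x3 * (l * x1 + c) * (l * x2 + c) = 2 * l * c + 3 * l ^ 2"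
    using v by algebra
  then have S: "x1 * y2 * (- y3) + x2 * y1 * (- y3) + x3 * y1 * y2 = 2 * l * c + 3 * l ^ 2"
    unfolding y by simp
  have "(x3 / y3 - z1 - z2) * (1 + la ^ 2 - la ^ 3) = 2 * la * nu - 3 * la ^ 2 * nu"
  proof -
    have "c ^ 3 * ((x3 / y3 - z1 - z2) * (1 + la ^ 2 - la ^ 3)) = (x3 / y3 - x1 / y1 - x2 / y2) * (- (y1 * y2 * y3))"
      unfolding D[symmetric] by (simp add: z1_def z2_def PQ)
    also have "\<dots> = - (x1 * y2 * (- y3) + x2 * y1 * (- y3) + x3 * y1 * y2)"
      using y0 by (simp add: field_simps)
    also have "\<dots> = c ^ 3 * (2 * la * nu - 3 * la ^ 2 * nu)" unfolding S N ..
    finally show ?thesis using c0 by simp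
  qed
  then have "x3 / y3 - z1 - z2 = (2 * la * nu - 3 * la ^ 2 * nu) / (1 + la ^ 2 - la ^ 3)"
    using D0 by (simp add: eq_divide_eq)
  then show "zc (ell_add P Q) = z1 + z2 + (2 * la * nu - 3 * la ^ 2 * nu) / (1 + la ^ 2 - la ^ 3)"
    unfolding s zc.simps by linarith
  have "l * x3 / y3 + c / y3 = (- y3) / y3" unfolding y(3) by (simp add: add_divide_distrib)
  then have "l * x3 / y3 + c / y3 = - 1" using y0(3) by simp
  then have "c * (1 / y3 - (la * (x3 / y3) - nu)) = 0"
    unfolding la nu using c0 by (simp add: field_simps)
  then show "wc (ell_add P Q) = la * zc (ell_add P Q) - nu" unfolding s using c0 by simp
qed

subsection \<open>The l-adic filtration\<close>

text \<open>The l-adic valuation of r is at least k, phrased so that r = 0 has every level.\<close>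

definition adic :: "int \<Rightarrow> nat \<Rightarrow> rat \<Rightarrow> bool"
  where "adic l k r \<longleftrightarrow> (\<exists>a b. \<not> l dvd b \<and> r * of_int b = of_int (l ^ k * a))"

context
  fixes l :: int
  assumes l: "prime l"
begin

lemma adic_0: "adic l k 0"
  unfolding adic_def using l by (intro exI[of _ 0] exI[of _ 1]) (auto simp: not_prime_unit)

lemma adic_int: "adic l 0 (of_int m)"
  unfolding adic_def using l by (intro exI[of _ m] exI[of _ 1]) (auto simp: not_prime_unit)

lemma adic_add:
  assumes "adic l k r" "adic l k s"
  shows "adic l k (r + s)"
proof -
  obtain a b a' b' where *: "\<not> l dvd b" "r * of_int b = of_int (l ^ k * a)" "\<not> l dvd b'" "s * of_int b' = of_int (l ^ k * a')"
    using assms unfolding adic_def by blast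
  have "(r + s) * of_int (b * b') = (r * of_int b) * of_int b' + (s * of_int b') * of_int b" by (simp add: algebra_simps)
  also have "\<dots> = of_int (l ^ k * (a * b' + a' * b))" unfolding *(2,4) by (simp add: algebra_simps)
  finally show ?thesis unfolding adic_def using *(1,3) l by (metis prime_dvd_mult_iff)
qed

lemma adic_mult:
  assumes "adic l k r" "adic l k' s"
  shows "adic l (k + k') (r * s)"
proof -
  obtain a b a' b' where *: "\<not> l dvd b" "r * of_int b = of_int (l ^ k * a)" "\<not> l dvd b'" "s * of_int b' = of_int (l ^ k' * a')"
    using assms unfolding adic_def by blast
  have "(r * s) * of_int (b * b') = (r * of_int b) * (s * of_int b')" by (simp add: algebra_simps)
  also have "\<dots> = of_int (l ^ (k + k') * (a * a'))" unfolding *(2,4) by (simp add: algebra_simps power_add)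
  finally show ?thesis unfolding adic_def using *(1,3) l by (metis prime_dvd_mult_iff)
qed

lemma adic_mono:
  assumes "adic l k r" "k' \<le> k"
  shows "adic l k' r"
proof -
  obtain a b where *: "\<not> l dvd b" "r * of_int b = of_int (l ^ k * a)" using assms unfolding adic_def by blast
  have "l ^ k * a = l ^ k' * (l ^ (k - k') * a)" using assms(2) by (simp flip: power_add mult.assoc)
  then show ?thesis unfolding adic_def using * by metis
qed

lemma adic_mult_int: "adic l k r \<Longrightarrow> adic l k (of_int m * r)"
  using adic_mult[OF adic_int] by simp

lemma adic_uminus: "adic l k r \<Longrightarrow> adic l k (- r)"
  using adic_mult_int[of k r "- 1"] by simp

lemma adic_diff: "adic l k r \<Longrightarrow> adic l k s \<Longrightarrow> adic l k (r - s)"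
  using adic_add[of k r "- s"] adic_uminus by simp

lemma adic_power: "adic l k r \<Longrightarrow> adic l (j * k) (r ^ j)"
  by (induction j) (use adic_int[of 1] in \<open>auto intro: adic_mult\<close>)

lemma adic_unit:
  assumes "adic l 1 r"
  shows "1 + r \<noteq> 0" "adic l k s \<Longrightarrow> adic l k (s / (1 + r))"
proof -
  obtain a b where *: "\<not> l dvd b" "r * of_int b = of_int (l ^ 1 * a)" using assms unfolding adic_def by blast
  have e: "(1 + r) * of_int b = of_int (b + l * a)" using *(2) by (simp add: algebra_simps)
  have n: "\<not> l dvd b + l * a" using *(1) by (simp add: dvd_add_left_iff)
  show nz: "1 + r \<noteq> 0"
  proof
    assume "1 + r = 0"
    then have "b + l * a = 0" using e by (metis mult_zero_left of_int_eq_0_iff)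
    then show False using n by simp
  qed
  have "(1 / (1 + r)) * of_int (b + l * a) = of_int (l ^ 0 * b)"
    unfolding e[symmetric] using nz by simp
  then have "adic l 0 (1 / (1 + r))" unfolding adic_def using n by blast
  then show "adic l k s \<Longrightarrow> adic l k (s / (1 + r))" using adic_mult[of k s 0 "1 / (1 + r)"] by simp
qed

lemma adic_cancel_coprime:
  assumes "adic l k (of_int m * r)" "\<not> l dvd m"
  shows "adic l k r"
proof -
  obtain a b where *: "\<not> l dvd b" "of_int m * r * of_int b = of_int (l ^ k * a)" using assms(1) unfolding adic_def by blast
  have "r * of_int (m * b) = of_int (l ^ k * a)" using *(2) by (simp add: algebra_simps)
  then show ?thesis unfolding adic_def using *(1) assms(2) l by (metis prime_dvd_mult_iff)
qed

lemma adic_cancel_l: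
  assumes "adic l (Suc k) (of_int l * r)"
  shows "adic l k r"
proof -
  obtain a b where *: "\<not> l dvd b" "of_int l * r * of_int b = of_int (l ^ Suc k * a)" using assms(1) unfolding adic_def by blast
  have "of_int l * (r * of_int b) = (of_int l :: rat) * of_int (l ^ k * a)" using *(2) by (simp add: algebra_simps)
  moreover have "(of_int l :: rat) \<noteq> 0" using l by auto
  ultimately have "r * of_int b = of_int (l ^ k * a)" by (metis mult_left_cancel)
  then show ?thesis unfolding adic_def using *(1) by blast
qed

text \<open>The k-th step of the filtration on the points reducing to the origin; on the curve w
  behaves like z^3.\<close>

definition near :: "nat \<Rightarrow> rat point \<Rightarrow> bool"
  where "near k P \<longleftrightarrow> adic l k (zc P) \<and> adic l (3 * k) (wc P)"

text \<open>The slope \<open>la\<close> has valuation at least 2k and the intercept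
  \<open>nu\<close> at least 3k, while the denominators are units. Every term of the correction
  contains \<open>la * nu\<close>.\<close>

lemma near_add:
  assumes P: "P \<in> ell_curve" and Q: "Q \<in> ell_curve" and nP: "near k P" and nQ: "near k Q" and k: "k \<ge> 1"
  shows "near k (ell_add P Q) \<and> adic l (5 * k) (zc (ell_add P Q) - (zc P + zc Q))"
proof -
  consider "P = Infty" | "Q = Infty" | "ell_add P Q = Infty" | "P \<noteq> Infty" "Q \<noteq> Infty" "ell_add P Q \<noteq> Infty" by blast
  then show ?thesis
  proof cases
    case 1 then show ?thesis using nQ by (simp add: adic_0)
  next
    case 2 then show ?thesis using nP by (simp add: ell_add_Infty_right adic_0)
  next
    case 3
    then have "Q = ell_neg P"
      by (cases P; cases Q) (auto simp: Let_def split: if_splits)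
    then show ?thesis using 3 by (simp add: near_def adic_0 zc_neg)
  next
    case 4
    define z1 z2 w1 w2 where "z1 = zc P" "z2 = zc Q" "w1 = wc P" "w2 = wc Q"
    define V where "V = z1 ^ 2 + z1 * z2 + z2 ^ 2 + w2 ^ 2"
    define U where "U = 1 - z1 * (w1 + w2) + w1 ^ 2 + w1 * w2 + w2 ^ 2"
    define la where "la = V / U"
    define nu where "nu = w1 - la * z1"
    note defs = z1_z2_w1_w2_def
    have z: "adic l k z1" "adic l k z2" and w: "adic l (3 * k) w1" "adic l (3 * k) w2"
      using nP nQ by (simp_all add: near_def defs)
    have pw: "adic l j (a * b)" if "adic l i a" "adic l i' b" "j \<le> i + i'" for i i' j a b
      using adic_mono[OF adic_mult] that by blast
    have V: "adic l (2 * k) V"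
      unfolding V_def power2_eq_square using k
      by (intro adic_add pw[OF z(1) z(1)] pw[OF z(1) z(2)] pw[OF z(2) z(2)] pw[OF w(2) w(2)]) auto
    have u: "adic l 1 (- z1 * (w1 + w2) + w1 ^ 2 + w1 * w2 + w2 ^ 2)"
      unfolding power2_eq_square using k
      by (intro adic_add pw[OF adic_uminus[OF z(1)] adic_add[OF w]] pw[OF w(1) w(1)] pw[OF w(1) w(2)] pw[OF w(2) w(2)]) auto
    have U: "U = 1 + (- z1 * (w1 + w2) + w1 ^ 2 + w1 * w2 + w2 ^ 2)" by (simp add: U_def)
    have U0: "U \<noteq> 0" unfolding U by (rule adic_unit(1)[OF u])
    have la: "adic l (2 * k) la" unfolding la_def U by (rule adic_unit(2)[OF u V])
    have nu: "adic l (3 * k) nu" unfolding nu_def by (intro adic_diff w pw[OF la z(1)]) simp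
    have d: "adic l 1 (la ^ 2 - la ^ 3)"
      unfolding power2_eq_square power3_eq_cube using k
      by (intro adic_diff pw[OF la la] pw[OF pw[OF la la order_refl] la]) auto
    have "adic l (5 * k) (2 * la * nu - 3 * la ^ 2 * nu)"
    proof -
      have "2 * la * nu - 3 * la ^ 2 * nu = of_int 2 * (la * nu) - of_int 3 * (la * la * nu)"
        by (simp add: power2_eq_square)
      also have "adic l (5 * k) \<dots>"
        by (intro adic_diff adic_mult_int pw[OF la nu] pw[OF pw[OF la la order_refl] nu]) auto
      finally show ?thesis .
    qed
    then have corr: "adic l (5 * k) ((2 * la * nu - 3 * la ^ 2 * nu) / (1 + (la ^ 2 - la ^ 3)))"
      by (rule adic_unit(2)[OF d])
    have eq: "zc (ell_add P Q) = z1 + z2 + (2 * la * nu - 3 * la ^ 2 * nu) / (1 + (la ^ 2 - la ^ 3))"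
      "wc (ell_add P Q) = la * zc (ell_add P Q) - nu"
      using zw_add[OF P Q 4] U0 unfolding la_def nu_def V_def U_def defs by (simp_all add: add_diff_eq)
    have 5: "adic l (5 * k) (zc (ell_add P Q) - (zc P + zc Q))"
      using corr unfolding eq(1) by (simp add: defs)
    have "adic l k (zc (ell_add P Q))"
      unfolding eq(1) by (intro adic_add z adic_mono[OF corr]) simp
    moreover from this have "adic l (3 * k) (wc (ell_add P Q))"
      unfolding eq(2) by (intro adic_diff nu pw[OF la]) auto
    ultimately show ?thesis using 5 by (simp add: near_def)
  qed
qed

lemma near_mult:
  assumes P: "P \<in> ell_curve" and nP: "near k P" and k: "k \<ge> 1"
  shows "near k (ell_mult (int m) P) \<and> adic l (5 * k) (zc (ell_mult (int m) P) - of_nat m * zc P)"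
proof (induction m)
  case 0
  then show ?case by (simp add: ell_mult_0 near_def adic_0)
next
  case (Suc m)
  have e: "ell_mult (int (Suc m)) P = ell_add P (ell_mult (int m) P)"
    using ell_mult_Suc[OF P, of "int m"] by (simp add: add.commute)
  have a: "near k (ell_add P (ell_mult (int m) P)) \<and>
      adic l (5 * k) (zc (ell_add P (ell_mult (int m) P)) - (zc P + zc (ell_mult (int m) P)))"
    using near_add[OF P ell_mult_in[OF P] nP _ k] Suc by blast
  have "zc (ell_mult (int (Suc m)) P) - of_nat (Suc m) * zc P =
      (zc (ell_add P (ell_mult (int m) P)) - (zc P + zc (ell_mult (int m) P))) + (zc (ell_mult (int m) P) - of_nat m * zc P)"
    unfolding e by (simp add: algebra_simps)
  then show ?case using a Suc adic_add unfolding e by metis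
qed

definition zval :: "nat \<Rightarrow> rat point \<Rightarrow> bool"
  where "zval k P \<longleftrightarrow> near k P \<and> \<not> adic l (Suc k) (zc P)"

lemma zval_unique:
  assumes "zval k P" "zval k' P" shows "k = k'"
proof (rule ccontr)
  assume "k \<noteq> k'"
  then have "Suc k \<le> k' \<or> Suc k' \<le> k" by linarith
  then show False using assms adic_mono unfolding zval_def near_def by blast
qed

text \<open>The curve equation is w (1 + w^2 - z w) = z^3. Once P is near the origin the bracket is
  a unit, so the level of w is dictated by that of z.\<close>

lemma near_improve:
  assumes P: "P \<in> ell_curve" and nP: "near k P" and k: "k \<ge> 1" and z: "adic l k' (zc P)"
  shows "near k' P"
proof -
  have pw: "adic l j (a * b)" if "adic l i a" "adic l i' b" "j \<le> i + i'" for i i' j a b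
    using adic_mono[OF adic_mult] that by blast
  have zw: "adic l k (zc P)" "adic l (3 * k) (wc P)" using nP by (simp_all add: near_def)
  have u: "adic l 1 (wc P * wc P - zc P * wc P)"
    using k by (intro adic_diff pw[OF zw] pw[OF zw(2) zw(2)]) auto
  have "wc P * (1 + (wc P * wc P - zc P * wc P)) = zc P ^ 3" using zw_curve[OF P] by algebra
  then have "wc P = zc P ^ 3 / (1 + (wc P * wc P - zc P * wc P))"
    using adic_unit(1)[OF u] by (simp add: eq_divide_eq)
  then have "adic l (3 * k') (wc P)" using adic_unit(2)[OF u adic_power[OF z, of 3]] by simp
  then show ?thesis using z by (simp add: near_def)
qed

text \<open>Up to an error of valuation 5k, multiplication by m multiplies z by m. As 5k \<ge> k + 2
  for k \<ge> 1, neither a factor prime to l nor a single factor l can be disturbed by the error;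
  the factors l are split off one at a time.\<close>

lemma zval_mult:
  assumes "P \<in> ell_curve" "zval k P" "k \<ge> 1" "m > 0"
  shows "zval (k + multiplicity l (int m)) (ell_mult (int m) P)"
  using assms
proof (induction m arbitrary: P k rule: less_induct)
  case (less m)
  have nP: "near k P" and ex: "\<not> adic l (Suc k) (zc P)" using less.prems by (simp_all add: zval_def)
  have l2: "l \<ge> 2" using l by (simp add: prime_ge_2_int)
  show ?case
  proof (cases "l dvd int m")
    case False
    have nm: "near k (ell_mult (int m) P)" "adic l (5 * k) (zc (ell_mult (int m) P) - of_nat m * zc P)"
      using near_mult[OF less.prems(1) nP less.prems(3)] by simp_all
    have "\<not> adic l (Suc k) (zc (ell_mult (int m) P))"
    proof
      assume a: "adic l (Suc k) (zc (ell_mult (int m) P))"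
      have "adic l (Suc k) (zc (ell_mult (int m) P) - (zc (ell_mult (int m) P) - of_nat m * zc P))"
        using less.prems(3) by (intro adic_diff a adic_mono[OF nm(2)]) simp
      then have "adic l (Suc k) (of_int (int m) * zc P)" by simp
      then show False using adic_cancel_coprime False ex by blast
    qed
    then show ?thesis using nm(1) False by (simp add: zval_def not_dvd_imp_multiplicity_0)
  next
    case True
    then obtain m'' where m'': "int m = l * m''" by (auto simp: dvd_def)
    have "0 < l * m''" "0 < l" using less.prems(4) l2 unfolding m''[symmetric] by auto
    then have "m'' > 0" by (rule zero_less_mult_pos)
    define m' where "m' = nat m''"
    have m': "int m = l * int m'" "m' > 0" using m'' \<open>m'' > 0\<close> by (simp_all add: m'_def)
    have "int m' < int m" unfolding m'(1) using m'(2) l2 by simp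
    then have lt: "m' < m" by simp
    define R where "R = ell_mult l P"
    have R: "R \<in> ell_curve" using ell_mult_in[OF less.prems(1)] by (simp add: R_def)
    have nR: "near k R" "adic l (5 * k) (zc R - of_int l * zc P)"
      using near_mult[OF less.prems(1) nP less.prems(3), of "nat l"] l2 by (simp_all add: R_def)
    have lz: "adic l (Suc k) (of_int l * zc P)"
    proof -
      have "adic l 1 (of_int l)" unfolding adic_def using l by (intro exI[of _ 1]) (auto simp: not_prime_unit)
      then show ?thesis using adic_mult[of 1 "of_int l" k "zc P"] nP by (simp add: near_def)
    qed
    have "adic l (Suc k) (of_int l * zc P + (zc R - of_int l * zc P))"
      using less.prems(3) by (intro adic_add lz adic_mono[OF nR(2)]) simp
    then have "near (Suc k) R" using near_improve[OF R nR(1) less.prems(3)] by simp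
    moreover have "\<not> adic l (Suc (Suc k)) (zc R)"
    proof
      assume a: "adic l (Suc (Suc k)) (zc R)"
      have "adic l (Suc (Suc k)) (zc R - (zc R - of_int l * zc P))"
        using less.prems(3) by (intro adic_diff a adic_mono[OF nR(2)]) simp
      then show False using adic_cancel_l ex by simp
    qed
    ultimately have "zval (Suc k) R" by (simp add: zval_def)
    from less.IH[OF lt R this] have "zval (Suc k + multiplicity l (int m')) (ell_mult (int m') R)"
      using m'(2) by simp
    moreover have "ell_mult (int m') R = ell_mult (int m) P"
      unfolding R_def ell_mult_mult[OF less.prems(1)] m'(1) by (simp add: mult.commute)
    moreover have "multiplicity l (int m) = Suc (multiplicity l (int m'))"
      unfolding m'(1) using m'(2) l by (intro multiplicity_times_same) auto
    ultimately show ?thesis by simp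
  qed
qed

lemma zval_neg: "zval k (ell_neg P) \<longleftrightarrow> zval k P"
  using adic_uminus[of _ "zc P"] adic_uminus[of _ "- zc P"] adic_uminus[of _ "wc P"] adic_uminus[of _ "- wc P"]
  by (auto simp: zval_def near_def zc_neg wc_neg)

lemma zval_mult_int:
  assumes "P \<in> ell_curve" "zval k P" "k \<ge> 1" "m \<noteq> 0"
  shows "zval (k + multiplicity l m) (ell_mult m P)"
proof (cases "m > 0")
  case True
  then show ?thesis using zval_mult[OF assms(1-3), of "nat m"] by simp
next
  case False
  then have "zval (k + multiplicity l (- m)) (ell_mult (- m) P)"
    using zval_mult[OF assms(1-3), of "nat (- m)"] assms(4) by simp
  moreover have "multiplicity l (- m) = multiplicity l m"
    by (metis abs_minus_cancel multiplicity_normalize_right normalize_int_def)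
  ultimately show ?thesis by (simp add: ell_mult_neg zval_neg)
qed

lemma zval_fraction:
  fixes p q r :: int
  assumes "coprime p q" "coprime r q" "q > 0" "r \<noteq> 0" "multiplicity l q = k" "k \<ge> 1"
  shows "zval k (Aff (of_int p / of_int q ^ 2) (of_int r / of_int q ^ 3))"
proof -
  let ?P = "Aff (of_int p / of_int q ^ 2) (of_int r / of_int q ^ 3) :: rat point"
  have z: "zc ?P * of_int r = of_int (q * p)" and w: "wc ?P * of_int r = of_int (q ^ 3)"
    using assms(3,4) by (simp_all add: field_simps power2_eq_square power3_eq_cube)
  have "l ^ k dvd q" using assms(5) multiplicity_dvd by blast
  then obtain s where s: "q = l ^ k * s" by (auto simp: dvd_def)
  have "l dvd q" using s assms(6) by (metis dvd_mult2 dvd_power not_one_le_zero le_eq_less_or_eq not_gr_zero)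
  then have lp: "\<not> l dvd p" and lr: "\<not> l dvd r"
    using assms(1,2) l by (meson coprime_common_divisor not_prime_unit)+
  have "adic l k (zc ?P)" unfolding adic_def using z lr s by (intro exI[of _ "s * p"] exI[of _ r]) (simp add: mult.assoc)
  moreover have "adic l (3 * k) (wc ?P)" unfolding adic_def using w lr
    by (intro exI[of _ "s ^ 3"] exI[of _ r]) (simp add: s power_mult_distrib power_mult[symmetric] mult.commute)
  moreover have "\<not> adic l (Suc k) (zc ?P)"
  proof
    assume "adic l (Suc k) (zc ?P)"
    then obtain a b where ab: "\<not> l dvd b" "zc ?P * of_int b = of_int (l ^ Suc k * a)" unfolding adic_def by blast
    have "(of_int (q * (p * b)) :: rat) = of_int (l ^ Suc k * (a * r))"
    proof -
      have "of_int (q * (p * b)) = (zc ?P * of_int r) * of_int b" unfolding z by simp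
      also have "\<dots> = (zc ?P * of_int b) * of_int r" by (simp add: mult_ac del: zc.simps)
      also have "\<dots> = of_int (l ^ Suc k * (a * r))" unfolding ab(2) by simp
      finally show ?thesis .
    qed
    then have "q * (p * b) = l ^ Suc k * (a * r)" by (simp only: of_int_eq_iff)
    then have "l ^ Suc k dvd q * (p * b)" by simp
    moreover have "coprime (l ^ Suc k) (p * b)"
    proof -
      have "\<not> l dvd p * b" using lp ab(1) l by (simp add: prime_dvd_mult_iff)
      then have "coprime l (p * b)" by (rule prime_imp_coprime[OF l])
      then show ?thesis by simp
    qed
    ultimately have "l ^ Suc k dvd q" by (simp add: coprime_dvd_mult_left_iff)
    then have "Suc k \<le> multiplicity l q" using l assms(3) by (intro multiplicity_geI) auto
    then show False using assms(5) by simp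
  qed
  ultimately show ?thesis by (simp add: zval_def near_def)
qed

end


subsection \<open>The archimedean place\<close>

text \<open>A small z forces x \<ge> 1, hence y^2 \<le> 2 x^3, and in absolute values w = z^3 (y^2 /
  x^3).\<close>

lemma wc_bound:
  assumes P: "P \<in> ell_curve" and z: "\<bar>zc P\<bar> \<le> \<delta>" "\<delta> \<le> 1 / 10"
  shows "\<bar>wc P\<bar> \<le> 2 * \<delta> ^ 3"
proof (cases P)
  case Infty
  then show ?thesis using z by simp
next
  case (Aff x y)
  then have c: "y ^ 2 = x ^ 3 + x - 1" using P by (simp add: ell_curve_Aff)
  have y0: "y \<noteq> 0" and x0: "x > 0" using no_two_torsion[OF c] curve_pos[OF c] .
  have zy: "zc P * y = x" using y0 by (simp add: Aff)
  \<comment> \<open>For x < 1 the equation gives y^2 = x^3 + x - 1 < x^2, against z being smaller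
    than 1.\<close>
  have x1: "x \<ge> 1"
  proof (rule ccontr)
    assume "\<not> x \<ge> 1"
    then have "x * x ^ 2 \<le> 1 * x ^ 2" by (intro mult_right_mono) auto
    then have "y ^ 2 < x ^ 2" using \<open>\<not> x \<ge> 1\<close> unfolding c by (simp add: power2_eq_square power3_eq_cube)
    also have "\<dots> = zc P ^ 2 * y ^ 2" by (simp only: power_mult_distrib[symmetric] zy)
    also have "zc P ^ 2 * y ^ 2 \<le> 1 ^ 2 * y ^ 2"
      using z by (intro mult_right_mono abs_le_square_iff[THEN iffD1]) auto
    finally show False by simp
  qed
  have "x ^ 1 \<le> x ^ 3" using x1 by (intro power_increasing) auto
  then have y2: "y ^ 2 \<le> 2 * x ^ 3" unfolding c by simp
  have wy: "\<bar>wc P\<bar> * \<bar>y\<bar> = 1" using y0 by (simp add: Aff flip: abs_mult)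
  have xz: "x = \<bar>zc P\<bar> * \<bar>y\<bar>" using x0 zy by (simp flip: abs_mult)
  have "w * (z * v) ^ 3 = z ^ 3 * v ^ 2 * (w * v)" for w z v :: rat by algebra
  from this[of "\<bar>wc P\<bar>" "\<bar>zc P\<bar>" "\<bar>y\<bar>"]
  have "\<bar>wc P\<bar> * x ^ 3 = \<bar>zc P\<bar> ^ 3 * y ^ 2" unfolding wy xz[symmetric] by simp
  also have "\<dots> \<le> \<bar>zc P\<bar> ^ 3 * (2 * x ^ 3)" using y2 by (intro mult_left_mono) auto
  also have "\<dots> \<le> \<delta> ^ 3 * (2 * x ^ 3)" using z x0 by (intro mult_right_mono power_mono) auto
  finally have "\<bar>wc P\<bar> * x ^ 3 \<le> (2 * \<delta> ^ 3) * x ^ 3" by simp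
  then show ?thesis using x0 by simp
qed

text \<open>The archimedean counterpart of \<open>near_add\<close>: \<open>la\<close> is at most 5
  \<delta>^2 and \<open>nu\<close> at most 7 \<delta>^3 in absolute value, and the remaining factor
  2 - 3 la at most 43/20, so the correction stays below 80 \<delta>^5.\<close>

lemma arch_add:
  assumes P: "P \<in> ell_curve" and Q: "Q \<in> ell_curve"
    and z: "\<bar>zc P\<bar> \<le> \<delta>" "\<bar>zc Q\<bar> \<le> \<delta>" and \<delta>: "\<delta> \<le> 1 / 10"
  shows "\<bar>zc (ell_add P Q) - (zc P + zc Q)\<bar> \<le> 80 * \<delta> ^ 5"
proof -
  have \<delta>0: "0 \<le> \<delta>" using z(1) abs_ge_zero order_trans by blast
  consider "P = Infty" | "Q = Infty" | "ell_add P Q = Infty" | "P \<noteq> Infty" "Q \<noteq> Infty" "ell_add P Q \<noteq> Infty" by blast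
  then show ?thesis
  proof cases
    case 1 then show ?thesis using \<delta>0 by simp
  next
    case 2 then show ?thesis using \<delta>0 by (simp add: ell_add_Infty_right)
  next
    case 3
    then have "Q = ell_neg P"
      by (cases P; cases Q) (auto simp: Let_def split: if_splits)
    then show ?thesis using 3 \<delta>0 by (simp add: zc_neg)
  next
    case 4
    define z1 z2 w1 w2 where "z1 = zc P" "z2 = zc Q" "w1 = wc P" "w2 = wc Q"
    define V where "V = z1 ^ 2 + z1 * z2 + z2 ^ 2 + w2 ^ 2"
    define U where "U = 1 - z1 * (w1 + w2) + w1 ^ 2 + w1 * w2 + w2 ^ 2"
    define la where "la = V / U"
    define nu where "nu = w1 - la * z1"
    note defs = z1_z2_w1_w2_def
    have zb: "\<bar>z1\<bar> \<le> \<delta>" "\<bar>z2\<bar> \<le> \<delta>" and wb: "\<bar>w1\<bar> \<le> 2 * \<delta> ^ 3" "\<bar>w2\<bar> \<le> 2 * \<delta> ^ 3"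
      using z wc_bound[OF P z(1) \<delta>] wc_bound[OF Q z(2) \<delta>] by (simp_all add: defs)
    have mb: "\<bar>a * b\<bar> \<le> A * B" if "\<bar>a\<bar> \<le> A" "\<bar>b\<bar> \<le> B" for a b A B :: rat
      unfolding abs_mult using that by (intro mult_mono) auto
    have d2: "\<delta> ^ 2 \<le> 1 / 100"
      using power_mono[OF \<delta> \<delta>0, of 2] by (simp add: power_divide)
    have d4: "\<delta> ^ 4 \<le> 1 / 10000"
      using power_mono[OF \<delta> \<delta>0, of 4] by (simp add: power_divide)
    have d6: "\<delta> ^ 6 \<le> 1 / 1000000"
      using power_mono[OF \<delta> \<delta>0, of 6] by (simp add: power_divide)
    have d62: "\<delta> ^ 6 \<le> 1 / 10000 * \<delta> ^ 2"
      using mult_right_mono[OF d4, of "\<delta> ^ 2"] by (simp flip: power_add)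
    have w22: "\<bar>w2 * w2\<bar> \<le> 4 * \<delta> ^ 6" using mb[OF wb(2) wb(2)] by (simp flip: power_add)
    have w12: "\<bar>w1 * w2\<bar> \<le> 4 * \<delta> ^ 6" using mb[OF wb(1) wb(2)] by (simp flip: power_add)
    have w11: "\<bar>w1 * w1\<bar> \<le> 4 * \<delta> ^ 6" using mb[OF wb(1) wb(1)] by (simp flip: power_add)
    have zz: "\<bar>z1 * z1\<bar> \<le> \<delta> ^ 2" "\<bar>z1 * z2\<bar> \<le> \<delta> ^ 2" "\<bar>z2 * z2\<bar> \<le> \<delta> ^ 2"
      using mb[OF zb(1) zb(1)] mb[OF zb] mb[OF zb(2) zb(2)] by (simp_all add: power2_eq_square)
    have zw: "\<bar>z1 * (w1 + w2)\<bar> \<le> 4 * \<delta> ^ 4"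
    proof -
      have "\<bar>w1 + w2\<bar> \<le> 4 * \<delta> ^ 3" using wb by linarith
      from mb[OF zb(1) this] show ?thesis by (simp add: power_numeral_reduce mult_ac)
    qed
    have V: "\<bar>V\<bar> \<le> 4 * \<delta> ^ 2"
      using zz w22 d62 unfolding V_def power2_eq_square[of z1] power2_eq_square[of z2] power2_eq_square[of w2] by linarith
    have U: "U \<ge> 9 / 10"
      using zw w11 w12 w22 d4 d6 unfolding U_def power2_eq_square by linarith
    then have U0: "U \<noteq> 0" by auto
    have la: "\<bar>la\<bar> \<le> 5 * \<delta> ^ 2"
    proof -
      have "\<bar>la\<bar> = \<bar>V\<bar> / U" using U by (simp add: la_def abs_divide)
      also have "\<dots> \<le> (4 * \<delta> ^ 2) / (9 / 10)" using U V by (intro frac_le) auto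
      also have "\<dots> \<le> 5 * \<delta> ^ 2" by simp
      finally show ?thesis .
    qed
    have la1: "\<bar>la\<bar> \<le> 1 / 20" using la d2 by linarith
    have nu: "\<bar>nu\<bar> \<le> 7 * \<delta> ^ 3"
    proof -
      have "\<bar>la * z1\<bar> \<le> 5 * \<delta> ^ 3" using mb[OF la zb(1)] by (simp add: power2_eq_square power3_eq_cube)
      then show ?thesis using wb(1) unfolding nu_def by linarith
    qed
    have "la ^ 2 - la ^ 3 = la ^ 2 * (1 - la)" by algebra
    moreover have "la ^ 2 * (1 - la) \<ge> 0" using la1 by (intro mult_nonneg_nonneg) auto
    ultimately have D: "1 + la ^ 2 - la ^ 3 \<ge> 1" by simp
    have N: "\<bar>2 * la * nu - 3 * la ^ 2 * nu\<bar> \<le> 80 * \<delta> ^ 5"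
    proof -
      have "2 * la * nu - 3 * la ^ 2 * nu = (la * nu) * (2 - 3 * la)" by algebra
      moreover have "\<bar>la * nu\<bar> \<le> 35 * \<delta> ^ 5" using mb[OF la nu] by (simp flip: power_add)
      moreover have "\<bar>2 - 3 * la\<bar> \<le> 43 / 20" using la1 by linarith
      ultimately have "\<bar>2 * la * nu - 3 * la ^ 2 * nu\<bar> \<le> (35 * \<delta> ^ 5) * (43 / 20)" using mb by metis
      moreover have "0 \<le> \<delta> ^ 5" using \<delta>0 by simp
      ultimately show ?thesis by linarith
    qed
    have "\<bar>(2 * la * nu - 3 * la ^ 2 * nu) / (1 + la ^ 2 - la ^ 3)\<bar> \<le> (80 * \<delta> ^ 5) / 1"
      unfolding abs_divide using N D \<delta>0 by (intro frac_le) auto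
    moreover have "zc (ell_add P Q) - (zc P + zc Q) = (2 * la * nu - 3 * la ^ 2 * nu) / (1 + la ^ 2 - la ^ 3)"
      using zw_add(1)[OF P Q 4] U0 unfolding la_def nu_def V_def U_def defs by simp
    ultimately show ?thesis by simp
  qed
qed

text \<open>The threshold keeps all intermediate multiples within \<delta> = 2 m |z| and makes each
  addition cost at most |z| / 2. A total relative error of one half is enough to compare two
  multiples up to a factor 3.\<close>

lemma arch_mult:
  assumes P: "P \<in> ell_curve" and m: "m > 0" and z: "\<bar>zc P\<bar> \<le> 1 / (20 * of_nat m ^ 2)"
  shows "\<bar>zc (ell_mult (int m) P) - of_nat m * zc P\<bar> \<le> of_nat m * \<bar>zc P\<bar> / 2"
proof -
  define t where "t = \<bar>zc P\<bar>"
  define M where "M = (of_nat m :: rat)"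
  have M: "M \<ge> 1" using m by (simp add: M_def)
  have t0: "t \<ge> 0" by (simp add: t_def)
  have tM: "20 * M ^ 2 * t \<le> 1" using z M by (simp add: t_def M_def[symmetric] field_simps)
  define \<delta> where "\<delta> = 2 * M * t"
  have "20 * M * t \<le> 20 * M ^ 2 * t"
    using M t0 by (intro mult_right_mono) (auto simp: power2_eq_square)
  then have \<delta>: "\<delta> \<le> 1 / 10" using tM by (simp add: \<delta>_def)
  have err: "80 * \<delta> ^ 5 \<le> t / 2"
  proof -
    have a: "(20 * M ^ 2 * t) ^ 3 \<le> 1 ^ 3" using tM t0 M by (intro power_mono) auto
    have b: "20 * t \<le> 1"
    proof -
      have "20 * 1 * t \<le> 20 * M ^ 2 * t" using M t0 by (intro mult_right_mono mult_left_mono) auto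
      then show ?thesis using tM by linarith
    qed
    have "M ^ 5 * t ^ 4 \<le> M ^ 6 * t ^ 4" using M t0 by (intro mult_right_mono power_increasing) auto
    also have "\<dots> = (M ^ 2 * t) ^ 3 * t" by (simp add: power_mult_distrib flip: power_mult) (simp add: power_numeral_reduce)
    also have "\<dots> \<le> (1 / 8000) * (1 / 20)"
    proof (intro mult_mono)
      have "8000 * (M ^ 2 * t) ^ 3 = (20 * M ^ 2 * t) ^ 3" by (simp add: power_mult_distrib)
      then show "(M ^ 2 * t) ^ 3 \<le> 1 / 8000" using a by simp
    qed (use b t0 M in auto)
    finally have "(2560 * M ^ 5 * t ^ 4) * t \<le> (1 / 2) * t" using t0 by (intro mult_right_mono) auto
    moreover have "80 * \<delta> ^ 5 = (2560 * M ^ 5 * t ^ 4) * t"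
      by (simp add: \<delta>_def power_mult_distrib) (simp add: power_numeral_reduce)
    ultimately show ?thesis by linarith
  qed
  have "j \<le> m \<Longrightarrow> \<bar>zc (ell_mult (int j) P) - of_nat j * zc P\<bar> \<le> of_nat j * (t / 2)" for j
  proof (induction j)
    case 0
    then show ?case by (simp add: ell_mult_0)
  next
    case (Suc j)
    then have IH: "\<bar>zc (ell_mult (int j) P) - of_nat j * zc P\<bar> \<le> of_nat j * (t / 2)" by simp
    have jM: "(of_nat j :: rat) \<le> M" using Suc.prems by (simp add: M_def)
    have e: "ell_mult (int (Suc j)) P = ell_add P (ell_mult (int j) P)"
      using ell_mult_Suc[OF P, of "int j"] by (simp add: add.commute)
    have jt: "of_nat j * t \<le> M * t" using jM t0 by (intro mult_right_mono) auto
    have "1 * t \<le> M * t" using M t0 by (intro mult_right_mono) auto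
    then have z1: "\<bar>zc P\<bar> \<le> \<delta>" using t0 by (simp add: \<delta>_def t_def)
    have "\<bar>of_nat j * zc P\<bar> = of_nat j * t" by (simp add: t_def abs_mult)
    moreover have "\<bar>zc (ell_mult (int j) P)\<bar> \<le> \<bar>zc (ell_mult (int j) P) - of_nat j * zc P\<bar> + \<bar>of_nat j * zc P\<bar>"
      by linarith
    moreover have "of_nat j * (t / 2) = of_nat j * t / 2" by simp
    moreover have "0 \<le> M * t" using M t0 by simp
    moreover have "\<delta> = 2 * (M * t)" by (simp add: \<delta>_def)
    ultimately have z2: "\<bar>zc (ell_mult (int j) P)\<bar> \<le> \<delta>" using IH jt by linarith
    have "\<bar>zc (ell_mult (int (Suc j)) P) - (zc P + zc (ell_mult (int j) P))\<bar> \<le> 80 * \<delta> ^ 5"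
      unfolding e by (rule arch_add[OF P ell_mult_in[OF P] z1 z2 \<delta>])
    then have "\<bar>(zc (ell_mult (int (Suc j)) P) - (zc P + zc (ell_mult (int j) P))) + (zc (ell_mult (int j) P) - of_nat j * zc P)\<bar> \<le> t / 2 + of_nat j * (t / 2)"
      using IH err by (intro order_trans[OF abs_triangle_ineq] add_mono) auto
    moreover have "(zc (ell_mult (int (Suc j)) P) - (zc P + zc (ell_mult (int j) P))) + (zc (ell_mult (int j) P) - of_nat j * zc P)
      = zc (ell_mult (int (Suc j)) P) - of_nat (Suc j) * zc P" by (simp add: algebra_simps)
    ultimately show ?case by (simp add: algebra_simps)
  qed
  from this[of m] show ?thesis by (simp add: t_def)
qed

section \<open>Numerical bounds\<close>

lemma gen_multiples:
  "ell_mult 3 gen = Aff 13 47" "ell_mult 4 gen = Aff (25 / 36) (37 / 216)" "ell_mult 5 gen = Aff (685 / 121) (- 18157 / 1331)"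
proof -
  show 3: "ell_mult 3 gen = Aff 13 47"
    using ell_mult_Suc[OF gen_in_ell_curve, of 2] unfolding ell_mult_2_gen by (simp add: gen_def)
  show 4: "ell_mult 4 gen = Aff (25 / 36) (37 / 216)"
    using ell_mult_Suc[OF gen_in_ell_curve, of 3] unfolding 3 by (simp add: gen_def Let_def power_divide)
  show "ell_mult 5 gen = Aff (685 / 121) (- 18157 / 1331)"
    using ell_mult_Suc[OF gen_in_ell_curve, of 4] unfolding 4 by (simp add: gen_def Let_def power_divide)
qed

text \<open>Working with 5g makes the naive height large compared with the error ln 265 / 3; the
  factor 50 is 2 * 5^2.\<close>

lemma neron_tate_gen_ge: "50 * neron_tate gen \<ge> ln 685 - ln 265 / 3"
proof -
  have "coprime (685 :: int) 121"
  proof -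
    have "gcd (685 :: int) 121 = 1" by (simp add: gcd_non_0_int)
    then show ?thesis by (simp add: coprime_iff_gcd_eq_1)
  qed
  then have "rat_height (685 / 121) = 685" using rat_height_quotient[of 685 121] by simp
  then have "neron_tate (ell_mult 5 gen) \<ge> (ln 685 - ln 265 / 3) / 2"
    using neron_tate_bounds(3)[OF ell_mult_in[OF gen_in_ell_curve], of 5] by (simp add: gen_multiples)
  then show ?thesis unfolding neron_tate_mult[OF gen_in_ell_curve] by simp
qed

lemma ln_less_ln_powers:
  assumes "(a::real) ^ i * b ^ j \<le> c ^ k" "a > 0" "b > 0" "c > 0"
  shows "real i * ln a + real j * ln b \<le> real k * ln c"
proof -
  have "ln (a ^ i * b ^ j) \<le> ln (c ^ k)" using assms by (subst ln_le_cancel_iff) auto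
  then show ?thesis using assms by (simp add: ln_mult ln_realpow)
qed

text \<open>The constants are dictated by later use: 45/2 = (9/2 - 2) * 3^2 and 18 = 9/2 * 2^2 serve
  \<open>ln_hgt_multiple_le\<close>, and 60 produces the summand 10 in the bound for b. The
  logarithms are compared through integer powers.\<close>

lemma neron_tate_gen_bounds:
  "ln 265 / 3 \<le> 45 / 2 * neron_tate gen" "ln 10 \<le> 60 * neron_tate gen" "ln 2 \<le> 18 * neron_tate gen"
  "1 / 100 \<le> neron_tate gen" "neron_tate gen < 1"
proof -
  have "29 * ln 265 \<le> 27 * ln (685::real)" using ln_less_ln_powers[of 265 29 1 0 685 27] by simp
  then show "ln 265 / 3 \<le> 45 / 2 * neron_tate gen" using neron_tate_gen_ge by simp
  have "2 * ln 265 + 5 * ln 10 \<le> 6 * ln (685::real)" using ln_less_ln_powers[of 265 2 10 5 685 6] by simp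
  then show "ln 10 \<le> 60 * neron_tate gen" using neron_tate_gen_ge by simp
  have "3 * ln 265 + 25 * ln 2 \<le> 9 * ln (685::real)" using ln_less_ln_powers[of 265 3 2 25 685 9] by simp
  then show "ln 2 \<le> 18 * neron_tate gen" using neron_tate_gen_ge by simp
  have "1 * ln 265 + 3 * ln 3 \<le> 3 * ln (685::real)" using ln_less_ln_powers[of 265 1 3 3 685 3] by simp
  moreover have "1 \<le> ln (3::real)" using exp_le by (subst ln_ge_iff) auto
  ultimately show "1 / 100 \<le> neron_tate gen" using neron_tate_gen_ge by simp
  have "ln (512 / 265 :: real) \<le> 512 / 265 - 1" by (rule ln_le_minus_one) simp
  then show "neron_tate gen < 1" using neron_tate_gen_less by simp
qed

lemma ell_mult_gen_eq_Infty: "ell_mult a gen = Infty \<Longrightarrow> a = 0"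
  using neron_tate_mult[OF gen_in_ell_curve, of a] neron_tate_gen_bounds(4) by (simp add: neron_tate_Infty)

lemma hgt_mult_neg: "hgt (ell_mult (- a) P) = hgt (ell_mult a P)"
  by (simp add: ell_mult_neg hgt_neg)

text \<open>A bound without additive constant. From |a| = 3 on, the excess of 9/2 over the true
  leading coefficient 2 absorbs the height error; smaller multiples are checked by hand.\<close>

lemma ln_hgt_multiple_le: "ln (hgt (ell_mult a gen)) \<le> 9 / 2 * neron_tate gen * real_of_int a ^ 2"
proof -
  have "ln (hgt (ell_mult a gen)) \<le> 9 / 2 * neron_tate gen * real_of_int a ^ 2" if a0: "a \<ge> 0" for a
  proof -
    consider "a = 0" | "a = 1" | "a = 2" | "a \<ge> 3" using a0 by linarith
    then show ?thesis
    proof cases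
      case 1 then show ?thesis by (simp add: ell_mult_0)
    next
      case 2
      have "rat_height 1 = 1" using rat_height_quotient[of 1 1] by simp
      then show ?thesis using 2 neron_tate_gen_bounds(4) by (simp add: ell_mult_1 gen_def)
    next
      case 3
      have "rat_height 2 = 2" using rat_height_quotient[of 2 1] by simp
      then show ?thesis using 3 neron_tate_gen_bounds(3) by (simp add: ell_mult_2_gen)
    next
      case 4
      have "ln (hgt (ell_mult a gen)) \<le> 2 * neron_tate (ell_mult a gen) + ln 265 / 3"
        using neron_tate_bounds(3)[OF ell_mult_in[OF gen_in_ell_curve], of a] by simp
      also have "\<dots> = 2 * (real_of_int a ^ 2 * neron_tate gen) + ln 265 / 3"
        unfolding neron_tate_mult[OF gen_in_ell_curve] ..
      finally have 1: "ln (hgt (ell_mult a gen)) \<le> 2 * (real_of_int a ^ 2 * neron_tate gen) + ln 265 / 3" .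
      have "3 ^ 2 \<le> real_of_int a ^ 2" using 4 by (intro power_mono) auto
      then have "9 * neron_tate gen \<le> real_of_int a ^ 2 * neron_tate gen"
        using neron_tate_gen_bounds(4) by (intro mult_right_mono) auto
      moreover have "9 / 2 * neron_tate gen * real_of_int a ^ 2 = 9 / 2 * (real_of_int a ^ 2 * neron_tate gen)" by simp
      ultimately show ?thesis using 1 neron_tate_gen_bounds(1) by linarith
    qed
  qed
  from this[of a] this[of "- a"] show ?thesis by (cases "a \<ge> 0") (auto simp: hgt_mult_neg)
qed

section \<open>Rational points\<close>

text \<open>Both sides of p^n / q^(2n) = u / t^3 are in lowest terms with positive denominators, so
  numerators and denominators agree separately.\<close>

lemma power_curve_fractions:
  fixes x1 y1 x2 y2 :: rat
  assumes c1: "y1 ^ 2 = x1 ^ 3 + x1 - 1" and c2: "y2 ^ 2 = x2 ^ 3 + x2 - 1" and e: "x1 ^ n = y2"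
  obtains p r q s u t :: int where "q > 0" "p > 0" "r \<noteq> 0" "coprime p q" "coprime r q"
    "x1 = of_int p / of_int q ^ 2" "y1 = of_int r / of_int q ^ 3" "rat_height x1 = max p (q ^ 2)"
    "t > 0" "s > 0" "u > 0" "coprime s t" "coprime u t"
    "x2 = of_int s / of_int t ^ 2" "y2 = of_int u / of_int t ^ 3" "rat_height x2 = max s (t ^ 2)"
    "u ^ 2 = s ^ 3 + s * t ^ 4 - t ^ 6" "p ^ n = u" "q ^ (2 * n) = t ^ 3"
proof -
  obtain p r q :: int where 1: "q > 0" "coprime p q" "coprime r q" "x1 = of_int p / of_int q ^ 2" "y1 = of_int r / of_int q ^ 3"
    using curve_lowest_terms[OF c1] by metis
  obtain s u t :: int where 2: "t > 0" "coprime s t" "coprime u t" "x2 = of_int s / of_int t ^ 2" "y2 = of_int u / of_int t ^ 3"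
    "u ^ 2 = s ^ 3 + s * t ^ 4 - t ^ 6"
    using curve_lowest_terms[OF c2] by metis
  have p: "p > 0" using curve_pos[OF c1] 1 by (simp add: zero_less_divide_iff)
  have s: "s > 0" using curve_pos[OF c2] 2 by (simp add: zero_less_divide_iff)
  have "y2 > 0" unfolding e[symmetric] using curve_pos[OF c1] by simp
  then have u: "u > 0" using 2 by (simp add: zero_less_divide_iff)
  have r: "r \<noteq> 0" using no_two_torsion[OF c1] 1 by auto
  have "(of_int p :: rat) ^ n / of_int q ^ (2 * n) = of_int u / of_int t ^ 3"
    using e unfolding 1(4) 2(5) by (simp add: power_divide flip: power_mult)
  then have "(of_int (p ^ n * t ^ 3) :: rat) = of_int (u * q ^ (2 * n))"
    using 1(1) 2(1) by (simp add: frac_eq_eq)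
  then have eq: "p ^ n * t ^ 3 = u * q ^ (2 * n)" by (simp only: of_int_eq_iff)
  have "t ^ 3 dvd q ^ (2 * n)"
  proof -
    have "t ^ 3 dvd u * q ^ (2 * n)" unfolding eq[symmetric] by simp
    moreover have "coprime (t ^ 3) u" using 2(3) by (simp add: coprime_commute)
    ultimately show ?thesis by (simp add: coprime_dvd_mult_right_iff)
  qed
  moreover have "q ^ (2 * n) dvd t ^ 3"
  proof -
    have "q ^ (2 * n) dvd p ^ n * t ^ 3" unfolding eq by simp
    moreover have "coprime (q ^ (2 * n)) (p ^ n)" using 1(2) by (simp add: coprime_commute)
    ultimately show ?thesis by (simp add: coprime_dvd_mult_right_iff)
  qed
  ultimately have qt: "q ^ (2 * n) = t ^ 3" using 1(1) 2(1) by (intro zdvd_antisym_nonneg) auto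
  then have "p ^ n = u" using eq 2(1) by simp
  moreover have "rat_height x1 = max p (q ^ 2)" "rat_height x2 = max s (t ^ 2)"
    using rat_height_quotient[of p "q ^ 2"] rat_height_quotient[of s "t ^ 2"] 1 2 p s by simp_all
  ultimately show thesis using that 1 2 p s u r qt by blast
qed

lemma z_square_bounds:
  fixes x y :: rat
  assumes c: "y ^ 2 = x ^ 3 + x - 1" and x: "x \<ge> 1"
  shows "x * (x / y) ^ 2 \<le> 1" "1 \<le> 2 * x * (x / y) ^ 2" "x ^ 3 \<le> y ^ 2" "y ^ 2 \<le> 2 * x ^ 3"
proof -
  have "x ^ 1 \<le> x ^ 3" using x by (intro power_increasing) auto
  then show 1: "x ^ 3 \<le> y ^ 2" and 2: "y ^ 2 \<le> 2 * x ^ 3" unfolding c using x by simp_all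
  have y: "y ^ 2 > 0" using no_two_torsion[OF c] by simp
  have "x * (x / y) ^ 2 = x ^ 3 / y ^ 2" by (simp add: power_divide power2_eq_square power3_eq_cube)
  then show "x * (x / y) ^ 2 \<le> 1" "1 \<le> 2 * x * (x / y) ^ 2" using 1 2 y by (simp_all add: mult.assoc)
qed

section \<open>Bounds for a point of the curve with affine coordinates\<close>

context
  fixes n :: nat and x1 y1 x2 y2 :: rat and a b :: int
  assumes n: "n \<ge> 1" and P: "Aff x1 y1 \<in> ell_curve" and Q: "Aff x2 y2 \<in> ell_curve" and e: "x1 ^ n = y2"
    and a: "Aff x1 y1 = ell_mult a gen" and b: "Aff x2 y2 = ell_mult b gen"
begin

text \<open>If s \<ge> t^2, then s^3 \<le> u^2 = p^(2n). Otherwise the height of x2 is t^2, and t^6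
  = q^(4n). No constant is lost, so none will be multiplied by n.\<close>

lemma power_curve_height:
  shows "hgt (Aff x2 y2) ^ 3 \<le> hgt (Aff x1 y1) ^ (2 * n)"
proof -
  have c: "y1 ^ 2 = x1 ^ 3 + x1 - 1" "y2 ^ 2 = x2 ^ 3 + x2 - 1" using P Q by (simp_all add: ell_curve_Aff)
  obtain p q s u t :: int where *: "q > 0" "p > 0" "rat_height x1 = max p (q ^ 2)" "t > 0" "s > 0"
    "rat_height x2 = max s (t ^ 2)" "u ^ 2 = s ^ 3 + s * t ^ 4 - t ^ 6" "p ^ n = u" "q ^ (2 * n) = t ^ 3"
    using power_curve_fractions[OF c e] by metis
  define M where "M = max p (q ^ 2)"
  have M: "p \<le> M" "q ^ 2 \<le> M" by (simp_all add: M_def)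
  have "p ^ (2 * n) \<le> M ^ (2 * n)" using * M by (intro power_mono) auto
  then have u: "u ^ 2 \<le> M ^ (2 * n)" unfolding *(8)[symmetric] by (simp add: power_mult[symmetric] mult.commute)
  have "(q ^ 2) ^ (2 * n) \<le> M ^ (2 * n)" using M by (intro power_mono) auto
  moreover have "(q ^ 2) ^ (2 * n) = t ^ 6"
  proof -
    have "(q ^ 2) ^ (2 * n) = (q ^ (2 * n)) ^ 2" by (simp only: power_mult[symmetric] mult.commute)
    also have "\<dots> = t ^ 6" unfolding *(9) by (simp flip: power_mult)
    finally show ?thesis .
  qed
  ultimately have t: "t ^ 6 \<le> M ^ (2 * n)" by simp
  have "max s (t ^ 2) ^ 3 \<le> M ^ (2 * n)"
  proof (cases "t ^ 2 \<le> s")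
    case True
    have "t ^ 2 * t ^ 4 \<le> s * t ^ 4" using True by (intro mult_right_mono) auto
    moreover have "t ^ 2 * t ^ 4 = t ^ 6" by (simp flip: power_add)
    ultimately have "s ^ 3 \<le> u ^ 2" unfolding *(7) by linarith
    then show ?thesis using u True by simp
  next
    case False
    then have "max s (t ^ 2) ^ 3 = t ^ 6" by (simp flip: power_mult)
    then show ?thesis using t by simp
  qed
  then show ?thesis using * by (simp add: M_def)
qed

text \<open>Computing the valuation of z at [b][a]g = [a][b]g in two ways gives v(q) + v(b) = v(t) +
  v(a), where v(t) = 2n/3 v(q). For n = 1 this means v(q)/3 = v(a) - v(b); for n \<ge> 2 it gives
  v(q)/3 \<le> v(b) - v(a). Hence the cubes.\<close>

lemma power_curve_denominator:
  shows "\<exists>p q::int. q > 0 \<and> x1 = of_int p / of_int q ^ 2 \<and> rat_height x1 = max p (q ^ 2) \<and> (q dvd a ^ 3 \<or> q dvd b ^ 3)"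
proof -
  have c: "y1 ^ 2 = x1 ^ 3 + x1 - 1" "y2 ^ 2 = x2 ^ 3 + x2 - 1" using P Q by (simp_all add: ell_curve_Aff)
  obtain p r q s u t :: int where 1: "q > 0" "p > 0" "r \<noteq> 0" "coprime p q" "coprime r q"
    "x1 = of_int p / of_int q ^ 2" "y1 = of_int r / of_int q ^ 3" "rat_height x1 = max p (q ^ 2)"
    and 2: "t > 0" "s > 0" "u > 0" "coprime s t" "coprime u t"
    "x2 = of_int s / of_int t ^ 2" "y2 = of_int u / of_int t ^ 3"
    and qt: "q ^ (2 * n) = t ^ 3"
    using power_curve_fractions[OF c e] by metis
  have a0: "a \<noteq> 0" and b0: "b \<noteq> 0" using a b by (auto simp: ell_mult_0)
  have val: "multiplicity l q + multiplicity l b = multiplicity l t + multiplicity l a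
      \<and> 2 * n * multiplicity l q = 3 * multiplicity l t" if l: "prime l" "multiplicity l q \<ge> 1" for l
  proof -
    have "multiplicity l (q ^ (2 * n)) = multiplicity l (t ^ 3)" by (simp only: qt)
    moreover have "multiplicity l (q ^ (2 * n)) = 2 * n * multiplicity l q" "multiplicity l (t ^ 3) = 3 * multiplicity l t"
      using prime_imp_prime_elem[OF l(1)] 1(1) 2(1) by (auto intro!: prime_elem_multiplicity_power_distrib)
    ultimately have m: "2 * n * multiplicity l q = 3 * multiplicity l t" by (simp only:)
    then have "multiplicity l t \<ge> 1" using l n by (metis One_nat_def Suc_leI less_le_trans mult_is_0 neq0_conv not_one_le_zero zero_neq_numeral)
    then have "zval l (multiplicity l t + multiplicity l a) (ell_mult a (Aff x2 y2))"
      using zval_mult_int[OF l(1) Q _ _ a0] zval_fraction[OF l(1) 2(4,5,1)] 2 by simp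
    moreover have "zval l (multiplicity l q + multiplicity l b) (ell_mult b (Aff x1 y1))"
      using zval_mult_int[OF l(1) P _ l(2) b0] zval_fraction[OF l(1) 1(4,5,1,3) refl l(2)] 1 by simp
    moreover have "ell_mult b (Aff x1 y1) = ell_mult a (Aff x2 y2)"
      unfolding a b ell_mult_mult[OF gen_in_ell_curve] by (simp add: mult.commute)
    ultimately have "multiplicity l q + multiplicity l b = multiplicity l t + multiplicity l a"
      using zval_unique[OF l(1)] by metis
    then show ?thesis using m by simp
  qed
  have "q dvd a ^ 3 \<or> q dvd b ^ 3"
  proof (cases "n = 1")
    case True
    have "multiplicity l q \<le> multiplicity l (a ^ 3)" if l: "prime l" for l
      using val[OF l] l a0 True by (cases "multiplicity l q \<ge> 1") (auto simp: prime_elem_multiplicity_power_distrib)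
    then have "q dvd a ^ 3" using 1(1) by (intro multiplicity_le_imp_dvd) auto
    then show ?thesis ..
  next
    case False
    have "multiplicity l q \<le> multiplicity l (b ^ 3)" if l: "prime l" for l
    proof (cases "multiplicity l q \<ge> 1")
      case True
      have "2 * 2 * multiplicity l q \<le> 2 * n * multiplicity l q" using False n by (intro mult_le_mono1 mult_le_mono2) auto
      then have "multiplicity l q \<le> 3 * multiplicity l b" using val[OF l True] by linarith
      also have "\<dots> = multiplicity l (b ^ 3)"
        using prime_elem_multiplicity_power_distrib[OF prime_imp_prime_elem[OF l] b0] by simp
      finally show ?thesis .
    qed simp
    then have "q dvd b ^ 3" using 1(1) by (intro multiplicity_le_imp_dvd) auto
    then show ?thesis ..
  qed
  then show ?thesis using 1 by blast
qed

text \<open>For x \<ge> 1 the abscissa is comparable to z^(-2). If one of the points is too far from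
  the origin for \<open>arch_mult\<close>, this already bounds x1, and the worst case is 2 * 400^3 =
  128000000. If both are close, |b z1| and |a z2| agree up to a factor 3, which contradicts a large
  x1 because x2^3 grows like x1^(2n) and not like x1^3.\<close>

lemma power_curve_x_bound:
  fixes M :: rat
  assumes M: "of_int \<bar>a\<bar> \<le> M" "of_int \<bar>b\<bar> \<le> M"
  shows "x1 \<le> 128000000 * M ^ 12"
proof -
  have c: "y1 ^ 2 = x1 ^ 3 + x1 - 1" "y2 ^ 2 = x2 ^ 3 + x2 - 1" using P Q by (simp_all add: ell_curve_Aff)
  have a0: "a \<noteq> 0" and b0: "b \<noteq> 0" using a b by (auto simp: ell_mult_0)
  define m k where "m = nat \<bar>a\<bar>" and "k = nat \<bar>b\<bar>"
  define A B where "A = (of_nat m :: rat)" and "B = (of_nat k :: rat)"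
  have mk: "m > 0" "k > 0" using a0 b0 by (simp_all add: m_def k_def)
  have A1: "1 \<le> A" "A \<le> M" and B1: "1 \<le> B" "B \<le> M" using mk M by (simp_all add: A_def B_def m_def k_def)
  have M1: "1 \<le> M" using A1 by simp
  have pM: "C * X ^ i \<le> 128000000 * M ^ 12" if "0 \<le> C" "C \<le> 128000000" "1 \<le> X" "X \<le> M" "i \<le> 12" for C X i
  proof -
    have "X ^ i \<le> M ^ i" using that by (intro power_mono) auto
    also have "\<dots> \<le> M ^ 12" using that M1 by (intro power_increasing) auto
    finally show ?thesis using that by (intro mult_mono) auto
  qed
  show ?thesis
  proof (cases "x1 \<ge> 1")
    case False
    then show ?thesis using pM[of 1 1 0] M1 by simp
  next
    case x1: True
    have Y: "y2 ^ 2 = x1 ^ (2 * n)" by (simp add: e[symmetric] power_mult[symmetric] mult.commute)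
    have Y1: "y2 ^ 2 \<ge> 1" unfolding Y using x1 by simp
    have x2: "x2 \<ge> 1"
    proof (rule ccontr)
      assume "\<not> x2 \<ge> 1"
      then have "x2 ^ 3 \<le> 1 ^ 3" using curve_pos[OF c(2)] by (intro power_mono) auto
      then show False using c(2) Y1 \<open>\<not> x2 \<ge> 1\<close> by simp
    qed
    define Z1 Z2 where "Z1 = (x1 / y1) ^ 2" and "Z2 = (x2 / y2) ^ 2"
    have b1: "x1 * Z1 \<le> 1" "1 \<le> 2 * x1 * Z1" using z_square_bounds[OF c(1) x1] by (simp_all add: Z1_def)
    have b2: "x2 * Z2 \<le> 1" "1 \<le> 2 * x2 * Z2" "x2 ^ 3 \<le> y2 ^ 2" "y2 ^ 2 \<le> 2 * x2 ^ 3"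
      using z_square_bounds[OF c(2) x2] by (simp_all add: Z2_def)
    have far: "x \<le> 400 * C ^ 4" if "x * z ^ 2 \<le> 1" "x \<ge> 1" "\<not> \<bar>z\<bar> \<le> 1 / (20 * C ^ 2)" "C \<ge> 1" for x z C :: rat
    proof -
      have "(1 / (20 * C ^ 2)) ^ 2 \<le> z ^ 2" using that by (intro abs_le_square_iff[THEN iffD1]) auto
      then have "x * (1 / (400 * C ^ 4)) \<le> x * z ^ 2"
        using that by (intro mult_left_mono) (simp_all add: power_divide power_mult_distrib flip: power_mult)
      also have "\<dots> \<le> 1" using that by simp
      finally show ?thesis using that by (simp add: field_simps)
    qed
    consider "\<not> \<bar>x1 / y1\<bar> \<le> 1 / (20 * B ^ 2)" | "\<not> \<bar>x2 / y2\<bar> \<le> 1 / (20 * A ^ 2)"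
      | "\<bar>x1 / y1\<bar> \<le> 1 / (20 * B ^ 2)" "\<bar>x2 / y2\<bar> \<le> 1 / (20 * A ^ 2)" by blast
    then show ?thesis
    proof cases
      case 1
      then have "x1 \<le> 400 * B ^ 4" using far b1(1) x1 B1 unfolding Z1_def by blast
      then show ?thesis using pM[of 400 B 4] B1 by simp
    next
      case 2
      then have x2A: "x2 \<le> 400 * A ^ 4" using far b2(1) x2 A1 unfolding Z2_def by blast
      have "x1 ^ 1 \<le> x1 ^ (2 * n)" using x1 n by (intro power_increasing) auto
      also have "\<dots> \<le> 2 * x2 ^ 3" using b2(4) Y by simp
      also have "\<dots> \<le> 2 * (400 * A ^ 4) ^ 3" using x2A x2 by (intro mult_left_mono power_mono) auto
      also have "\<dots> = 128000000 * A ^ 12" by (simp add: power_mult_distrib flip: power_mult)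
      also have "\<dots> \<le> 128000000 * M ^ 12" using pM[of 128000000 A 12] A1 by simp
      finally show ?thesis by simp
    next
      case 3
      define z1 z2 where "z1 = x1 / y1" and "z2 = x2 / y2"
      have zz: "zc (Aff x1 y1) = z1" "zc (Aff x2 y2) = z2" by (simp_all add: z1_def z2_def)
      have m1: "\<bar>zc (ell_mult (int k) (Aff x1 y1)) - B * z1\<bar> \<le> B * \<bar>z1\<bar> / 2"
        using arch_mult[OF P mk(2)] 3(1) unfolding zz B_def z1_def by simp
      have m2: "\<bar>zc (ell_mult (int m) (Aff x2 y2)) - A * z2\<bar> \<le> A * \<bar>z2\<bar> / 2"
        using arch_mult[OF Q mk(1)] 3(2) unfolding zz A_def z2_def by simp
      have "\<bar>zc (ell_mult (int k) (Aff x1 y1))\<bar> = \<bar>zc (ell_mult (int m) (Aff x2 y2))\<bar>"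
      proof -
        \<comment> \<open>\<open>arch_mult\<close> needs positive multipliers. With absolute values
          the two multiples agree only up to sign, which suffices for |z|.\<close>
        have "\<bar>b\<bar> * a = \<bar>a\<bar> * b \<or> \<bar>b\<bar> * a = - (\<bar>a\<bar> * b)" by (auto simp: abs_if)
        then have "zc (ell_mult (\<bar>b\<bar> * a) gen) = zc (ell_mult (\<bar>a\<bar> * b) gen) \<or> zc (ell_mult (\<bar>b\<bar> * a) gen) = - zc (ell_mult (\<bar>a\<bar> * b) gen)"
          by (auto simp: ell_mult_neg zc_neg)
        then show ?thesis unfolding a b ell_mult_mult[OF gen_in_ell_curve] m_def k_def by auto
      qed
      moreover have "\<bar>B * z1\<bar> = B * \<bar>z1\<bar>" "\<bar>A * z2\<bar> = A * \<bar>z2\<bar>" using A1 B1 by (simp_all add: abs_mult)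
      \<comment> \<open>A quantity known up to half its size from either side: 3/2 divided by 1/2 is
        the factor 3.\<close>
      ultimately have "\<bar>B * z1\<bar> / 2 \<le> 3 / 2 * \<bar>A * z2\<bar>" "\<bar>A * z2\<bar> / 2 \<le> 3 / 2 * \<bar>B * z1\<bar>"
        using m1 m2 by linarith+
      then have "\<bar>B * z1\<bar> \<le> \<bar>3 * A * z2\<bar>" "\<bar>A * z2\<bar> \<le> \<bar>3 * B * z1\<bar>" by (simp_all add: abs_mult)
      then have "(B * z1) ^ 2 \<le> (3 * A * z2) ^ 2" "(A * z2) ^ 2 \<le> (3 * B * z1) ^ 2"
        by (simp_all only: abs_le_square_iff)
      then have r1: "B ^ 2 * Z1 \<le> 9 * A ^ 2 * Z2" and r2: "A ^ 2 * Z2 \<le> 9 * B ^ 2 * Z1"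
        unfolding Z1_def Z2_def z1_def[symmetric] z2_def[symmetric] by (simp_all add: power_mult_distrib)
      have cmp: "X' \<le> 18 * X * C ^ 2" if "1 \<le> 2 * X * Z" "X' * Z' \<le> 1" "D ^ 2 * Z \<le> 9 * C ^ 2 * Z'" "1 \<le> D" "1 \<le> X" "1 \<le> X'" for X X' Z Z' C D :: rat
      proof -
        have "1 * X' \<le> D ^ 2 * X'" using that by (intro mult_right_mono) auto
        also have "\<dots> = D ^ 2 * X' * 1" by simp
        also have "\<dots> \<le> D ^ 2 * X' * (2 * X * Z)" using that by (intro mult_left_mono) auto
        also have "\<dots> = 2 * X * X' * (D ^ 2 * Z)" by simp
        also have "\<dots> \<le> 2 * X * X' * (9 * C ^ 2 * Z')" using that by (intro mult_left_mono) auto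
        also have "\<dots> = 18 * X * C ^ 2 * (X' * Z')" by simp
        also have "\<dots> \<le> 18 * X * C ^ 2 * 1" using that by (intro mult_left_mono) auto
        finally show ?thesis by simp
      qed
      show ?thesis
      proof (cases "n = 1")
        case True
        have "x1 \<le> 18 * x2 * B ^ 2" using cmp[OF b2(2) b1(1) r2 A1(1) x2 x1] .
        then have "x1 ^ 3 \<le> (18 * x2 * B ^ 2) ^ 3" using x1 by (intro power_mono) auto
        also have "\<dots> = 5832 * B ^ 6 * x2 ^ 3" by (simp add: power_mult_distrib flip: power_mult)
        also have "\<dots> \<le> 5832 * B ^ 6 * x1 ^ 2"
          using b2(3) Y True by (intro mult_left_mono) auto
        finally have "x1 ^ 2 * x1 \<le> x1 ^ 2 * (5832 * B ^ 6)" by (simp add: power2_eq_square power3_eq_cube mult_ac)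
        then have "x1 \<le> 5832 * B ^ 6" using x1 by (subst (asm) mult_le_cancel_left_pos) auto
        then show ?thesis using pM[of 5832 B 6] B1 by simp
      next
        case False
        have x2x1: "x2 \<le> 18 * x1 * A ^ 2" using cmp[OF b1(2) b2(1) r1 B1(1) x1 x2] .
        have "x1 ^ 4 \<le> x1 ^ (2 * n)" using x1 n False by (intro power_increasing) auto
        also have "\<dots> \<le> 2 * x2 ^ 3" using b2(4) Y by simp
        also have "\<dots> \<le> 2 * (18 * x1 * A ^ 2) ^ 3" using x2x1 x2 by (intro mult_left_mono power_mono) auto
        also have "\<dots> = x1 ^ 3 * (11664 * A ^ 6)" by (simp add: power_mult_distrib flip: power_mult)
        finally have "x1 ^ 3 * x1 \<le> x1 ^ 3 * (11664 * A ^ 6)" by (simp add: power_numeral_reduce mult_ac)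
        then have "x1 \<le> 11664 * A ^ 6" using x1 by (subst (asm) mult_le_cancel_left_pos) auto
        then show ?thesis using pM[of 11664 A 6] A1 by simp
      qed
    qed
  qed
qed

text \<open>The numerator is x1 times q^2, which adds the exponents 12 and 6; q^2 \<le> M^6 comes
  from the divisibility of a cube by q.\<close>

lemma power_curve_height_bound:
  fixes M :: int
  assumes M: "\<bar>a\<bar> \<le> M" "\<bar>b\<bar> \<le> M"
  shows "hgt (Aff x1 y1) \<le> 128000000 * M ^ 18"
proof -
  have a0: "a \<noteq> 0" and b0: "b \<noteq> 0" using a b by (auto simp: ell_mult_0)
  obtain p q where pq: "q > 0" "x1 = of_int p / of_int q ^ 2" "rat_height x1 = max p (q ^ 2)" "q dvd a ^ 3 \<or> q dvd b ^ 3"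
    using power_curve_denominator by blast
  have M1: "1 \<le> M" using a0 M by linarith
  have "q \<le> M ^ 3" if "q dvd c ^ 3" "c \<noteq> 0" "\<bar>c\<bar> \<le> M" for c
  proof -
    have "q dvd \<bar>c\<bar> ^ 3" using that(1) by (simp flip: power_abs)
    then have "q \<le> \<bar>c\<bar> ^ 3" using that(2) by (intro zdvd_imp_le) auto
    also have "\<dots> \<le> M ^ 3" using that by (intro power_mono) auto
    finally show ?thesis .
  qed
  then have "q \<le> M ^ 3" using pq(4) a0 b0 M by blast
  then have "q ^ 2 \<le> (M ^ 3) ^ 2" using pq(1) by (intro power_mono) auto
  then have q6: "q ^ 2 \<le> M ^ 6" by (simp flip: power_mult)
  have "of_int \<bar>a\<bar> \<le> (of_int M :: rat)" "of_int \<bar>b\<bar> \<le> (of_int M :: rat)" using M by (simp_all only: of_int_le_iff)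
  then have "x1 \<le> 128000000 * of_int M ^ 12" by (rule power_curve_x_bound)
  then have "of_int p \<le> 128000000 * of_int M ^ 12 * (of_int q :: rat) ^ 2"
    using pq(1,2) by (simp add: field_simps)
  also have "\<dots> = of_int (128000000 * M ^ 12 * q ^ 2)" by simp
  finally have "p \<le> 128000000 * M ^ 12 * q ^ 2" by (simp only: of_int_le_iff)
  also have "\<dots> \<le> 128000000 * M ^ 12 * M ^ 6" using q6 M1 by (intro mult_left_mono) auto
  also have "\<dots> = 128000000 * (M ^ 12 * M ^ 6)" by simp
  also have "M ^ 12 * M ^ 6 = M ^ 18" by (simp flip: power_add)
  finally have p: "p \<le> 128000000 * M ^ 18" .
  have "M ^ 6 \<le> M ^ 18" using M1 by (intro power_increasing) auto
  moreover have "0 \<le> M ^ 18" by simp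
  ultimately have "q ^ 2 \<le> 128000000 * M ^ 18" using q6 by linarith
  then show ?thesis using pq(3) p by simp
qed


text \<open>The heights satisfy 3 h(x2) \<le> 2n h(x1). Both h(x1) and the error ln 10 are measured
  in units of the canonical height of g, which then cancels.\<close>

lemma power_curve_b_bound:
  shows "real_of_int b ^ 2 \<le> 3 / 2 * real n * real_of_int a ^ 2 + 10"
proof -
  define G where "G = neron_tate gen"
  have G: "G \<ge> 1 / 100" "ln 10 \<le> 60 * G" using neron_tate_gen_bounds by (simp_all add: G_def)
  define h1 h2 where "h1 = ln (real_of_int (hgt (Aff x1 y1)))" and "h2 = ln (real_of_int (hgt (Aff x2 y2)))"
  have "real_of_int (hgt (Aff x2 y2)) ^ 3 \<le> real_of_int (hgt (Aff x1 y1)) ^ (2 * n)"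
    using power_curve_height[THEN of_int_le_iff[where 'a = real, THEN iffD2]] by simp
  then have "ln (real_of_int (hgt (Aff x2 y2)) ^ 3) \<le> ln (real_of_int (hgt (Aff x1 y1)) ^ (2 * n))"
    using hgt_ge_1[of "Aff x2 y2"] hgt_ge_1[of "Aff x1 y1"] by (subst ln_le_cancel_iff) auto
  then have h: "3 * h2 \<le> 2 * (real n * h1)"
    using hgt_ge_1[of "Aff x2 y2"] hgt_ge_1[of "Aff x1 y1"] by (simp add: h1_def h2_def ln_realpow)
  have "h1 \<le> 9 / 2 * G * real_of_int a ^ 2" unfolding h1_def a G_def by (rule ln_hgt_multiple_le)
  then have "real n * h1 \<le> real n * (9 / 2 * G * real_of_int a ^ 2)" by (intro mult_left_mono) auto
  moreover have "neron_tate (Aff x2 y2) \<le> (h2 + ln 10 / 3) / 2"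
    unfolding h2_def by (rule neron_tate_bounds(2)[OF Q])
  moreover have "neron_tate (Aff x2 y2) = real_of_int b ^ 2 * G"
    unfolding b G_def by (rule neron_tate_mult[OF gen_in_ell_curve])
  ultimately have "3 * (real_of_int b ^ 2 * G) \<le> real n * (9 / 2 * G * real_of_int a ^ 2) + 30 * G"
    using h G(2) by simp
  then have "(3 * G) * real_of_int b ^ 2 \<le> (3 * G) * (3 / 2 * real n * real_of_int a ^ 2 + 10)"
    by (simp add: algebra_simps)
  then show ?thesis using G(1) by (subst (asm) mult_le_cancel_left_pos) auto
qed

text \<open>A large |a| dominates n as well, so the bound for b gives |b| \<le> a^2 and M = a^2 is
  admissible. The height of x1 is then at most |a|^38, while the canonical height grows like a^2;
  even ln A \<le> A - 1 separates the two.\<close>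

lemma power_curve_a_bound:
  shows "\<bar>real_of_int a\<bar> \<le> 10 ^ 6 * (real n + 1)"
proof (rule ccontr)
  assume "\<not> \<bar>real_of_int a\<bar> \<le> 10 ^ 6 * (real n + 1)"
  define A where "A = real_of_int \<bar>a\<bar>"
  have A: "A > 1000000 * (real n + 1)" using \<open>\<not> _\<close> by (simp add: A_def)
  have A6: "A \<ge> 1000000" "real n \<le> A / 1000000" using A by (simp_all add: field_simps)
  have "real_of_int b ^ 2 \<le> 3 / 2 * real n * A ^ 2 + 10"
    using power_curve_b_bound by (simp add: A_def)
  also have "\<dots> \<le> 3 / 2 * (A / 1000000) * A ^ 2 + 10"
    using A6 by (intro add_right_mono mult_right_mono mult_left_mono) auto
  also have "\<dots> \<le> A ^ 3"
  proof -
    have "1 ^ 3 \<le> (A / 1000000) ^ 3" using A6 by (intro power_mono) auto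
    then have "1000000 * 1000000 * 1000000 \<le> A ^ 3" by (simp add: power_divide)
    moreover have "3 / 2 * (A / 1000000) * A ^ 2 = 3 / 2000000 * A ^ 3" by (simp add: power2_eq_square power3_eq_cube)
    ultimately show ?thesis by linarith
  qed
  also have "\<dots> \<le> A ^ 4" using A6 by (intro power_increasing) auto
  finally have "real_of_int b ^ 2 \<le> (A ^ 2) ^ 2" by (simp flip: power_mult)
  then have bA: "\<bar>real_of_int b\<bar> \<le> A ^ 2" using abs_le_square_iff[of "real_of_int b" "A ^ 2"] by simp
  define M where "M = \<bar>a\<bar> ^ 2"
  have rM: "real_of_int M = A ^ 2" by (simp add: M_def A_def)
  have "1 * \<bar>a\<bar> \<le> \<bar>a\<bar> * \<bar>a\<bar>" using A6 unfolding A_def by (intro mult_right_mono) linarith+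
  then have "\<bar>a\<bar> \<le> M" by (simp add: M_def power2_eq_square)
  moreover have "real_of_int \<bar>b\<bar> \<le> real_of_int M" unfolding rM using bA by simp
  then have "\<bar>b\<bar> \<le> M" by (simp only: of_int_le_iff)
  ultimately have "hgt (Aff x1 y1) \<le> 128000000 * M ^ 18" by (rule power_curve_height_bound)
  then have "real_of_int (hgt (Aff x1 y1)) \<le> real_of_int (128000000 * M ^ 18)" by (simp only: of_int_le_iff)
  also have "\<dots> = 128000000 * A ^ 36" by (simp add: rM flip: power_mult)
  also have "\<dots> \<le> A ^ 2 * A ^ 36"
  proof (intro mult_right_mono)
    have "1000000 ^ 2 \<le> A ^ 2" using A6 by (intro power_mono) auto
    then show "128000000 \<le> A ^ 2" by simp
  qed (use A6 in auto)
  also have "\<dots> = A ^ 38" by (simp flip: power_add)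
  finally have "ln (real_of_int (hgt (Aff x1 y1))) \<le> ln (A ^ 38)"
    using hgt_ge_1[of "Aff x1 y1"] A6 by (subst ln_le_cancel_iff) auto
  also have "\<dots> = 38 * ln A" using A6 by (simp add: ln_realpow)
  finally have 1: "ln (real_of_int (hgt (Aff x1 y1))) \<le> 38 * ln A" .
  have "neron_tate (Aff x1 y1) \<le> (ln (real_of_int (hgt (Aff x1 y1))) + ln 10 / 3) / 2"
    by (rule neron_tate_bounds(2)[OF P])
  moreover have "ln 10 \<le> ln A" "ln A \<le> A - 1" using A6 by (auto intro: ln_le_minus_one)
  ultimately have "neron_tate (Aff x1 y1) \<le> 20 * A" using 1 A6(1) by argo
  moreover have "neron_tate (Aff x1 y1) = A ^ 2 * neron_tate gen"
    unfolding a neron_tate_mult[OF gen_in_ell_curve] by (simp add: A_def)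
  moreover have "A ^ 2 * (1 / 100) \<le> A ^ 2 * neron_tate gen"
    using neron_tate_gen_bounds(4) by (intro mult_left_mono) auto
  ultimately have "A ^ 2 * (1 / 100) \<le> 20 * A" by linarith
  moreover have "1000000 * A \<le> A * A" using A6 by (intro mult_right_mono) auto
  ultimately show False using A6 by (simp add: power2_eq_square)
qed

end

theorem theorem1p4:
  fixes n :: nat and P :: "rat point \<times> rat point"
  assumes "n \<ge> 1" and "P \<in> rational_C n"
  shows "neron_tate2 P \<le> 8.253 * 10 ^ 38 * (real n + 1) ^ 3 \<and>
    (\<exists>a b. P = (ell_mult a gen, ell_mult b gen)) \<and>
    (\<forall>a b. P = (ell_mult a gen, ell_mult b gen) \<longrightarrow>
      \<bar>real_of_int a\<bar> \<le> 7.037 * 10 ^ 19 * (real n + 1) \<and>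
      \<bar>real_of_int b\<bar> \<le> sqrt (3 * real n * (real_of_int a) ^ 2 / 2 + 14 * ln 2 + 10))"
proof -
  obtain P1 P2 where PP: "P = (P1, P2)" by (cases P)
  have bounds: "\<bar>real_of_int a\<bar> \<le> 10 ^ 6 * (real n + 1) \<and> real_of_int b ^ 2 \<le> 3 / 2 * real n * real_of_int a ^ 2 + 10"
    if ab: "P = (ell_mult a gen, ell_mult b gen)" for a b
    using rational_C_cases[OF assms(1) assms(2)[unfolded PP]]
  proof
    assume "P1 = Infty \<and> P2 = Infty"
    then have "a = 0" "b = 0" using ab PP ell_mult_gen_eq_Infty by auto
    then show ?thesis by simp
  next
    assume "\<exists>x1 y1 x2 y2. P1 = Aff x1 y1 \<and> P2 = Aff x2 y2 \<and>
      y1 ^ 2 = x1 ^ 3 + x1 - 1 \<and> y2 ^ 2 = x2 ^ 3 + x2 - 1 \<and> x1 ^ n = y2"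
    then obtain x1 y1 x2 y2 where *: "P1 = Aff x1 y1" "P2 = Aff x2 y2"
      "y1 ^ 2 = x1 ^ 3 + x1 - 1" "y2 ^ 2 = x2 ^ 3 + x2 - 1" "x1 ^ n = y2" by blast
    have "Aff x1 y1 \<in> ell_curve" "Aff x2 y2 \<in> ell_curve" using *(3,4) by (simp_all add: ell_curve_Aff)
    moreover have "Aff x1 y1 = ell_mult a gen" "Aff x2 y2 = ell_mult b gen" using ab PP * by simp_all
    ultimately show ?thesis
      using power_curve_a_bound[OF assms(1) _ _ *(5)] power_curve_b_bound[OF assms(1) _ _ *(5)] by blast
  qed
  have "P1 \<in> ell_curve \<and> P2 \<in> ell_curve"
    using rational_C_cases[OF assms(1) assms(2)[unfolded PP]] Infty_in_ell_curve by (auto simp: ell_curve_Aff)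
  then obtain a b where ab: "P = (ell_mult a gen, ell_mult b gen)" using mordell_weil PP by blast
  define N where "N = real n + 1"
  have N: "N \<ge> 1" by (simp add: N_def)
  have a2: "real_of_int a ^ 2 \<le> 10 ^ 12 * N ^ 2"
  proof -
    have "\<bar>real_of_int a\<bar> ^ 2 \<le> (10 ^ 6 * N) ^ 2" using bounds[OF ab] unfolding N_def by (intro power_mono) auto
    then show ?thesis by (simp add: power_mult_distrib)
  qed
  have "neron_tate2 P = (real_of_int a ^ 2 + real_of_int b ^ 2) * neron_tate gen"
    unfolding ab neron_tate2_def by (simp add: neron_tate_mult[OF gen_in_ell_curve] distrib_right)
  also have "\<dots> \<le> (real_of_int a ^ 2 + real_of_int b ^ 2) * 1"
    using neron_tate_gen_bounds(5) by (intro mult_left_mono) auto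
  \<comment> \<open>The cubic growth in n + 1 comes from n a^2, with |a| at most a multiple of n +
    1.\<close>
  also have "\<dots> \<le> 10 ^ 12 * N ^ 2 + (3 / 2 * N * (10 ^ 12 * N ^ 2) + 10)"
  proof -
    have "real n * real_of_int a ^ 2 \<le> N * (10 ^ 12 * N ^ 2)" using a2 by (intro mult_mono) (auto simp: N_def)
    then show ?thesis using bounds[OF ab] a2 by (simp add: mult.assoc)
  qed
  also have "\<dots> \<le> 8.253 * 10 ^ 38 * N ^ 3"
  proof -
    have "N ^ 2 \<le> N ^ 3" "N ^ 0 \<le> N ^ 3" using N by (intro power_increasing; simp)+
    moreover have "3 / 2 * N * (10 ^ 12 * N ^ 2) = 3 / 2 * 10 ^ 12 * N ^ 3" by (simp add: power2_eq_square power3_eq_cube)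
    ultimately show ?thesis by simp
  qed
  finally have "neron_tate2 P \<le> 8.253 * 10 ^ 38 * (real n + 1) ^ 3" by (simp only: N_def)
  moreover have "\<bar>real_of_int a\<bar> \<le> 7.037 * 10 ^ 19 * (real n + 1) \<and>
      \<bar>real_of_int b\<bar> \<le> sqrt (3 * real n * (real_of_int a) ^ 2 / 2 + 14 * ln 2 + 10)"
    if "P = (ell_mult a gen, ell_mult b gen)" for a b
  proof
    have "10 ^ 6 * (real n + 1) \<le> 7.037 * 10 ^ 19 * (real n + 1)" by (intro mult_right_mono) auto
    then show "\<bar>real_of_int a\<bar> \<le> 7.037 * 10 ^ 19 * (real n + 1)" using bounds[OF that] by linarith
    have "\<bar>real_of_int b\<bar> ^ 2 \<le> 3 * real n * (real_of_int a) ^ 2 / 2 + 14 * ln 2 + 10"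
    proof -
      have "0 \<le> ln (2::real)" by simp
      moreover have "real_of_int b ^ 2 \<le> 3 / 2 * real n * real_of_int a ^ 2 + 10" using bounds[OF that] by blast
      ultimately show ?thesis unfolding power2_abs by linarith
    qed
    then show "\<bar>real_of_int b\<bar> \<le> sqrt (3 * real n * (real_of_int a) ^ 2 / 2 + 14 * ln 2 + 10)"
      by (rule real_le_rsqrt)
  qed
  ultimately show ?thesis using ab by blast
qed

end
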